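(* Let $m\in\mathbb{Z}_{\ge 0}$ and let $a,b\in\mathbb{C}\setminus\mathbb{Z}$. Define $$U_1=(-1)^{m+1}\,m!\,\frac{\Gamma(a-m)\,\Gamma(b-m)}{\Gamma(a+b-m)}\;{}_2F_1\!\left(a,b;\,a+b-m;\,1-z\right).$$ Write $F={}_2F_1(a,b;\,m+1;\,z)$. Then $U_1$ (a function on the upper half-plane) has the following expressions: (1) $$U_1=(-1)^{m+1}m!\,\frac{\Gamma(1-a)\Gamma(1-b)}{\Gamma(m+2-a-b)}(1-z)^{m+1-a-b}\,{}_2F_1(m+1-a,\,m+1-b;\,m+2-a-b;\,1-z)-\frac{\pi\sin\pi(a+b)}{\sin\pi a\,\sin\pi b}\,F;$$ (2) $$U_1=(-1)^{m+1}m!\,\frac{\Gamma(a-m)\Gamma(1-b)}{\Gamma(1+a-b)}(-z)^{-a}\,{}_2F_1\!\left(a,\,a-m;\,1+a-b;\,\tfrac1z\right)-\frac{\pi e^{-i\pi b}}{\sin\pi b}\,F;$$ (3) $$U_1=F\log z+\frac{(-1)^{m+1}m!\,(m-1)!}{(1-a)_m(1-b)_m}\,z^{-m}\sum_{k=0}^{m-1}\frac{(a-m)_k(b-m)_k}{(1-m)_k\,k!}z^k+\sum_{k=0}^{\infty}\frac{(a)_k(b)_k}{(m+1)_k\,k!}\big(\psi(a+k)+\psi(b+k)-\psi(m+k+1)-\psi(k+1)\big)z^k;$$ (4) $$\begin{aligned}U_1={}&F\log z-\frac{\pi\sin\pi(a+b)}{\sin\pi a\,\sin\pi b}\,F+\frac{(-1)^{m+1}m!\,(m-1)!}{(1-a)_m(1-b)_m}\,z^{-m}(1-z)^{m+1-a-b}\sum_{k=0}^{m-1}\frac{(1-a)_k(1-b)_k}{(1-m)_k\,k!}z^k\\&+(1-z)^{m+1-a-b}\sum_{k=0}^{\infty}\frac{(m+1-a)_k(m+1-b)_k}{(m+1)_k\,k!}\big(\psi(m+k+1-a)+\psi(m+k+1-b)-\psi(m+k+1)-\psi(k+1)\big)z^k;\end{aligned}$$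 (5) $$\begin{aligned}U_1={}&F\log\frac{z}{1-z}-\frac{\pi}{\tan\pi b}\,F+\frac{(-1)^{m+1}m!\,(m-1)!}{(1-a)_m(1-b)_m}\,z^{-m}(1-z)^{m-a}\sum_{k=0}^{m-1}\frac{(a-m)_k(1-b)_k}{(1-m)_k\,k!}\frac{z^k}{(z-1)^k}\\&+(1-z)^{-a}\sum_{k=0}^{\infty}\frac{(a)_k(m+1-b)_k}{(m+1)_k\,k!}\big(\psi(a+k)+\psi(m+k+1-b)-\psi(m+k+1)-\psi(k+1)\big)\frac{z^k}{(z-1)^k}.\end{aligned}$$
   Context: ${}_2F_1(a,b;c;z)=\sum_{k\ge0}\frac{(a)_k(b)_k}{(c)_k\,k!}z^k$ is the Gauss hypergeometric function (analytically continued), $(x)_k=x(x+1)\cdots(x+k-1)$, and $\psi(x)=\Gamma'(x)/\Gamma(x)$. All identities are between analytic functions on the upper half-plane $\{\operatorname{Im} z>0\}$, with $\log$ and complex powers taking principal values and all hypergeometric functions being the principal analytic continuations. An expression with an explicit infinite series is asserted where that series converges ($|z|<1$ for series in $z$, $|z/(z-1)|<1$ for series in $z/(z-1)$), and elsewhere by analytic continuation. A quotient $\frac{1}{\Gamma(\gamma)}\,{}_2F_1(\alpha,\beta;\gamma;x)$ with $\gamma\in\mathbb{Z}_{\le0}$ is understood as its limit, i.e. as $\sum_k\frac{(\alpha)_k(\beta)_k}{\Gamma(\gamma+k)\,k!}x^k$ (continued analytically). For $m=0$, every term containing a sum $\sum_{k=0}^{m-1}$ is taken to be $0$. *)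

theory Defs
  imports "HOL-Complex_Analysis.Complex_Analysis"
begin

text \<open>
  \<open>S\<close> is an analytic continuation to \<open>D\<close> of the function that is given on \<open>A\<close> by the convergent
  series of the terms \<open>t k z\<close>. In all uses below \<open>A\<close> is a nonempty open subset of the connected
  open set \<open>D\<close>, so that \<open>S\<close> is uniquely determined on \<open>D\<close>.
\<close>
definition continues_series ::
    "(nat \<Rightarrow> complex \<Rightarrow> complex) \<Rightarrow> complex set \<Rightarrow> complex set \<Rightarrow> (complex \<Rightarrow> complex) \<Rightarrow> bool" where
  "continues_series t A D S \<longleftrightarrow> S holomorphic_on D \<and> (\<forall>z\<in>A. (\<lambda>k. t k z) sums S z)"

definition slit_plane :: "complex set" where
  "slit_plane = - {complex_of_real x | x. x \<ge> 1}"

text \<open>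
  The principal branch, i.e. the continuation of the power series from the unit disc to the plane
  cut along \<open>[1, \<infinity>)\<close>. Values on the cut are unspecified.
\<close>
definition principal_continuation :: "(nat \<Rightarrow> complex) \<Rightarrow> complex \<Rightarrow> complex" where
  "principal_continuation f =
     (SOME S. continues_series (\<lambda>k z. f k * z ^ k) (ball 0 1) slit_plane S)"

text \<open>Meaningful only if \<open>c\<close> is not a nonpositive integer.\<close>
definition hyp2f1 :: "complex \<Rightarrow> complex \<Rightarrow> complex \<Rightarrow> complex \<Rightarrow> complex" where
  "hyp2f1 a b c =
     principal_continuation (\<lambda>k. pochhammer a k * pochhammer b k / (pochhammer c k * fact k))"

text \<open>
  The quotient \<open>hyp2f1 a b c z / Gamma c\<close>, which at the poles of \<open>Gamma\<close> is understood as its limit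
  in \<open>c\<close>. Note that \<open>rGamma\<close> is the entire function \<open>1 / Gamma\<close>.
\<close>
definition hyp2f1_over_Gamma :: "complex \<Rightarrow> complex \<Rightarrow> complex \<Rightarrow> complex \<Rightarrow> complex" where
  "hyp2f1_over_Gamma a b c z =
     (if c \<in> \<int>\<^sub>\<le>\<^sub>0
      then principal_continuation
             (\<lambda>k. pochhammer a k * pochhammer b k * rGamma (c + of_nat k) / fact k) z
      else hyp2f1 a b c z / Gamma c)"

definition upper_half_plane :: "complex set" where
  "upper_half_plane = {z. Im z > 0}"

end

theory Submission
  imports Defs "HOL-Real_Asymp.Real_Asymp"
begin

text \<open>
  All functions in the theorem solve the hypergeometric equation with parameters \<open>a\<close>, \<open>b\<close>,
  \<open>c = m + 1\<close>. Two ideas reduce the theorem to one asymptotic computation.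

  First, \<open>d/dz\<close> sends each of these functions with parameters \<open>(m, a, b)\<close> to the function of the
  same kind with parameters \<open>(m + 1, a + 1, b + 1)\<close>, up to the factor \<open>a b / (m + 1)\<close>, which is the
  same for all of them. Since \<open>a\<close> and \<open>b\<close> are not integers, this factor never vanishes, and an
  identity for \<open>m = 0\<close> and all \<open>a\<close>, \<open>b\<close> yields the identity for all \<open>m\<close> (\<open>raise_identity\<close>). The polar
  part \<open>z\<^sup>-\<^sup>m \<Sum>\<dots>\<close> of the logarithmic expansions is produced by differentiating \<open>F log z\<close>.

  Second, for \<open>m = 0\<close> everything follows from \<open>U\<^sub>1 = F log z + S\<close> with a power series \<open>S\<close>
  (\<open>U0_eq_log_sol\<close>). Both sides solve the equation, and so by the Wronskian with \<open>F\<close> they satisfy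
  \<open>U\<^sub>1 = \<kappa> (F log z + S) + \<beta> F\<close>; comparison for \<open>z \<rightarrow> 0+\<close> shows \<open>\<kappa> = 1\<close>, \<open>\<beta> = 0\<close>. This needs the
  constant term in the behaviour of the zero-balanced series \<open>\<Gamma>(a) \<Gamma>(b) / \<Gamma>(a + b) F(a, b; a + b; x)\<close>
  for \<open>x \<rightarrow> 1-\<close>, namely \<open>- \<psi>(a) - \<psi>(b) - 2 \<gamma>\<close> next to \<open>- log (1 - x)\<close>
  (\<open>zero_balanced_limit_always\<close>). A recurrence in \<open>a\<close> and \<open>b\<close> moves the parameters far to the right,
  where Euler's integral is available.

  In the connection formulas without logarithms, for \<open>m = 0\<close>, the difference of \<open>U\<^sub>1\<close> and the other
  Kummer solution (at \<open>1\<close> or at \<open>\<infinity>\<close>) is a function in which the logarithms cancel.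
  The difference is therefore a solution that is analytic at \<open>0\<close>, hence a multiple of \<open>F\<close>, and the
  factor is its value at \<open>0\<close>, which the reflection formula of the digamma function turns into trigonometric functions. Of the three logarithmic formulas, the first is the
  expansion above; the second arises from it by Euler's transformation and the connection formula
  at \<open>1\<close>, the third, by Pfaff's transformation and the connection formula at \<open>\<infinity>\<close>, from the
  expansion at the point \<open>z / (z - 1)\<close>.

  Throughout, \<open>reg_hyp a b c\<close> is the regularised function \<open>F(a, b; c; z) / \<Gamma>(c)\<close>, which is entire in \<open>c\<close>, so
  that no parameter has to be excluded. Its continuation to the slit plane is given by Euler's
  integral for large \<open>b\<close> and \<open>c - b\<close>, from where contiguous relations lower \<open>b\<close> and \<open>c\<close>.
\<close>


section \<open>The Beta integral with complex parameters\<close>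

lemma continuous_on_real_powr:
  fixes s :: complex
  assumes "Re s > 0"
  shows "continuous_on {0..1} (\<lambda>t::real. complex_of_real t powr s)"
    and "continuous_on {0..1} (\<lambda>t::real. complex_of_real (1 - t) powr s)"
  using assms by (auto intro!: continuous_on_powr_complex continuous_intros)

lemma continuous_on_mult_Ln:
  "continuous_on {0..1} (\<lambda>t::real. complex_of_real t * Ln (complex_of_real t))"
proof -
  have "continuous_on {0..1} (\<lambda>t::real. t * ln t)"
    unfolding continuous_on_def
  proof
    fix t :: real assume t: "t \<in> {0..1}"
    show "((\<lambda>t. t * ln t) \<longlongrightarrow> t * ln t) (at t within {0..1})"
    proof (cases "t = 0")
      case True
      have "((\<lambda>t::real. t * ln t) \<longlongrightarrow> 0) (at_right 0)" by real_asymp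
      thus ?thesis using True by (simp add: at_within_Icc_at_right)
    qed (use t in \<open>auto intro!: tendsto_intros\<close>)
  qed
  hence "continuous_on {0..1} (\<lambda>t::real. complex_of_real (t * ln t))"
    by (intro continuous_on_of_real)
  also have "?this \<longleftrightarrow> ?thesis"
  proof (rule continuous_on_cong)
    fix t :: real assume "t \<in> {0..1}"
    thus "complex_of_real (t * ln t) = complex_of_real t * Ln (complex_of_real t)"
      by (cases "t = 0") (auto simp: Ln_of_real)
  qed auto
  finally show ?thesis .
qed

text \<open>
  Since the Beta integral is known for real parameters, the complex case needs only holomorphy in each
  parameter. The bound \<open>Re a > 2\<close> (instead of \<open>> 0\<close>) leaves the factor \<open>t ln t\<close> in the \<open>a\<close>-derivative of the
  integrand, which keeps it continuous up to \<open>t = 0\<close>.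
\<close>
lemma holomorphic_Mellin:
  fixes g :: "real \<Rightarrow> complex"
  assumes g: "continuous_on {0..1} g"
  shows "(\<lambda>a. integral {0..1} (\<lambda>t. complex_of_real t powr (a - 1) * g t)) holomorphic_on {a. Re a > 2}"
proof -
  have "(\<lambda>a. integral (cbox 0 1) (\<lambda>t. complex_of_real t powr (a - 1) * g t)) holomorphic_on {a. Re a > 2}"
  proof (rule leibniz_rule_holomorphic[where fx = "\<lambda>a t. Ln (complex_of_real t) * complex_of_real t powr (a - 1) * g t"])
    fix a :: complex and t :: real assume a: "a \<in> {a. Re a > 2}" and t: "t \<in> cbox 0 1"
    show "((\<lambda>a. complex_of_real t powr (a - 1) * g t) has_field_derivative
            Ln (complex_of_real t) * complex_of_real t powr (a - 1) * g t) (at a within {a. 2 < Re a})"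
    proof (cases "t = 0")
      case False
      have "((\<lambda>a. complex_of_real t powr (a - 1)) has_field_derivative
              Ln (complex_of_real t) * complex_of_real t powr (a - 1) * 1) (at a within {a. 2 < Re a})"
        by (rule DERIV_chain2[OF has_field_derivative_powr_right])
           (use False in \<open>auto intro!: derivative_eq_intros\<close>)
      from DERIV_cmult_right[OF this, of "g t"] show ?thesis by simp
    qed auto
  next
    fix a :: complex assume "a \<in> {a. Re a > 2}"
    thus "(\<lambda>t. complex_of_real t powr (a - 1) * g t) integrable_on cbox 0 1"
      unfolding interval_cbox [symmetric]
      by (intro integrable_continuous_real continuous_intros continuous_on_real_powr g) auto
  next
    have *: "continuous_on ({a. Re a > 2} \<times> {0..1})
            (\<lambda>x. (complex_of_real (snd x) * Ln (complex_of_real (snd x))) *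
                 complex_of_real (snd x) powr (fst x - 2) * g (snd x))"
      by (intro continuous_intros continuous_on_powr_complex
           continuous_on_compose2[OF continuous_on_mult_Ln] continuous_on_compose2[OF g])  auto
    show "continuous_on ({a. Re a > 2} \<times> cbox 0 1)
            (\<lambda>(a, t). Ln (complex_of_real t) * complex_of_real t powr (a - 1) * g t)"
    proof (subst continuous_on_cong[OF refl])
      fix x :: "complex \<times> real" assume "x \<in> {a. Re a > 2} \<times> cbox 0 1"
      show "(case x of (a, t) \<Rightarrow> Ln (complex_of_real t) * complex_of_real t powr (a - 1) * g t) =
        (complex_of_real (snd x) * Ln (complex_of_real (snd x))) *
                 complex_of_real (snd x) powr (fst x - 2) * g (snd x)"
        by (cases x) (auto simp: powr_diff power2_eq_square field_simps)
    qed (use * in simp)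
  next
    show "convex {a. Re a > 2}" by (rule convex_halfspace_Re_gt)
  qed
  thus ?thesis by simp
qed

lemma half_plane_eqI:
  assumes "f holomorphic_on {a. Re a > 2}" "g holomorphic_on {a. Re a > 2}"
    and "\<And>x::real. x > 2 \<Longrightarrow> f (of_real x) = g (of_real x)" and "Re a > 2"
  shows "f a = g a"
proof -
  have "3 islimpt (complex_of_real ` {2<..})"
    unfolding islimpt_approachable
  proof safe
    fix e :: real assume "e > 0"
    thus "\<exists>x'\<in>complex_of_real ` {2<..}. x' \<noteq> 3 \<and> dist x' 3 < e"
      by (intro bexI[OF _ imageI[of "3 + e/2"]]) (auto simp: dist_norm)
  qed
  have "f a - g a = 0"
  proof (rule analytic_continuation[where f = "\<lambda>a. f a - g a" and w = a and S = "{a. Re a > 2}" and U = "complex_of_real ` {2<..}" and \<xi> = 3])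
    show "open {a. Re a > 2}" by (rule open_halfspace_Re_gt)
    show "connected {a. Re a > 2}" by (intro convex_connected convex_halfspace_Re_gt)
  qed (use assms \<open>3 islimpt _\<close> in \<open>auto intro!: holomorphic_intros\<close>)
  thus ?thesis by simp
qed

lemma nonpos_Ints_Re: "z \<in> \<int>\<^sub>\<le>\<^sub>0 \<Longrightarrow> Re z \<le> 0"
  by (elim nonpos_Ints_cases) auto

lemma Beta_integral_real_complex:
  assumes "Re a > 2" and b: "b > (2::real)"
  shows "integral {0..1} (\<lambda>t. complex_of_real t powr (a - 1) * complex_of_real (1 - t) powr (of_real b - 1))
           = Beta a (of_real b)"
proof -
  have *: "continuous_on {0..1} (\<lambda>t. complex_of_real (1 - t) powr (of_real b - 1))"
    using b by (intro continuous_on_real_powr) auto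
  show ?thesis
  proof (rule half_plane_eqI[OF holomorphic_Mellin[OF *] _ _ assms(1)])
    show "(\<lambda>a. Beta a (of_real b)) holomorphic_on {a. 2 < Re a}"
      unfolding Beta_altdef using b by (intro holomorphic_intros) (auto dest!: nonpos_Ints_Re)
  next
    fix x :: real assume x: "x > 2"
    have "((\<lambda>t. complex_of_real (t powr (x - 1) * (1 - t) powr (b - 1))) has_integral complex_of_real (Beta x b)) {0..1}"
      using has_integral_Beta_real[of x b] x b by (intro has_integral_of_real) auto
    also have "?this \<longleftrightarrow> ((\<lambda>t. complex_of_real t powr (of_real x - 1) * complex_of_real (1 - t) powr (of_real b - 1)) has_integral complex_of_real (Beta x b)) {0..1}"
      by (intro has_integral_cong) (use powr_of_real[of _ "x - 1"] powr_of_real[of "1 - _" "b - 1"] in auto)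
    finally show "integral {0..1} (\<lambda>t. complex_of_real t powr (complex_of_real x - 1) * complex_of_real (1 - t) powr (complex_of_real b - 1)) =
         Beta (complex_of_real x) (complex_of_real b)"
      by (simp add: integral_unique Beta_complex_of_real)
  qed
qed

lemma integral_reflect_01:
  fixes f :: "real \<Rightarrow> complex"
  shows "integral {0..1} (\<lambda>t. f (1 - t)) = integral {0..1} f"
proof -
  have "integral {0..1} (\<lambda>t. f (1 - t)) = integral {-1..0} (\<lambda>t. f (1 + t))"
    using Henstock_Kurzweil_Integration.integral_reflect_real[of 0 "-1::real" "\<lambda>t. f (1 + t)"] by simp
  also have "\<dots> = integral {0..1} f"
    using integral_shift_real_ivl[of 0 1 1 f] by (simp add: add_ac)
  finally show ?thesis .
qed

text \<open>
  The two parameters are continued from the reals one after the other; \<open>t \<mapsto> 1 - t\<close> exchanges their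
  roles.
\<close>
lemma Beta_integral_complex:
  assumes a: "Re a > 2" and b: "Re b > 2"
  shows "integral {0..1} (\<lambda>t. complex_of_real t powr (a - 1) * complex_of_real (1 - t) powr (b - 1))
           = Beta a b"
proof -
  have *: "continuous_on {0..1} (\<lambda>t. complex_of_real (1 - t) powr (a - 1))"
    using a by (intro continuous_on_real_powr) auto
  have "integral {0..1} (\<lambda>t. complex_of_real t powr (b - 1) * complex_of_real (1 - t) powr (a - 1))
           = Beta b a"
  proof (rule half_plane_eqI[OF holomorphic_Mellin[OF *] _ _ b])
    show "(\<lambda>b. Beta b a) holomorphic_on {b. 2 < Re b}"
      unfolding Beta_altdef using a by (intro holomorphic_intros) (auto dest!: nonpos_Ints_Re)
  next
    fix x :: real assume x: "x > 2"
    show "integral {0..1} (\<lambda>t. complex_of_real t powr (of_real x - 1) * complex_of_real (1 - t) powr (a - 1)) = Beta (of_real x) a"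
      using Beta_integral_real_complex[OF a x] integral_reflect_01[of "\<lambda>t. complex_of_real t powr (a - 1) * complex_of_real (1 - t) powr (of_real x - 1)"]
      by (simp add: Beta_commute mult.commute)
  qed
  thus ?thesis
    using integral_reflect_01[of "\<lambda>t. complex_of_real t powr (a - 1) * complex_of_real (1 - t) powr (b - 1)"]
    by (simp add: Beta_commute mult.commute)
qed

section \<open>Continuation of power series to the slit plane\<close>

lemma slit_plane_iff: "z \<in> slit_plane \<longleftrightarrow> 1 - z \<notin> \<real>\<^sub>\<le>\<^sub>0"
proof -
  have "z \<in> {complex_of_real x |x. 1 \<le> x} \<longleftrightarrow> 1 - z \<in> \<real>\<^sub>\<le>\<^sub>0"
    by (auto simp: complex_nonpos_Reals_iff complex_eq_iff)
  thus ?thesis by (simp add: slit_plane_def)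
qed

lemma slit_plane_segment:
  assumes "z \<in> slit_plane" "t \<in> {0..1}"
  shows "complex_of_real t * z \<in> slit_plane"
proof -
  have "Im z \<noteq> 0 \<or> Re z < 1"
    using assms(1) by (auto simp: slit_plane_iff complex_nonpos_Reals_iff not_le)
  moreover have "t * Re z < 1" if "Re z < 1"
    using assms(2) that by (cases "Re z \<le> 0") (auto intro: le_less_trans[OF mult_left_le_one_le] le_less_trans[OF mult_nonneg_nonpos])
  ultimately show ?thesis using assms(2)
    by (auto simp: slit_plane_iff complex_nonpos_Reals_iff not_le)
qed

lemma open_slit_plane [simp, intro]: "open slit_plane"
proof -
  have "slit_plane = (\<lambda>z. 1 - z) -` (- \<real>\<^sub>\<le>\<^sub>0)" by (auto simp: slit_plane_iff)
  also have "open \<dots>" by (intro open_vimage continuous_intros) auto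
  finally show ?thesis .
qed

lemma zero_in_slit_plane [simp]: "0 \<in> slit_plane"
  by (simp add: slit_plane_iff complex_nonpos_Reals_iff)

lemma connected_slit_plane [simp, intro]: "connected slit_plane"
proof -
  have "starlike slit_plane"
    unfolding starlike_def
  proof (intro bexI[of _ 0] ballI subsetI)
    fix z x assume z: "z \<in> slit_plane" and "x \<in> closed_segment 0 z"
    then obtain t where "t \<in> {0..1}" "x = of_real t * z"
      by (auto simp: closed_segment_def scaleR_conv_of_real)
    thus "x \<in> slit_plane" using slit_plane_segment[OF z] by simp
  qed auto
  thus ?thesis by (rule starlike_imp_connected)
qed

lemma unit_ball_subset_slit_plane: "ball 0 1 \<subseteq> slit_plane"
proof
  fix z :: complex assume "z \<in> ball 0 1"
  hence "Re z < 1" using complex_Re_le_cmod[of z] by simp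
  thus "z \<in> slit_plane" by (simp add: slit_plane_iff complex_nonpos_Reals_iff)
qed

lemma slit_plane_eqI:
  assumes "f holomorphic_on slit_plane" "g holomorphic_on slit_plane"
    and "\<And>z. z \<in> ball 0 1 \<Longrightarrow> f z = g z" "z \<in> slit_plane"
  shows "f z = g z"
  using assms unit_ball_subset_slit_plane
  by (intro analytic_continuation_open[of "ball 0 1" slit_plane f g z]) auto

text \<open>
  This fixes the two domains of \<^const>\<open>continues_series\<close>, so that operations on functions
  correspond to operations on coefficient sequences.
\<close>
definition continues :: "(nat \<Rightarrow> complex) \<Rightarrow> (complex \<Rightarrow> complex) \<Rightarrow> bool" where
  "continues f S \<longleftrightarrow> continues_series (\<lambda>k z. f k * z ^ k) (ball 0 1) slit_plane S"

lemma continues_sums: "continues f S \<Longrightarrow> norm z < 1 \<Longrightarrow> (\<lambda>k. f k * z ^ k) sums S z"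
  and continues_holomorphic: "continues f S \<Longrightarrow> S holomorphic_on slit_plane"
  by (auto simp: continues_def continues_series_def)

lemma continues_unique:
  assumes "continues f S" "continues f T" "z \<in> slit_plane"
  shows "S z = T z"
proof (rule slit_plane_eqI[OF _ _ _ assms(3)])
  fix w :: complex assume "w \<in> ball 0 1"
  hence "norm w < 1" by simp
  thus "S w = T w" using sums_unique2 continues_sums assms(1,2) by blast
qed (use assms continues_holomorphic in blast)+

lemma continues_principal_continuation:
  "continues f S \<Longrightarrow> continues f (principal_continuation f)"
  unfolding continues_def principal_continuation_def
  by (rule someI[where P = "continues_series (\<lambda>k z. f k * z ^ k) (ball 0 1) slit_plane"])

lemma continues_add: "continues f S \<Longrightarrow> continues g T \<Longrightarrow> continues (\<lambda>k. f k + g k) (\<lambda>z. S z + T z)"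
  by (auto simp: continues_def continues_series_def ring_distribs intro!: holomorphic_intros sums_add)

lemma continues_cmult: "continues f S \<Longrightarrow> continues (\<lambda>k. c * f k) (\<lambda>z. c * S z)"
  by (auto simp: continues_def continues_series_def mult.assoc intro!: holomorphic_intros sums_mult)

lemma continues_deriv:
  assumes "continues f S"
  shows "continues (\<lambda>k. of_nat (Suc k) * f (Suc k)) (deriv S)"
  unfolding continues_def continues_series_def
proof (intro conjI ballI)
  show "deriv S holomorphic_on slit_plane"
    using continues_holomorphic[OF assms] by (intro holomorphic_deriv) auto
next
  fix z :: complex assume z: "z \<in> ball 0 1"
  have sm: "summable (\<lambda>k. f k * w ^ k)" if "norm w < 1" for w
    using continues_sums[OF assms that] by (simp add: sums_iff)
  have "((\<lambda>z. \<Sum>k. f k * z ^ k) has_field_derivative (\<Sum>k. diffs f k * z ^ k)) (at z)"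
    using z sm by (intro termdiffs_strong'[of 1]) auto
  moreover have "eventually (\<lambda>w. (\<Sum>k. f k * w ^ k) = S w) (nhds z)"
  proof (rule eventually_mono[OF eventually_nhds_in_open[of "ball 0 1" z]])
    fix w :: complex assume "w \<in> ball 0 1"
    thus "(\<Sum>k. f k * w ^ k) = S w" using continues_sums[OF assms, of w] by (simp add: sums_iff)
  qed (use z in auto)
  ultimately have "(S has_field_derivative (\<Sum>k. diffs f k * z ^ k)) (at z)"
    by (subst (asm) DERIV_cong_ev[OF refl _ refl])
  hence "deriv S z = (\<Sum>k. diffs f k * z ^ k)" by (rule DERIV_imp_deriv)
  moreover have "summable (\<lambda>k. diffs f k * z ^ k)"
    using z sm by (intro termdiff_converges[of z 1]) auto
  ultimately show "(\<lambda>k. of_nat (Suc k) * f (Suc k) * z ^ k) sums deriv S z"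
    by (simp add: diffs_def sums_iff)
qed

lemma continues_shift:
  assumes "continues f S"
  shows "continues (\<lambda>k. case k of 0 \<Rightarrow> 0 | Suc j \<Rightarrow> f j) (\<lambda>z. z * S z)"
  unfolding continues_def continues_series_def
proof (intro conjI ballI)
  fix z :: complex assume z: "z \<in> ball 0 1"
  hence "(\<lambda>k. z * (f k * z ^ k)) sums (z * S z)"
    using continues_sums[OF assms] by (intro sums_mult) auto
  thus "(\<lambda>k. (case k of 0 \<Rightarrow> 0 | Suc j \<Rightarrow> f j) * z ^ k) sums (z * S z)"
    using sums_Suc_iff[of "\<lambda>k. (case k of 0 \<Rightarrow> 0 | Suc j \<Rightarrow> f j) * z ^ k" "z * S z"]
    by (simp add: mult_ac)
qed (use continues_holomorphic[OF assms] in \<open>auto intro!: holomorphic_intros\<close>)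

text \<open>
  The operator \<open>z d/dz\<close> multiplies the \<open>k\<close>-th coefficient by \<open>k\<close>. Contiguous relations and the
  hypergeometric equation are thereby reduced to identities between coefficients.
\<close>
lemma continues_Euler_operator:
  assumes "continues f S"
  shows "continues (\<lambda>k. of_nat k * f k) (\<lambda>z. z * deriv S z)"
proof -
  have "(\<lambda>k. case k of 0 \<Rightarrow> 0 | Suc j \<Rightarrow> of_nat (Suc j) * f (Suc j)) = (\<lambda>k. of_nat k * f k)"
    by (auto split: nat.splits)
  with continues_shift[OF continues_deriv[OF assms]] show ?thesis by simp
qed

section \<open>Existence of the regularised hypergeometric function\<close>

definition hyp_coeff :: "complex \<Rightarrow> complex \<Rightarrow> complex \<Rightarrow> nat \<Rightarrow> complex" where
  "hyp_coeff a b c k = pochhammer a k * pochhammer b k * rGamma (c + of_nat k) / fact k"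

lemma binomial_series_sums:
  fixes a w :: complex
  assumes "norm w < 1"
  shows "(\<lambda>k. pochhammer a k / fact k * w ^ k) sums (1 - w) powr (- a)"
proof -
  have "(\<lambda>k. (-a gchoose k) * (-w) ^ k) sums (1 + (-w)) powr (-a)"
    by (rule gen_binomial_complex) (use assms in auto)
  also have "(\<lambda>k. (-a gchoose k) * (-w) ^ k) = (\<lambda>k. pochhammer a k / fact k * w ^ k)"
  proof
    fix k
    have "(-1) ^ k * (-w) ^ k = w ^ k" by (simp flip: power_mult_distrib)
    thus "(-a gchoose k) * (-w) ^ k = pochhammer a k / fact k * w ^ k"
      by (simp add: gbinomial_pochhammer)
  qed
  finally show ?thesis by simp
qed

lemma continuous_on_powr_off_cut:
  fixes f :: "'a :: topological_space \<Rightarrow> complex"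
  assumes "continuous_on A f" "\<And>x. x \<in> A \<Longrightarrow> f x \<notin> \<real>\<^sub>\<le>\<^sub>0"
  shows "continuous_on A (\<lambda>x. f x powr s)"
proof (rule continuous_on_powr_complex)
  show "A \<subseteq> {x. Re (f x) \<ge> 0 \<or> Im (f x) \<noteq> 0}"
    using assms(2) by (force simp: complex_nonpos_Reals_iff)
  show "Re s > 0" if "x \<in> A" "f x = 0" for x using assms(2)[OF that(1)] that(2) by simp
qed (use assms in auto)

text \<open>
  The integrand of Euler's integral for \<open>F(a, b; b + d; z)\<close>.
\<close>
definition Euler_kernel :: "complex \<Rightarrow> complex \<Rightarrow> complex \<Rightarrow> complex \<Rightarrow> real \<Rightarrow> complex" where
  "Euler_kernel a b d z t = complex_of_real t powr (b - 1) * complex_of_real (1 - t) powr (d - 1)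
      * (1 - complex_of_real t * z) powr (- a)"

lemma continuous_on_Euler_kernel:
  assumes "Re b > 1" "Re d > 1" "z \<in> slit_plane"
  shows "continuous_on {0..1} (Euler_kernel a b d z)"
proof -
  have "1 - of_real t * z \<notin> \<real>\<^sub>\<le>\<^sub>0" if "t \<in> {0..1}" for t
    using slit_plane_segment[OF assms(3) that] by (simp add: slit_plane_iff)
  hence "continuous_on {0..1} (\<lambda>t. (1 - complex_of_real t * z) powr (- a))"
    by (intro continuous_on_powr_off_cut) (auto intro!: continuous_intros)
  thus ?thesis unfolding Euler_kernel_def using assms
    by (intro continuous_on_mult continuous_on_real_powr) auto
qed

lemma holomorphic_Euler_integral:
  assumes "Re b > 1" "Re d > 1"
  shows "(\<lambda>z. integral {0..1} (Euler_kernel a b d z)) holomorphic_on slit_plane"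
proof (subst holomorphic_on_open [OF open_slit_plane], intro ballI allI impI)
  fix z0 assume "z0 \<in> slit_plane"
  then obtain e where e: "e > 0" "ball z0 e \<subseteq> slit_plane"
    using open_slit_plane open_contains_ball by blast
  have "(\<lambda>z. integral (cbox 0 1) (Euler_kernel a b d z)) holomorphic_on (ball z0 e)"
  proof (rule leibniz_rule_holomorphic[where fx = "\<lambda>z t. complex_of_real t powr (b - 1) * complex_of_real (1 - t) powr (d - 1)
      * (a * of_real t * (1 - complex_of_real t * z) powr (- a - 1))"])
    fix z :: complex and t :: real assume z: "z \<in> ball z0 e" and t: "t \<in> cbox 0 1"
    have "1 - of_real t * z \<notin> \<real>\<^sub>\<le>\<^sub>0"
      using slit_plane_segment[of z t] z t e by (auto simp: slit_plane_iff)
    thus "((\<lambda>z. Euler_kernel a b d z t) has_field_derivative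
       complex_of_real t powr (b - 1) * complex_of_real (1 - t) powr (d - 1)
      * (a * of_real t * (1 - complex_of_real t * z) powr (- a - 1))) (at z within ball z0 e)"
      unfolding Euler_kernel_def
      by (intro DERIV_cmult) (auto intro!: derivative_eq_intros)
  next
    fix z :: complex assume z: "z \<in> ball z0 e"
    show "Euler_kernel a b d z integrable_on cbox 0 1"
      unfolding interval_cbox [symmetric] using z e
      by (intro integrable_continuous_real continuous_on_Euler_kernel assms) auto
  next
    have "1 - of_real (snd x) * fst x \<notin> \<real>\<^sub>\<le>\<^sub>0" if "x \<in> ball z0 e \<times> {0..1}" for x :: "complex \<times> real"
      using slit_plane_segment[of "fst x" "snd x"] that e by (auto simp: slit_plane_iff)
    hence "continuous_on (ball z0 e \<times> {0..1}) (\<lambda>x. (1 - complex_of_real (snd x) * fst x) powr (- a - 1))"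
      by (intro continuous_on_powr_off_cut) (auto intro!: continuous_intros)
    moreover have "continuous_on (ball z0 e \<times> {0..1}) (\<lambda>x. complex_of_real (snd x) powr (b - 1))"
      using assms by (intro continuous_on_compose2[OF continuous_on_real_powr(1)]) (auto intro!: continuous_intros)
    moreover have "continuous_on (ball z0 e \<times> {0..1}) (\<lambda>x. complex_of_real (1 - snd x) powr (d - 1))"
      using assms by (intro continuous_on_compose2[OF continuous_on_real_powr(2)]) (auto intro!: continuous_intros)
    ultimately show "continuous_on (ball z0 e \<times> cbox 0 1) (\<lambda>(z, t). complex_of_real t powr (b - 1) * complex_of_real (1 - t) powr (d - 1)
      * (a * of_real t * (1 - complex_of_real t * z) powr (- a - 1)))"
      unfolding case_prod_unfold interval_cbox [symmetric]
      by (intro continuous_on_mult) (auto intro!: continuous_intros)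
  qed auto
  thus "\<exists>f'. ((\<lambda>z. integral {0..1} (Euler_kernel a b d z)) has_field_derivative f') (at z0)"
    using e holomorphic_on_open[of "ball z0 e"] by auto
qed

text \<open>
  Expand \<open>(1 - t z)\<^sup>-\<^sup>a\<close> by the binomial series, which converges uniformly in \<open>t\<close>, and integrate
  termwise by the Beta integral.
\<close>
lemma Euler_integral_sums:
  assumes b: "Re b > 2" and d: "Re d > 2" and z: "norm z < 1"
  shows "(\<lambda>k. Gamma b * Gamma d * hyp_coeff a b (b + d) k * z ^ k)
           sums integral {0..1} (Euler_kernel a b d z)"
proof -
  define g where "g = (\<lambda>k t. pochhammer a k / fact k * z ^ k *
       (complex_of_real t powr (b + of_nat k - 1) * complex_of_real (1 - t) powr (d - 1)))"
  have cont: "continuous_on {0..1} (g k)" for k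
    unfolding g_def using b d by (intro continuous_intros continuous_on_real_powr) auto
  have g_eq: "g k t = complex_of_real t powr (b - 1) * complex_of_real (1 - t) powr (d - 1) *
                (pochhammer a k / fact k * (of_real t * z) ^ k)" if "t \<in> {0..1}" for k t
  proof (cases "t = 0")
    case False
    have "complex_of_real t powr (b + of_nat k - 1) = of_real t powr (b - 1) * of_real t powr (of_nat k)"
      by (simp flip: powr_add add: algebra_simps)
    thus ?thesis using False by (simp add: g_def power_mult_distrib powr_nat' mult_ac)
  qed (auto simp: g_def)
  have nrm: "norm (complex_of_real t powr (b - 1)) \<le> 1" "norm (complex_of_real (1 - t) powr (d - 1)) \<le> 1" if "t \<in> {0..1}" for t
    using that b d by (auto simp: norm_powr_real_powr powr_le1 simp del: of_real_diff)
  have "uniform_limit {0..1} (\<lambda>n t. \<Sum>k<n. g k t) (\<lambda>t. \<Sum>k. g k t) sequentially"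
  proof (rule Weierstrass_m_test)
    fix k t assume t: "t \<in> {0..1::real}"
    have "norm (of_real t * z) ^ k \<le> norm z ^ k"
      using t by (intro power_mono) (auto simp: norm_mult mult_left_le_one_le)
    hence "norm (g k t) \<le> 1 * 1 * (norm (pochhammer a k / fact k) * norm z ^ k)"
      unfolding g_eq[OF t] norm_mult norm_power using nrm[OF t]
      by (intro mult_mono) auto
    thus "norm (g k t) \<le> norm (pochhammer a k / fact k * z ^ k)" by (simp add: norm_mult norm_power norm_divide)
  next
    show "summable (\<lambda>k. norm (pochhammer a k / fact k * z ^ k))"
    proof (rule powser_insidea)
      show "summable (\<lambda>k. pochhammer a k / fact k * complex_of_real ((norm z + 1) / 2) ^ k)"
        using z by (intro sums_summable[OF binomial_series_sums]) (simp add: norm_divide del: of_real_divide)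
      show "norm z < norm (complex_of_real ((norm z + 1) / 2))" using z by (simp add: norm_divide del: of_real_divide)
    qed
  qed
  then obtain I J where IJ: "\<And>n. ((\<lambda>t. \<Sum>k<n. g k t) has_integral I n) {0..1}"
     "((\<lambda>t. \<Sum>k. g k t) has_integral J) {0..1}" "I \<longlonglongrightarrow> J"
    by (rule uniform_limit_integral) (auto intro!: continuous_intros cont)
  have gi: "(g k has_integral (Gamma b * Gamma d * hyp_coeff a b (b + d) k * z ^ k)) {0..1}" for k
  proof -
    have "integral {0..1} (g k) = pochhammer a k / fact k * z ^ k * Beta (b + of_nat k) d"
      unfolding g_def using b d by (subst Beta_integral_complex[symmetric]) auto
    also have "Beta (b + of_nat k) d = Gamma b * Gamma d * pochhammer b k * rGamma (b + d + of_nat k)"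
      using b unfolding Beta_altdef
      by (subst pochhammer_Gamma) (auto dest!: nonpos_Ints_Re simp: Gamma_eq_zero_iff add_ac)
    finally have "integral {0..1} (g k) = Gamma b * Gamma d * hyp_coeff a b (b + d) k * z ^ k"
      by (simp add: hyp_coeff_def mult_ac)
    thus ?thesis using integrable_continuous_real[OF cont[of k]] by (simp add: has_integral_iff)
  qed
  have "I n = (\<Sum>k<n. Gamma b * Gamma d * hyp_coeff a b (b + d) k * z ^ k)" for n
  proof (rule has_integral_unique[OF IJ(1)])
    show "((\<lambda>t. \<Sum>k<n. g k t) has_integral (\<Sum>k<n. Gamma b * Gamma d * hyp_coeff a b (b + d) k * z ^ k)) {0..1}"
      by (rule has_integral_sum) (auto intro: gi)
  qed
  hence "I = (\<lambda>n. \<Sum>k<n. Gamma b * Gamma d * hyp_coeff a b (b + d) k * z ^ k)" by (rule ext)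
  with IJ(3) have "(\<lambda>k. Gamma b * Gamma d * hyp_coeff a b (b + d) k * z ^ k) sums J"
    by (simp add: sums_def)
  also have "J = integral {0..1} (\<lambda>t. \<Sum>k. g k t)" using IJ(2) by (simp add: integral_unique)
  also have "\<dots> = integral {0..1} (Euler_kernel a b d z)"
  proof (rule integral_cong)
    fix t :: real assume t: "t \<in> {0..1}"
    have "norm (of_real t * z) < 1"
      using t z by (auto simp: norm_mult intro: le_less_trans[OF mult_left_le_one_le])
    from sums_mult[OF binomial_series_sums[OF this, of a], of "complex_of_real t powr (b - 1) * complex_of_real (1 - t) powr (d - 1)"]
    show "(\<Sum>k. g k t) = Euler_kernel a b d z t"
      unfolding g_eq[OF t] Euler_kernel_def by (simp add: sums_iff)
  qed
  finally show ?thesis .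
qed

lemma continues_Euler_integral:
  assumes "Re b > 2" "Re d > 2"
  shows "continues (\<lambda>k. Gamma b * Gamma d * hyp_coeff a b (b + d) k)
           (\<lambda>z. integral {0..1} (Euler_kernel a b d z))"
  unfolding continues_def continues_series_def
  using holomorphic_Euler_integral[of b d a] Euler_integral_sums[of b d _ a] assms by auto

lemma hyp_coeff_rec_c: "(of_nat k + c) * hyp_coeff a b (c + 1) k = hyp_coeff a b c k"
proof -
  have "rGamma (c + of_nat k) = (of_nat k + c) * rGamma (c + of_nat k + 1)"
    by (simp only: rGamma_plus1 add.commute[of "of_nat k" c])
  also have "c + of_nat k + 1 = c + 1 + of_nat k" by simp
  finally show ?thesis by (simp add: hyp_coeff_def)
qed

lemma hyp_coeff_Suc:
  "of_nat (Suc k) * (of_nat k + c) * hyp_coeff a b c (Suc k) = (of_nat k + a) * (of_nat k + b) * hyp_coeff a b c k"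
proof -
  define X where "X = pochhammer a k * pochhammer b k * rGamma (c + of_nat k + 1) / fact k"
  have "rGamma (c + of_nat k) = (c + of_nat k) * rGamma (c + of_nat k + 1)"
    by (simp add: rGamma_plus1)
  hence 1: "hyp_coeff a b c k = X * (c + of_nat k)"
    by (simp add: hyp_coeff_def X_def)
  have "c + of_nat (Suc k) = c + of_nat k + 1" by simp
  hence "hyp_coeff a b c (Suc k) = X * (a + of_nat k) * (b + of_nat k) / of_nat (Suc k)"
    unfolding hyp_coeff_def X_def by (simp only: pochhammer_rec' fact_Suc) (simp add: mult_ac)
  hence 2: "of_nat (Suc k) * hyp_coeff a b c (Suc k) = X * (a + of_nat k) * (b + of_nat k)"
    by (simp del: of_nat_Suc)
  have "of_nat (Suc k) * (of_nat k + c) * hyp_coeff a b c (Suc k) = (of_nat k + c) * (of_nat (Suc k) * hyp_coeff a b c (Suc k))"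
    by (simp only: mult_ac)
  also have "\<dots> = (of_nat k + a) * (of_nat k + b) * hyp_coeff a b c k"
    unfolding 1 2 by (simp only: mult_ac add_ac)
  finally show ?thesis .
qed

text \<open>
  Euler's integral covers \<open>Re b > 2\<close>, \<open>Re (c - b) > 2\<close>. From there \<open>b\<close> is lowered first, while \<open>c\<close> is kept so
  large that \<open>c - b - 1\<close> does not vanish, and then \<open>c\<close> is lowered.
\<close>
lemma ex_continues_hyp_coeff: "\<exists>S. continues (hyp_coeff a b c) S"
proof -
  have large: "\<exists>S. continues (hyp_coeff a b c) S" if "Re b > 2" "Re (c - b) > 2" for b c
  proof -
    have nz: "Gamma b \<noteq> 0" "Gamma (c - b) \<noteq> 0"
      using that by (auto simp: Gamma_eq_zero_iff dest!: nonpos_Ints_Re)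
    from continues_cmult[OF continues_Euler_integral[OF that], of "1 / (Gamma b * Gamma (c - b))" a]
    show ?thesis using nz by (auto simp: field_simps)
  qed
  have down_b: "\<exists>S. continues (hyp_coeff a b c) S" if "\<exists>S. continues (hyp_coeff a (b + 1) c) S" "Re (c - b) > 2" for b c
  proof -
    from that(1) obtain S where S: "continues (hyp_coeff a (b + 1) c) S" ..
    let ?g = "hyp_coeff a (b + 1) c"
    \<comment> \<open>The contiguous relation \<open>(c - b - 1) F(b) = (z (1 - z) d/dz + c - b - 1 - a z) F(b + 1)\<close>.\<close>
    define f where "f = (\<lambda>k. (of_nat k * ?g k + (c - b - 1) * ?g k) +
        (- 1) * (case k of 0 \<Rightarrow> 0 | Suc j \<Rightarrow> of_nat j * ?g j + a * ?g j))"
    define T where "T = (\<lambda>z. (z * deriv S z + (c - b - 1) * S z) + (- 1) * (z * (z * deriv S z + a * S z)))"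
    have T: "continues f T"
      unfolding f_def T_def
      by (intro continues_add continues_cmult continues_shift continues_Euler_operator S)
    have "f k = (c - b - 1) * hyp_coeff a b c k" for k
    proof (cases k)
      case (Suc j)
      define X where "X = pochhammer a j * pochhammer (b + 1) j * rGamma (c + of_nat k) / fact k"
      have "?g k = X * (a + of_nat j) * (b + 1 + of_nat j)"
        by (simp add: hyp_coeff_def X_def Suc pochhammer_rec')
      moreover have "?g j = X * of_nat (Suc j) * (c + of_nat j)"
      proof -
        have "rGamma (c + of_nat j) = (c + of_nat j) * rGamma (c + of_nat j + 1)"
          by (simp add: rGamma_plus1)
        also have "c + of_nat j + 1 = c + of_nat k" by (simp add: Suc)
        finally show ?thesis by (simp add: hyp_coeff_def X_def Suc del: of_nat_Suc)
      qed
      moreover have "hyp_coeff a b c k = X * (a + of_nat j) * b"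
        by (simp add: hyp_coeff_def X_def Suc pochhammer_rec'[of a] pochhammer_rec[of b])
      ultimately show ?thesis by (simp add: f_def Suc algebra_simps)
    qed (simp add: f_def hyp_coeff_def)
    moreover have "c - b - 1 \<noteq> 0" using that(2) by (auto simp: complex_eq_iff)
    ultimately have "(\<lambda>k. 1 / (c - b - 1) * f k) = hyp_coeff a b c"
      by (auto simp: fun_eq_iff)
    with continues_cmult[OF T, of "1 / (c - b - 1)"] show ?thesis by auto
  qed
  have down_c: "\<exists>S. continues (hyp_coeff a b c) S" if "\<exists>S. continues (hyp_coeff a b (c + 1)) S" for b c
  proof -
    from that obtain S where "continues (hyp_coeff a b (c + 1)) S" ..
    hence "continues (\<lambda>k. of_nat k * hyp_coeff a b (c + 1) k + c * hyp_coeff a b (c + 1) k) (\<lambda>z. z * deriv S z + c * S z)"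
      by (intro continues_add continues_Euler_operator continues_cmult)
    thus ?thesis by (auto simp: hyp_coeff_rec_c simp flip: ring_distribs)
  qed
  obtain N where N: "real N > 2 - Re b" using reals_Archimedean2 by blast
  obtain M where M: "real M > Re b + real N + 2 - Re c" using reals_Archimedean2 by blast
  have 1: "\<exists>S. continues (hyp_coeff a (b + of_nat n) (c + of_nat M)) S" if "n \<le> N" for n
    using that
  proof (induction n rule: inc_induct)
    case base
    show ?case using N M by (intro large) auto
  next
    case (step n)
    have "b + of_nat (Suc n) = b + of_nat n + 1" by simp
    hence "\<exists>S. continues (hyp_coeff a (b + of_nat n + 1) (c + of_nat M)) S"
      using step.IH by metis
    moreover have "Re (c + of_nat M - (b + of_nat n)) > 2" using step.hyps M by simp
    ultimately show ?case by (rule down_b)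
  qed
  have "\<exists>S. continues (hyp_coeff a b (c + of_nat n)) S" if "n \<le> M" for n
    using that
  proof (induction n rule: inc_induct)
    case base
    show ?case using 1[of 0] by simp
  next
    case (step n)
    have "c + of_nat (Suc n) = c + of_nat n + 1" by simp
    hence "\<exists>S. continues (hyp_coeff a b (c + of_nat n + 1)) S"
      using step.IH by metis
    thus ?case by (rule down_c)
  qed
  from this[of 0] show ?thesis by simp
qed

section \<open>Contiguous relations\<close>

definition reg_hyp :: "complex \<Rightarrow> complex \<Rightarrow> complex \<Rightarrow> complex \<Rightarrow> complex" where
  "reg_hyp a b c = principal_continuation (hyp_coeff a b c)"

lemma continues_reg_hyp: "continues (hyp_coeff a b c) (reg_hyp a b c)"
  unfolding reg_hyp_def using ex_continues_hyp_coeff continues_principal_continuation by blast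

lemma holomorphic_reg_hyp: "reg_hyp a b c holomorphic_on slit_plane"
  using continues_reg_hyp by (rule continues_holomorphic)

lemma holomorphic_on_reg_hyp [holomorphic_intros]:
  "f holomorphic_on A \<Longrightarrow> (\<And>z. z \<in> A \<Longrightarrow> f z \<in> slit_plane) \<Longrightarrow> (\<lambda>z. reg_hyp a b c (f z)) holomorphic_on A"
  using holomorphic_on_compose_gen[of f A "reg_hyp a b c" slit_plane, OF _ holomorphic_reg_hyp] by (auto simp: o_def)

lemma reg_hyp_eqI:
  assumes "continues f S" "\<And>k. f k = hyp_coeff a b c k" "z \<in> slit_plane"
  shows "S z = reg_hyp a b c z"
proof -
  have "f = hyp_coeff a b c" using assms(2) by auto
  thus ?thesis using continues_unique[OF assms(1) _ assms(3)] continues_reg_hyp by simp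
qed

lemma hyp2f1_eq_reg_hyp:
  assumes "c \<notin> \<int>\<^sub>\<le>\<^sub>0" "z \<in> slit_plane"
  shows "hyp2f1 a b c z = Gamma c * reg_hyp a b c z"
proof -
  have "Gamma c * hyp_coeff a b c k = pochhammer a k * pochhammer b k / (pochhammer c k * fact k)" for k
    using assms(1) pochhammer_rGamma[of c k]
    by (simp add: hyp_coeff_def pochhammer_Gamma Gamma_def rGamma_eq_zero_iff field_simps)
  hence "(\<lambda>k. pochhammer a k * pochhammer b k / (pochhammer c k * fact k)) = (\<lambda>k. Gamma c * hyp_coeff a b c k)"
    by auto
  with continues_cmult[OF continues_reg_hyp, of "Gamma c" a b c]
  have "continues (\<lambda>k. pochhammer a k * pochhammer b k / (pochhammer c k * fact k)) (\<lambda>z. Gamma c * reg_hyp a b c z)"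
    by simp
  from continues_unique[OF continues_principal_continuation[OF this] this assms(2)]
  show ?thesis unfolding hyp2f1_def .
qed

lemma hyp2f1_over_Gamma_eq_reg_hyp:
  assumes "z \<in> slit_plane"
  shows "hyp2f1_over_Gamma a b c z = reg_hyp a b c z"
proof (cases "c \<in> \<int>\<^sub>\<le>\<^sub>0")
  case True
  thus ?thesis by (simp add: hyp2f1_over_Gamma_def reg_hyp_def hyp_coeff_def [abs_def])
next
  case False
  thus ?thesis using assms by (simp add: hyp2f1_over_Gamma_def hyp2f1_eq_reg_hyp Gamma_eq_zero_iff)
qed

lemma reg_hyp_commute: "reg_hyp a b c = reg_hyp b a c"
proof -
  have "hyp_coeff a b c = hyp_coeff b a c" by (simp add: hyp_coeff_def fun_eq_iff)
  thus ?thesis by (simp add: reg_hyp_def)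
qed

lemma reg_hyp_0: "reg_hyp a b c 0 = rGamma c"
  using continues_sums[OF continues_reg_hyp, of 0 a b c] powser_sums_zero_iff[of "hyp_coeff a b c" "reg_hyp a b c 0"]
  by (simp add: hyp_coeff_def)

lemma deriv_reg_hyp:
  assumes "z \<in> slit_plane"
  shows "deriv (reg_hyp a b c) z = a * b * reg_hyp (a + 1) (b + 1) (c + 1) z"
proof (rule continues_unique[OF continues_deriv[OF continues_reg_hyp] _ assms])
  have "of_nat (Suc k) * hyp_coeff a b c (Suc k) = a * b * hyp_coeff (a + 1) (b + 1) (c + 1) k" for k
  proof -
    have "c + of_nat (Suc k) = c + 1 + of_nat k" by simp
    moreover have "1 + complex_of_nat k \<noteq> 0" using of_nat_neq_0[of k, where 'a = complex] by simp
    ultimately show ?thesis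
      unfolding hyp_coeff_def by (simp only: pochhammer_rec fact_Suc) (simp add: divide_simps)
  qed
  hence "(\<lambda>k. of_nat (Suc k) * hyp_coeff a b c (Suc k)) = (\<lambda>k. a * b * hyp_coeff (a + 1) (b + 1) (c + 1) k)" by auto
  thus "continues (\<lambda>k. of_nat (Suc k) * hyp_coeff a b c (Suc k)) (\<lambda>z. a * b * reg_hyp (a + 1) (b + 1) (c + 1) z)"
    using continues_cmult[OF continues_reg_hyp] by simp
qed

lemma DERIV_reg_hyp:
  assumes "z \<in> slit_plane"
  shows "(reg_hyp a b c has_field_derivative a * b * reg_hyp (a + 1) (b + 1) (c + 1) z) (at z)"
  using holomorphic_derivI[OF holomorphic_reg_hyp open_slit_plane assms] deriv_reg_hyp[OF assms] by simp

lemma reg_hyp_raise_a: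
  assumes "z \<in> slit_plane"
  shows "z * deriv (reg_hyp a b c) z + a * reg_hyp a b c z = a * reg_hyp (a + 1) b c z"
proof (rule continues_unique[OF _ _ assms])
  show "continues (\<lambda>k. of_nat k * hyp_coeff a b c k + a * hyp_coeff a b c k) (\<lambda>z. z * deriv (reg_hyp a b c) z + a * reg_hyp a b c z)"
    by (intro continues_add continues_Euler_operator continues_cmult continues_reg_hyp)
  have "of_nat k * hyp_coeff a b c k + a * hyp_coeff a b c k = a * hyp_coeff (a + 1) b c k" for k
  proof -
    have "(of_nat k + a) * pochhammer a k = a * pochhammer (a + 1) k"
      using pochhammer_rec[of a k] pochhammer_rec'[of a k] by (simp add: add.commute)
    hence "(of_nat k + a) * pochhammer a k * (pochhammer b k * rGamma (c + of_nat k) / fact k) =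
           a * pochhammer (a + 1) k * (pochhammer b k * rGamma (c + of_nat k) / fact k)" by simp
    moreover have "of_nat k * hyp_coeff a b c k + a * hyp_coeff a b c k =
        (of_nat k + a) * pochhammer a k * (pochhammer b k * rGamma (c + of_nat k) / fact k)"
      by (simp add: hyp_coeff_def ring_distribs add_divide_distrib mult_ac)
    ultimately show ?thesis by (simp add: hyp_coeff_def)
  qed
  hence "(\<lambda>k. of_nat k * hyp_coeff a b c k + a * hyp_coeff a b c k) = (\<lambda>k. a * hyp_coeff (a + 1) b c k)" by auto
  thus "continues (\<lambda>k. of_nat k * hyp_coeff a b c k + a * hyp_coeff a b c k) (\<lambda>z. a * reg_hyp (a + 1) b c z)"
    using continues_cmult[OF continues_reg_hyp] by simp
qed

lemma reg_hyp_lower_c: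
  assumes "z \<in> slit_plane"
  shows "z * deriv (reg_hyp a b (c + 1)) z + c * reg_hyp a b (c + 1) z = reg_hyp a b c z"
proof (rule reg_hyp_eqI[OF _ _ assms])
  show "continues (\<lambda>k. of_nat k * hyp_coeff a b (c + 1) k + c * hyp_coeff a b (c + 1) k)
          (\<lambda>z. z * deriv (reg_hyp a b (c + 1)) z + c * reg_hyp a b (c + 1) z)"
    by (intro continues_add continues_Euler_operator continues_cmult continues_reg_hyp)
qed (simp add: hyp_coeff_rec_c flip: ring_distribs)

section \<open>The hypergeometric equation\<close>

definition hyp_ode :: "complex \<Rightarrow> complex \<Rightarrow> complex \<Rightarrow> complex set \<Rightarrow> (complex \<Rightarrow> complex) \<Rightarrow> bool" where
  "hyp_ode a b c D u \<longleftrightarrow> u holomorphic_on D \<and>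
     (\<forall>z\<in>D. z * (1 - z) * deriv (deriv u) z + (c - (a + b + 1) * z) * deriv u z - a * b * u z = 0)"

lemma hyp_odeI:
  assumes "open D"
    and u1: "\<And>z. z \<in> D \<Longrightarrow> (u has_field_derivative u1 z) (at z)"
    and u2: "\<And>z. z \<in> D \<Longrightarrow> (u1 has_field_derivative u2 z) (at z)"
    and eq: "\<And>z. z \<in> D \<Longrightarrow> z * (1 - z) * u2 z + (c - (a + b + 1) * z) * u1 z - a * b * u z = 0"
  shows "hyp_ode a b c D u"
  unfolding hyp_ode_def
proof safe
  show "u holomorphic_on D" using u1 \<open>open D\<close> by (auto simp: holomorphic_on_open)
  fix z assume z: "z \<in> D"
  have "deriv u z = u1 z" if "z \<in> D" for z using u1[OF that] by (rule DERIV_imp_deriv)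
  hence "eventually (\<lambda>z. deriv u z = u1 z) (nhds z)"
    using eventually_nhds_in_open[OF \<open>open D\<close> z] by (auto elim: eventually_mono)
  hence "deriv (deriv u) z = deriv u1 z" by (intro deriv_cong_ev) auto
  also have "\<dots> = u2 z" using u2[OF z] by (rule DERIV_imp_deriv)
  finally show "z * (1 - z) * deriv (deriv u) z + (c - (a + b + 1) * z) * deriv u z - a * b * u z = 0"
    using eq[OF z] DERIV_imp_deriv[OF u1[OF z]] by simp
qed

lemma hyp_odeD:
  assumes "hyp_ode a b c D u" "open D" "z \<in> D"
  shows "(u has_field_derivative deriv u z) (at z)"
    and "(deriv u has_field_derivative deriv (deriv u) z) (at z)"
    and "z * (1 - z) * deriv (deriv u) z + (c - (a + b + 1) * z) * deriv u z - a * b * u z = 0"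
  using assms by (auto simp: hyp_ode_def intro!: holomorphic_derivI holomorphic_deriv)

lemma hyp_ode_subset: "hyp_ode a b c D u \<Longrightarrow> D' \<subseteq> D \<Longrightarrow> hyp_ode a b c D' u"
  by (auto simp: hyp_ode_def intro: holomorphic_on_subset)

lemma hyp_ode_cong:
  assumes "hyp_ode a b c D u" "open D" "\<And>z. z \<in> D \<Longrightarrow> u z = v z"
  shows "hyp_ode a b c D v"
proof (rule hyp_odeI[OF \<open>open D\<close>, of _ "deriv u" "deriv (deriv u)"])
  fix z assume z: "z \<in> D"
  have "eventually (\<lambda>z. u z = v z) (nhds z)"
    using eventually_nhds_in_open[OF \<open>open D\<close> z] assms(3) by (auto elim: eventually_mono)
  thus "(v has_field_derivative deriv u z) (at z)"
    using hyp_odeD(1)[OF assms(1,2) z] DERIV_cong_ev by blast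
qed (use hyp_odeD[OF assms(1,2)] assms(3) in auto)

lemma hyp_ode_lincomb:
  assumes "hyp_ode a b c D u" "hyp_ode a b c D v" "open D"
  shows "hyp_ode a b c D (\<lambda>z. s * u z + t * v z)"
proof (rule hyp_odeI[OF \<open>open D\<close>])
  fix z assume z: "z \<in> D"
  note u = hyp_odeD[OF assms(1,3) z] and v = hyp_odeD[OF assms(2,3) z]
  show "((\<lambda>z. s * u z + t * v z) has_field_derivative (s * deriv u z + t * deriv v z)) (at z)"
    by (intro DERIV_add DERIV_cmult u v)
  show "((\<lambda>z. s * deriv u z + t * deriv v z) has_field_derivative (s * deriv (deriv u) z + t * deriv (deriv v) z)) (at z)"
    by (intro DERIV_add DERIV_cmult u v)
  have "z * (1 - z) * (s * deriv (deriv u) z + t * deriv (deriv v) z) + (c - (a + b + 1) * z) * (s * deriv u z + t * deriv v z)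
         - a * b * (s * u z + t * v z) =
      s * (z * (1 - z) * deriv (deriv u) z + (c - (a + b + 1) * z) * deriv u z - a * b * u z) +
      t * (z * (1 - z) * deriv (deriv v) z + (c - (a + b + 1) * z) * deriv v z - a * b * v z)"
    by (simp add: algebra_simps)
  thus "z * (1 - z) * (s * deriv (deriv u) z + t * deriv (deriv v) z) + (c - (a + b + 1) * z) * (s * deriv u z + t * deriv v z)
         - a * b * (s * u z + t * v z) = 0" using u(3) v(3) by simp
qed

text \<open>
  With \<open>\<theta> = z d/dz\<close> the equation reads \<open>(\<theta> + c) u' = (\<theta> + a) (\<theta> + b) u\<close>, and this is the recurrence
  \<open>hyp_coeff_Suc\<close>.
\<close>
lemma hyp_ode_reg_hyp: "hyp_ode a b c slit_plane (reg_hyp a b c)"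
  unfolding hyp_ode_def
proof safe
  fix z assume z: "z \<in> slit_plane"
  let ?f = "hyp_coeff a b c" and ?S = "reg_hyp a b c"
  define g where "g = (\<lambda>k. (of_nat k * (of_nat (Suc k) * ?f (Suc k)) + c * (of_nat (Suc k) * ?f (Suc k)))
     + (-1) * (of_nat k * (of_nat k * ?f k) + (a + b) * (of_nat k * ?f k) + a * b * ?f k))"
  define T where "T = (\<lambda>z. (z * deriv (deriv ?S) z + c * deriv ?S z)
     + (-1) * (z * deriv (\<lambda>z. z * deriv ?S z) z + (a + b) * (z * deriv ?S z) + a * b * ?S z))"
  have "continues g T"
    unfolding g_def T_def
    by (intro continues_add continues_cmult continues_Euler_operator continues_deriv continues_reg_hyp)
  moreover have "g k = 0" for k
  proof -
    have "g k = of_nat (Suc k) * (of_nat k + c) * ?f (Suc k) - (of_nat k + a) * (of_nat k + b) * ?f k"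
      by (simp add: g_def algebra_simps)
    thus ?thesis using hyp_coeff_Suc[of k c a b] by simp
  qed
  hence "g = (\<lambda>k. 0 * ?f k)" by auto
  moreover have "continues (\<lambda>k. 0 * ?f k) (\<lambda>z. 0 * ?S z)" by (intro continues_cmult continues_reg_hyp)
  ultimately have "T z = 0" using continues_unique[of g T "\<lambda>z. 0 * ?S z" z] z by simp
  moreover have "deriv (\<lambda>z. z * deriv ?S z) z = deriv ?S z + z * deriv (deriv ?S) z"
  proof (rule DERIV_imp_deriv)
    have "(deriv ?S has_field_derivative deriv (deriv ?S) z) (at z)"
      by (intro holomorphic_derivI[OF _ open_slit_plane z] holomorphic_deriv holomorphic_reg_hyp open_slit_plane)
    from DERIV_mult[OF DERIV_ident this]
    show "((\<lambda>z. z * deriv ?S z) has_field_derivative (deriv ?S z + z * deriv (deriv ?S) z)) (at z)" by (simp add: add_ac mult_ac)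
  qed
  ultimately show "z * (1 - z) * deriv (deriv ?S) z + (c - (a + b + 1) * z) * deriv ?S z - a * b * ?S z = 0"
    by (simp add: T_def algebra_simps)
qed (rule holomorphic_reg_hyp)

lemma has_fps_expansion_reg_hyp: "reg_hyp a b c has_fps_expansion Abs_fps (hyp_coeff a b c)"
proof (rule has_fps_expansionI, rule eventually_mono)
  show "eventually (\<lambda>z. z \<in> ball 0 1) (nhds (0::complex))" by (rule eventually_nhds_in_open) auto
qed (use continues_sums[OF continues_reg_hyp] in auto)

text \<open>
  The equation determines the Taylor coefficients at \<open>0\<close> recursively: the coefficient of \<open>u\<^sub>n\<^sub>+\<^sub>1\<close> is
  \<open>(n + 1) (n + c)\<close>, which vanishes for no \<open>n\<close>.
\<close>
lemma hyp_ode_unique_analytic: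
  assumes u: "hyp_ode a b c D u" and c: "c \<notin> \<int>\<^sub>\<le>\<^sub>0"
    and D: "open D" "connected D" "0 \<in> D" "D \<subseteq> slit_plane" and z: "z \<in> D"
  shows "u z = u 0 * Gamma c * reg_hyp a b c z"
proof -
  have hol: "u holomorphic_on D" using u by (simp add: hyp_ode_def)
  obtain U where U: "u has_fps_expansion U"
    using has_fps_expansion_fps_expansion[OF D(1,3) hol] by blast
  let ?E = "(fps_X * (1 - fps_X)) * fps_deriv (fps_deriv U) + (fps_const c - fps_const (a + b + 1) * fps_X) * fps_deriv U
          - fps_const (a * b) * U"
  have "(\<lambda>z. (z * (1 - z)) * deriv (deriv u) z + (c - (a + b + 1) * z) * deriv u z - (a * b) * u z) has_fps_expansion ?E"
    by (intro fps_expansion_intros U)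
  moreover have "eventually (\<lambda>z. (z * (1 - z)) * deriv (deriv u) z + (c - (a + b + 1) * z) * deriv u z - (a * b) * u z = 0) (nhds 0)"
    using eventually_nhds_in_open[OF D(1,3)] u by (auto elim!: eventually_mono simp: hyp_ode_def)
  ultimately have "(\<lambda>z::complex. 0) has_fps_expansion ?E"
    by (subst (asm) has_fps_expansion_cong[OF _ refl])
  hence E0: "?E = 0" by (metis fps_expansion_unique_complex has_fps_expansion_0)
  have rec: "of_nat (Suc n) * (of_nat n + c) * fps_nth U (Suc n) = (of_nat n + a) * (of_nat n + b) * fps_nth U n" for n
  proof -
    have *: "?E = fps_X * fps_deriv (fps_deriv U) - fps_X * (fps_X * fps_deriv (fps_deriv U)) + fps_const c * fps_deriv U
                - fps_const (a + b + 1) * (fps_X * fps_deriv U) - fps_const (a * b) * U" by (simp add: algebra_simps)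
    have "fps_nth ?E n = 0" by (simp only: E0 fps_zero_nth)
    thus ?thesis unfolding *
      by (cases n; cases "n - 1") (simp_all add: algebra_simps numeral_2_eq_2)
  qed
  have U_eq: "fps_nth U n = u 0 * Gamma c * hyp_coeff a b c n" for n
  proof (induction n)
    case 0
    have "fps_nth U 0 = u 0" using has_fps_expansion_imp_0_eq_fps_nth_0[OF U] by simp
    thus ?case using c by (simp add: hyp_coeff_def Gamma_def rGamma_eq_zero_iff)
  next
    case (Suc n)
    have nz: "of_nat (Suc n) * (of_nat n + c) \<noteq> 0"
    proof -
      have "c = - of_nat n" if "of_nat n + c = 0" using that by (simp add: add_eq_0_iff)
      hence "of_nat n + c \<noteq> 0" using c by auto
      thus ?thesis using of_nat_neq_0[of n, where 'a = complex] by (simp del: of_nat_Suc)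
    qed
    have "of_nat (Suc n) * (of_nat n + c) * fps_nth U (Suc n) = of_nat (Suc n) * (of_nat n + c) * (u 0 * Gamma c * hyp_coeff a b c (Suc n))"
      unfolding rec Suc.IH using hyp_coeff_Suc[of n c a b] by (simp only: mult_ac)
    thus ?case using nz by (metis mult_left_cancel)
  qed
  let ?k = "u 0 * Gamma c"
  have "(\<lambda>z. u z - ?k * reg_hyp a b c z) has_fps_expansion (U - fps_const ?k * Abs_fps (hyp_coeff a b c))"
    by (intro fps_expansion_intros U has_fps_expansion_reg_hyp)
  also have "U - fps_const ?k * Abs_fps (hyp_coeff a b c) = 0"
    by (rule fps_ext) (simp add: U_eq)
  finally have "u z - ?k * reg_hyp a b c z = 0"
    by (rule has_fps_expansion_0_analytic_continuation[OF _ _ D(1-3) z])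
       (use D(4) in \<open>auto intro!: holomorphic_intros hol\<close>)
  thus ?thesis by simp
qed

lemma hyp_ode_reflect:
  assumes u: "hyp_ode a b (a + b + 1 - c) D u" and "open D" "open D'" "\<And>z. z \<in> D' \<Longrightarrow> 1 - z \<in> D"
  shows "hyp_ode a b c D' (\<lambda>z. u (1 - z))"
proof (rule hyp_odeI[OF \<open>open D'\<close>])
  fix z assume "z \<in> D'"
  hence z: "1 - z \<in> D" using assms(4) by auto
  note u = hyp_odeD[OF assms(1,2) z]
  show "((\<lambda>z. u (1 - z)) has_field_derivative - deriv u (1 - z)) (at z)"
    by (rule DERIV_chain2[of u _ "\<lambda>z. 1 - z", OF u(1), THEN DERIV_cong]) (auto intro!: derivative_eq_intros)
  show "((\<lambda>z. - deriv u (1 - z)) has_field_derivative deriv (deriv u) (1 - z)) (at z)"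
    by (rule DERIV_minus[OF DERIV_chain2[of "deriv u" _ "\<lambda>z. 1 - z", OF u(2)], THEN DERIV_cong]) (auto intro!: derivative_eq_intros)
  show "z * (1 - z) * deriv (deriv u) (1 - z) + (c - (a + b + 1) * z) * - deriv u (1 - z) - a * b * u (1 - z) = 0"
    using u(3) by (simp add: algebra_simps)
qed

lemma DERIV_one_minus_powr:
  assumes "z \<in> slit_plane"
  shows "((\<lambda>z. (1 - z) powr s) has_field_derivative - s * (1 - z) powr (s - 1)) (at z)"
  using assms by (auto intro!: derivative_eq_intros simp: slit_plane_iff)

lemma one_minus_powr_diff:
  assumes "z \<in> slit_plane"
  shows "(1 - z) powr (s - 1) = (1 - z) powr s / (1 - z)"
  using assms by (auto simp: slit_plane_iff powr_diff)

lemma hyp_ode_Euler_transform: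
  assumes v: "hyp_ode (c - a) (c - b) c D v" and "open D" "D \<subseteq> slit_plane"
  shows "hyp_ode a b c D (\<lambda>z. (1 - z) powr (c - a - b) * v z)"
proof -
  define s where "s = c - a - b"
  have "hyp_ode a b c D (\<lambda>z. (1 - z) powr s * v z)"
  proof (rule hyp_odeI[OF \<open>open D\<close>])
  fix z assume z: "z \<in> D"
  hence z': "z \<in> slit_plane" using assms by auto
  hence nz: "1 - z \<noteq> 0" by (auto simp: slit_plane_iff)
    note v = hyp_odeD[OF assms(1,2) z]
  show "((\<lambda>z. (1 - z) powr s * v z) has_field_derivative
     (- s * (1 - z) powr (s - 1) * v z + (1 - z) powr s * deriv v z)) (at z)"
    by (rule DERIV_mult[OF DERIV_one_minus_powr[OF z'] v(1), THEN DERIV_cong]) (simp add: algebra_simps)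
  show "((\<lambda>z. - s * (1 - z) powr (s - 1) * v z + (1 - z) powr s * deriv v z) has_field_derivative
     (- s * (- (s - 1) * (1 - z) powr (s - 1 - 1) * v z + (1 - z) powr (s - 1) * deriv v z)
      + (- s * (1 - z) powr (s - 1) * deriv v z + (1 - z) powr s * deriv (deriv v) z))) (at z)"
    by (rule DERIV_add[OF DERIV_mult[OF DERIV_cmult[OF DERIV_one_minus_powr[OF z']] v(1)]
          DERIV_mult[OF DERIV_one_minus_powr[OF z'] v(2)], THEN DERIV_cong]) (simp add: algebra_simps)
  define p where "p = (1 - z) powr (s - 1 - 1)"
  have p: "(1 - z) powr (s - 1) = (1 - z) * p" "(1 - z) powr s = (1 - z)^2 * p"
    using nz one_minus_powr_diff[OF z', of s] one_minus_powr_diff[OF z', of "s - 1"] by (simp_all add: p_def power2_eq_square)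
  have "z * (1 - z) * (- s * (- (s - 1) * p * v z + ((1 - z) * p) * deriv v z)
      + (- s * ((1 - z) * p) * deriv v z + ((1 - z)^2 * p) * deriv (deriv v) z)) +
      (c - (a + b + 1) * z) * (- s * ((1 - z) * p) * v z + ((1 - z)^2 * p) * deriv v z) - a * b * (((1 - z)^2 * p) * v z)
      = p * (1 - z)^2 * (z * (1 - z) * deriv (deriv v) z + (c - (c - a + (c - b) + 1) * z) * deriv v z - (c - a) * (c - b) * v z)"
    unfolding s_def by algebra
  also have "\<dots> = 0" by (simp only: v(3) mult_zero_right)
  finally show "z * (1 - z) * (- s * (- (s - 1) * (1 - z) powr (s - 1 - 1) * v z + (1 - z) powr (s - 1) * deriv v z)
      + (- s * (1 - z) powr (s - 1) * deriv v z + (1 - z) powr s * deriv (deriv v) z)) +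
      (c - (a + b + 1) * z) * (- s * (1 - z) powr (s - 1) * v z + (1 - z) powr s * deriv v z) - a * b * ((1 - z) powr s * v z) = 0"
    unfolding p p_def [symmetric] .
qed
  thus ?thesis by (simp add: s_def)
qed

lemma hyp_ode_Pfaff_transform:
  assumes v: "hyp_ode a (c - b) c D v" and "open D" "open D'" "D' \<subseteq> slit_plane"
    and maps: "\<And>z. z \<in> D' \<Longrightarrow> z / (z - 1) \<in> D"
  shows "hyp_ode a b c D' (\<lambda>z. (1 - z) powr (- a) * v (z / (z - 1)))"
proof (rule hyp_odeI[OF \<open>open D'\<close>])
  fix z assume z: "z \<in> D'"
  hence z': "z \<in> slit_plane" using assms by auto
  hence nz: "1 - z \<noteq> 0" "z - 1 \<noteq> 0" by (auto simp: slit_plane_iff)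
  define w where "w = z / (z - 1)"
  note v = hyp_odeD[OF assms(1,2) maps[OF z], folded w_def]
  have dw: "((\<lambda>z. z / (z - 1)) has_field_derivative (- 1 / (1 - z)^2)) (at z)"
    using nz by (auto intro!: derivative_eq_intros simp: power2_eq_square divide_simps) (auto simp: algebra_simps)
  have v1: "((\<lambda>z. v (z / (z - 1))) has_field_derivative deriv v w * (- 1 / (1 - z)^2)) (at z)"
    using v(1) unfolding w_def by (rule DERIV_chain2[OF _ dw])
  have v2: "((\<lambda>z. deriv v (z / (z - 1))) has_field_derivative deriv (deriv v) w * (- 1 / (1 - z)^2)) (at z)"
    using v(2) unfolding w_def by (rule DERIV_chain2[OF _ dw])
  have shift: "(1 - z) powr (- a - 2) = (1 - z) powr (- a) / (1 - z)^2"
    using one_minus_powr_diff[OF z', of "- a"] one_minus_powr_diff[OF z', of "- a - 1"] by (simp add: power2_eq_square algebra_simps)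
  have "((\<lambda>z. (1 - z) powr (- a) * v (z / (z - 1))) has_field_derivative
      a * (1 - z) powr (- a - 1) * v w - (1 - z) powr (- a - 2) * deriv v w) (at z)"
    by (rule DERIV_mult[OF DERIV_one_minus_powr[OF z'] v1, THEN DERIV_cong]) (simp add: w_def shift)
  thus "((\<lambda>z. (1 - z) powr (- a) * v (z / (z - 1))) has_field_derivative
      a * (1 - z) powr (- a - 1) * v (z / (z - 1)) - (1 - z) powr (- a - 2) * deriv v (z / (z - 1))) (at z)"
    by (simp add: w_def)
  show "((\<lambda>z. a * (1 - z) powr (- a - 1) * v (z / (z - 1)) - (1 - z) powr (- a - 2) * deriv v (z / (z - 1)))
     has_field_derivative
      (a * (- (- a - 1) * (1 - z) powr (- a - 1 - 1) * v w + (1 - z) powr (- a - 1) * (deriv v w * (- 1 / (1 - z)^2)))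
      - (- (- a - 2) * (1 - z) powr (- a - 2 - 1) * deriv v w + (1 - z) powr (- a - 2) * (deriv (deriv v) w * (- 1 / (1 - z)^2))))) (at z)"
    by (rule DERIV_diff[OF DERIV_mult[OF DERIV_cmult[OF DERIV_one_minus_powr[OF z']] v1]
          DERIV_mult[OF DERIV_one_minus_powr[OF z'] v2], THEN DERIV_cong]) (simp add: algebra_simps w_def)
  define p where "p = (1 - z) powr (- a) / (1 - z)^4"
  define y where "y = 1 - z"
  have y: "y \<noteq> 0" "z = 1 - y" using nz by (auto simp: y_def)
  have p: "(1 - z) powr (- a) = y ^ 4 * p" "(1 - z) powr (- a - 1) = y ^ 3 * p"
    "(1 - z) powr (- a - 1 - 1) = y ^ 2 * p" "(1 - z) powr (- a - 2) = y ^ 2 * p" "(1 - z) powr (- a - 2 - 1) = y * p"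
    using y(1) one_minus_powr_diff[OF z', of "- a"] one_minus_powr_diff[OF z', of "- a - 1"]
      one_minus_powr_diff[OF z', of "- a - 2"] shift
    by (simp_all add: p_def y_def[symmetric] eval_nat_numeral)
  have w: "w = 1 - 1 / y" using y(1) nz by (simp add: w_def y(2) field_simps)
  have q: "1 / (1 - z)^2 = 1 / y^2" by (simp add: y_def)
  have v3: "(1 - y) * y * deriv (deriv v) w = c * y^3 * deriv v w + (a + (c - b) + 1) * (1 - y) * y^2 * deriv v w - a * (c - b) * y ^ 3 * v w"
  proof -
    have "0 = - (y^3) * (w * (1 - w) * deriv (deriv v) w + (c - (a + (c - b) + 1) * w) * deriv v w - a * (c - b) * v w)"
      using v(3) by simp
    also have "\<dots> = (1 - y) * y * deriv (deriv v) w - (c * y^3 * deriv v w + (a + (c - b) + 1) * (1 - y) * y^2 * deriv v w - a * (c - b) * y ^ 3 * v w)"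
      unfolding w using y(1) by (simp add: divide_simps) (simp add: algebra_simps eval_nat_numeral)
    finally show ?thesis by simp
  qed
  have "z * (1 - z) *
      (a * (- (- a - 1) * (y ^ 2 * p) * v w + (y ^ 3 * p) * (deriv v w * (- 1 / y^2)))
      - (- (- a - 2) * (y * p) * deriv v w + (y ^ 2 * p) * (deriv (deriv v) w * (- 1 / y^2)))) +
      (c - (a + b + 1) * z) * (a * (y ^ 3 * p) * v w - (y ^ 2 * p) * deriv v w) - a * b * ((y ^ 4 * p) * v w)
      = p * ((1 - y) * y * deriv (deriv v) w - (c * y^3 * deriv v w + (a + (c - b) + 1) * (1 - y) * y^2 * deriv v w - a * (c - b) * y ^ 3 * v w)
       + (c * y^3 * deriv v w - a * (c - b) * y ^ 3 * v w + (a + (c - b) + 1) * (1 - y) * y^2 * deriv v w)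
       + (1 - y) * y * (a * (a + 1) * y^2 * v w - (2 * a + 2) * y * deriv v w)
       + (c - (a + b + 1) * (1 - y)) * (a * y^3 * v w - y^2 * deriv v w) - a * b * y ^ 4 * v w)"
    using y(1) unfolding y(2) by (simp add: divide_simps) (simp add: algebra_simps eval_nat_numeral)
  also have "\<dots> = p * ((c * y^3 * deriv v w - a * (c - b) * y ^ 3 * v w + (a + (c - b) + 1) * (1 - y) * y^2 * deriv v w)
       + (1 - y) * y * (a * (a + 1) * y^2 * v w - (2 * a + 2) * y * deriv v w)
       + (c - (a + b + 1) * (1 - y)) * (a * y^3 * v w - y^2 * deriv v w) - a * b * y ^ 4 * v w)"
    unfolding v3 by simp
  also have "\<dots> = 0" by algebra
  finally show "z * (1 - z) *
      (a * (- (- a - 1) * (1 - z) powr (- a - 1 - 1) * v w + (1 - z) powr (- a - 1) * (deriv v w * (- 1 / (1 - z)^2)))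
      - (- (- a - 2) * (1 - z) powr (- a - 2 - 1) * deriv v w + (1 - z) powr (- a - 2) * (deriv (deriv v) w * (- 1 / (1 - z)^2)))) +
      (c - (a + b + 1) * z) * (a * (1 - z) powr (- a - 1) * v (z / (z - 1)) - (1 - z) powr (- a - 2) * deriv v (z / (z - 1)))
      - a * b * ((1 - z) powr (- a) * v (z / (z - 1))) = 0"
    unfolding p unfolding y_def [symmetric] w_def [symmetric] .
qed


section \<open>Transformations of Pfaff and Euler\<close>

lemma Pfaff_map_slit_plane:
  assumes "z \<in> slit_plane"
  shows "z / (z - 1) \<in> slit_plane" and "1 - z / (z - 1) = 1 / (1 - z)"
proof -
  have nz: "z \<noteq> 1" using assms by (auto simp: slit_plane_iff)
  thus *: "1 - z / (z - 1) = 1 / (1 - z)" by (simp add: field_simps)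
  have "inverse (1 - z) \<in> \<real>\<^sub>\<le>\<^sub>0 \<longleftrightarrow> 1 - z \<in> \<real>\<^sub>\<le>\<^sub>0"
    by (metis inverse_inverse_eq nonpos_Reals_inverse_I)
  thus "z / (z - 1) \<in> slit_plane" using assms unfolding slit_plane_iff * by (simp add: divide_inverse)
qed

lemma reg_hyp_Pfaff_aux:
  assumes c: "c \<notin> \<int>\<^sub>\<le>\<^sub>0" and z: "z \<in> slit_plane"
  shows "reg_hyp a b c z = (1 - z) powr (- a) * reg_hyp a (c - b) c (z / (z - 1))"
proof -
  have "hyp_ode a b c slit_plane (\<lambda>z. (1 - z) powr (- a) * reg_hyp a (c - b) c (z / (z - 1)))"
    by (rule hyp_ode_Pfaff_transform[OF hyp_ode_reg_hyp]) (auto simp: Pfaff_map_slit_plane)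
  from hyp_ode_unique_analytic[OF this c _ _ _ _ z] show ?thesis
    using c by (simp add: reg_hyp_0 Gamma_def rGamma_eq_zero_iff)
qed

lemma reg_hyp_Euler:
  assumes c: "c \<notin> \<int>\<^sub>\<le>\<^sub>0" and z: "z \<in> slit_plane"
  shows "reg_hyp a b c z = (1 - z) powr (c - a - b) * reg_hyp (c - a) (c - b) c z"
proof -
  have "hyp_ode a b c slit_plane (\<lambda>z. (1 - z) powr (c - a - b) * reg_hyp (c - a) (c - b) c z)"
    by (rule hyp_ode_Euler_transform[OF hyp_ode_reg_hyp]) auto
  from hyp_ode_unique_analytic[OF this c _ _ _ _ z] show ?thesis
    using c by (simp add: reg_hyp_0 Gamma_def rGamma_eq_zero_iff)
qed

lemma rGamma_Suc_of_nat: "rGamma (1 + of_nat n :: complex) = 1 / fact n"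
  using Gamma_fact[of n, where 'a = complex] by (simp add: rGamma_inverse_Gamma divide_inverse)

text \<open>
  For \<open>c = - n\<close> the first \<open>n + 1\<close> coefficients of the regularised series vanish.
\<close>
lemma reg_hyp_nonpos_Int:
  assumes "z \<in> slit_plane"
  shows "reg_hyp a b (- of_nat n) z = pochhammer a (Suc n) * pochhammer b (Suc n) * z ^ Suc n *
           reg_hyp (a + of_nat (Suc n)) (b + of_nat (Suc n)) (of_nat (Suc n) + 1) z"
proof -
  let ?N = "Suc n"
  let ?R = "reg_hyp (a + of_nat ?N) (b + of_nat ?N) (of_nat ?N + 1)"
  have on_ball: "reg_hyp a b (- of_nat n) z = pochhammer a ?N * pochhammer b ?N * z ^ ?N * ?R z" if z: "z \<in> ball 0 1" for z
  proof (rule sums_unique2)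
    show "(\<lambda>k. hyp_coeff a b (- of_nat n) k * z ^ k) sums reg_hyp a b (- of_nat n) z"
      using z by (intro continues_sums[OF continues_reg_hyp]) auto
    have "(\<lambda>k. pochhammer a ?N * pochhammer b ?N * z ^ ?N * (hyp_coeff (a + of_nat ?N) (b + of_nat ?N) (of_nat ?N + 1) k * z ^ k))
        sums (pochhammer a ?N * pochhammer b ?N * z ^ ?N * ?R z)"
      using z by (intro sums_mult continues_sums[OF continues_reg_hyp]) auto
    also have "(\<lambda>k. pochhammer a ?N * pochhammer b ?N * z ^ ?N * (hyp_coeff (a + of_nat ?N) (b + of_nat ?N) (of_nat ?N + 1) k * z ^ k))
        = (\<lambda>k. hyp_coeff a b (- of_nat n) (k + ?N) * z ^ (k + ?N))"
    proof
      fix k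
      have "- of_nat n + of_nat (k + ?N) = (1 + of_nat k :: complex)" by simp
      hence 1: "rGamma (- of_nat n + of_nat (k + ?N)) = (1 / fact k :: complex)"
        by (simp only: rGamma_Suc_of_nat)
      have "of_nat ?N + 1 + of_nat k = (1 + of_nat (k + ?N) :: complex)" by simp
      hence 2: "rGamma (of_nat ?N + 1 + of_nat k) = (1 / fact (k + ?N) :: complex)"
        by (simp only: rGamma_Suc_of_nat)
      have 3: "pochhammer x (k + ?N) = pochhammer x ?N * pochhammer (x + of_nat ?N) k" for x :: complex
        using pochhammer_product'[of x ?N k] by (simp only: add.commute)
      show "pochhammer a ?N * pochhammer b ?N * z ^ ?N * (hyp_coeff (a + of_nat ?N) (b + of_nat ?N) (of_nat ?N + 1) k * z ^ k)
        = hyp_coeff a b (- of_nat n) (k + ?N) * z ^ (k + ?N)"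
        unfolding hyp_coeff_def 1 2 3 power_add by (simp only: mult_ac times_divide_eq_left times_divide_eq_right divide_divide_eq_left mult_1_left mult_1_right)
    qed
    also have "\<dots> sums (pochhammer a ?N * pochhammer b ?N * z ^ ?N * ?R z) \<longleftrightarrow>
       (\<lambda>k. hyp_coeff a b (- of_nat n) k * z ^ k) sums (pochhammer a ?N * pochhammer b ?N * z ^ ?N * ?R z)"
    proof (rule sums_zero_iff_shift)
      fix k assume "k < ?N"
      then obtain j where j: "n = k + j" by (auto simp: less_Suc_eq_le le_iff_add)
      have "- of_nat n + of_nat k = (- of_nat j :: complex)" by (simp add: j)
      hence "rGamma (- of_nat n + of_nat k) = (0 :: complex)" by (simp add: rGamma_eq_zero_iff)
      thus "hyp_coeff a b (- of_nat n) k * z ^ k = 0" by (simp add: hyp_coeff_def)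
    qed
    finally show "(\<lambda>k. hyp_coeff a b (- of_nat n) k * z ^ k) sums (pochhammer a ?N * pochhammer b ?N * z ^ ?N * ?R z)" .
  qed
  have "(\<lambda>z. pochhammer a ?N * pochhammer b ?N * z ^ ?N * ?R z) holomorphic_on slit_plane"
    by (intro holomorphic_intros)
  from slit_plane_eqI[OF holomorphic_reg_hyp this on_ball assms] show ?thesis by simp
qed

lemma pochhammer_flip: "pochhammer (- x - of_nat n) (Suc n) = (- 1) ^ Suc n * pochhammer (x :: complex) (Suc n)"
proof -
  have "pochhammer (- (x + of_nat n)) (Suc n) = (- 1) ^ Suc n * pochhammer (x + of_nat n - of_nat (Suc n) + 1) (Suc n)"
    by (rule pochhammer_minus)
  moreover have "- (x + of_nat n) = - x - of_nat n" "x + of_nat n - of_nat (Suc n) + 1 = x" by simp_all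
  ultimately show ?thesis by (simp only:)
qed

text \<open>
  At \<open>c = - n\<close> uniqueness of the analytic solution fails, but \<open>reg_hyp_nonpos_Int\<close> leads back to
  \<open>c = n + 2\<close>. The signs \<open>(-1)\<^sup>n\<^sup>+\<^sup>1\<close> from \<open>(z / (z - 1))\<^sup>n\<^sup>+\<^sup>1\<close> and from the Pochhammer symbol
  cancel.
\<close>
lemma reg_hyp_Pfaff:
  assumes z: "z \<in> slit_plane"
  shows "reg_hyp a b c z = (1 - z) powr (- a) * reg_hyp a (c - b) c (z / (z - 1))"
proof (cases "c \<in> \<int>\<^sub>\<le>\<^sub>0")
  case True
  then obtain n where n: "c = - of_nat n" by (elim nonpos_Ints_cases')
  let ?N = "Suc n" and ?w = "z / (z - 1)"
  have nz: "z \<noteq> 1" using z by (auto simp: slit_plane_iff)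
  let ?R = "reg_hyp (a + of_nat ?N) (1 - b) (of_nat ?N + 1) ?w"
  have pole: "complex_of_nat ?N + 1 \<notin> \<int>\<^sub>\<le>\<^sub>0" by (auto dest!: nonpos_Ints_Re)
  \<comment> \<open>Bring the parameters of the transformed function into the form of the lemma above.\<close>
  have e1: "of_nat ?N + 1 - (b + of_nat ?N) = 1 - b" by simp
  have e2: "- b - of_nat n + of_nat ?N = 1 - b" by simp
  have e3: "- (a + of_nat ?N) = - a - of_nat ?N" by simp
  have p1: "(1 - z) powr (- a - of_nat ?N) = (1 - z) powr (- a) / (1 - z) ^ ?N"
    using nz by (subst powr_diff) (simp add: powr_nat' del: power_Suc of_nat_Suc)
  have "reg_hyp a b c z = pochhammer a ?N * pochhammer b ?N * (z ^ ?N * ((1 - z) powr (- a) / (1 - z) ^ ?N * ?R))"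
    unfolding n reg_hyp_nonpos_Int[OF z] reg_hyp_Pfaff_aux[OF pole z, of "a + of_nat ?N" "b + of_nat ?N"] e1 e3 p1 mult.assoc ..
  also have "z ^ ?N * ((1 - z) powr (- a) / (1 - z) ^ ?N * ?R) = (1 - z) powr (- a) * ((- 1) ^ ?N * ?w ^ ?N * ?R)"
  proof -
    have "(- 1) ^ ?N * ?w ^ ?N = (- 1 * ?w) ^ ?N" by (rule power_mult_distrib [symmetric])
    also have "- 1 * ?w = z / (1 - z)" using nz by (simp add: divide_simps) (simp add: algebra_simps)
    finally show ?thesis by (simp add: power_divide del: power_Suc)
  qed
  finally have "reg_hyp a b c z = (1 - z) powr (- a) * (pochhammer a ?N * ((- 1) ^ ?N * pochhammer b ?N) * ?w ^ ?N * ?R)"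
    by (simp only: mult_ac)
  also have "pochhammer a ?N * ((- 1) ^ ?N * pochhammer b ?N) * ?w ^ ?N * ?R = reg_hyp a (- b - of_nat n) (- of_nat n) ?w"
    unfolding reg_hyp_nonpos_Int[OF Pfaff_map_slit_plane(1)[OF z]] pochhammer_flip e2 ..
  also have "- b - of_nat n = c - b" by (simp add: n)
  finally show ?thesis unfolding n .
qed (rule reg_hyp_Pfaff_aux[OF _ z])

section \<open>Abelian limits\<close>

lemma summable_bounded_powser:
  fixes v :: "nat \<Rightarrow> complex"
  assumes "Bseq v" "norm z < 1"
  shows "summable (\<lambda>k. v k * z ^ k)"
proof -
  from assms(1) obtain K where "\<And>k. norm (v k) \<le> K" by (auto simp: Bseq_def)
  hence "norm (v k * z ^ k) \<le> K * norm z ^ k" for k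
    by (auto simp: norm_mult norm_power intro!: mult_right_mono)
  moreover have "summable (\<lambda>k. K * norm z ^ k)"
    using assms(2) by (intro summable_mult summable_geometric) auto
  ultimately show ?thesis by (rule summable_comparison_test'[rotated])
qed

text \<open>
  The weights \<open>(1 - x) x\<^sup>k\<close> have sum \<open>1\<close> and each of them tends to \<open>0\<close>; the left-hand side is thus an
  average of the sequence that forgets every finite initial part.
\<close>
lemma Abel_mean_limit:
  fixes v :: "nat \<Rightarrow> complex"
  assumes "v \<longlonglongrightarrow> L"
  shows "((\<lambda>x. (1 - complex_of_real x) * (\<Sum>k. v k * complex_of_real x ^ k)) \<longlongrightarrow> L) (at_left 1)"
proof (rule tendstoI)
  fix e :: real assume e: "e > 0"
  define d where "d = (\<lambda>k. v k - L)"
  have "d \<longlonglongrightarrow> 0" using assms unfolding d_def by (rule LIM_zero)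
  hence Bd: "Bseq d" using convergentI convergent_imp_Bseq by blast
  from \<open>d \<longlonglongrightarrow> 0\<close> e obtain N where N: "\<And>k. k \<ge> N \<Longrightarrow> norm (d k) < e / 2"
    by (metis LIMSEQ_D half_gt_zero diff_zero)
  define B where "B = (\<Sum>k<N. norm (d k))"
  have bound: "norm ((1 - complex_of_real x) * (\<Sum>k. v k * complex_of_real x ^ k) - L) \<le> (1 - x) * B + e / 2"
    if x: "x \<in> {0<..<1}" for x
  proof -
    let ?x = "complex_of_real x"
    have nx: "norm ?x < 1" using x by simp
    have s1: "summable (\<lambda>k. norm (d k * ?x ^ k))"
    proof -
      from Bd obtain K where "\<And>k. norm (d k) \<le> K" by (auto simp: Bseq_def)
      hence "norm (norm (d k * ?x ^ k)) \<le> K * x ^ k" for k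
        using x by (auto simp: norm_mult norm_power intro!: mult_right_mono)
      moreover have "summable (\<lambda>k. K * x ^ k)" using x by (intro summable_mult summable_geometric) auto
      ultimately show ?thesis by (rule summable_comparison_test'[rotated])
    qed
    have geo: "(\<lambda>k. L * ?x ^ k) sums (L * (1 / (1 - ?x)))" by (intro sums_mult geometric_sums nx)
    have "(\<lambda>k. d k * ?x ^ k + L * ?x ^ k) sums ((\<Sum>k. d k * ?x ^ k) + L * (1 / (1 - ?x)))"
      by (intro sums_add geo summable_sums summable_norm_cancel[OF s1])
    hence "(\<Sum>k. v k * ?x ^ k) = (\<Sum>k. d k * ?x ^ k) + L * (1 / (1 - ?x))"
      by (simp add: sums_iff d_def algebra_simps)
    moreover have "1 - ?x \<noteq> 0" using x by auto
    ultimately have "(1 - ?x) * (\<Sum>k. v k * ?x ^ k) - L = (1 - ?x) * (\<Sum>k. d k * ?x ^ k)"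
      by (simp add: field_simps)
    also have "norm \<dots> = (1 - x) * norm (\<Sum>k. d k * ?x ^ k)"
    proof -
      have "norm (1 - ?x) = norm (complex_of_real (1 - x))" by simp
      also have "\<dots> = 1 - x" using x by (subst norm_of_real) auto
      finally show ?thesis by (simp add: norm_mult)
    qed
    also have "\<dots> \<le> (1 - x) * (B + e / 2 * (1 / (1 - x)))"
    proof (intro mult_left_mono)
      have "norm (\<Sum>k. d k * ?x ^ k) \<le> (\<Sum>k. norm (d k * ?x ^ k))" by (rule summable_norm[OF s1])
      also have sm: "(\<lambda>k. (if k < N then norm (d k) else 0) + e / 2 * x ^ k) sums (B + e / 2 * (1 / (1 - x)))"
        using x sums_If_finite_set[of "{..<N}" "\<lambda>k. norm (d k)"] unfolding B_def
        by (intro sums_add sums_mult geometric_sums) auto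
      have "(\<Sum>k. norm (d k * ?x ^ k)) \<le> (\<Sum>k. (if k < N then norm (d k) else 0) + e / 2 * x ^ k)"
      proof (rule suminf_le[OF _ s1 sums_summable[OF sm]])
        fix k
        have xk: "0 \<le> x ^ k" "x ^ k \<le> 1" using x by (auto intro: power_le_one)
        show "norm (d k * ?x ^ k) \<le> (if k < N then norm (d k) else 0) + e / 2 * x ^ k"
        proof (cases "k < N")
          case True
          have "norm (d k) * x ^ k \<le> norm (d k)" using xk by (intro mult_right_le_one_le) auto
          thus ?thesis using True xk e x by (auto simp: norm_mult norm_power intro!: add_increasing2)
        next
          case False
          hence "norm (d k) * x ^ k \<le> e / 2 * x ^ k" using N[of k] xk by (intro mult_right_mono) auto
          thus ?thesis using False x by (auto simp: norm_mult norm_power)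
        qed
      qed
      also have "\<dots> = B + e / 2 * (1 / (1 - x))" using sm by (simp add: sums_iff)
      finally show "norm (\<Sum>k. d k * ?x ^ k) \<le> B + e / 2 * (1 / (1 - x))" .
    qed (use x in auto)
    also have "\<dots> = (1 - x) * B + e / 2" using x by (simp add: field_simps)
    finally show ?thesis .
  qed
  have "((\<lambda>x. (1 - x) * B + e / 2) \<longlongrightarrow> (1 - 1) * B + e / 2) (at_left 1)"
    by (intro tendsto_intros)
  hence "eventually (\<lambda>x. (1 - x) * B + e / 2 < e) (at_left 1)"
    using order_tendstoD(2)[of _ _ "at_left 1" e] e by fastforce
  moreover have "eventually (\<lambda>x. x \<in> {0<..<1::real}) (at_left 1)"
    by (rule eventually_at_left_real) auto
  ultimately show "eventually (\<lambda>x. dist ((1 - complex_of_real x) * (\<Sum>k. v k * complex_of_real x ^ k)) L < e) (at_left 1)"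
    by eventually_elim (use bound in \<open>force simp: dist_norm\<close>)
qed

lemma Abel_telescoping_limit:
  fixes v :: "nat \<Rightarrow> complex"
  assumes "v \<longlonglongrightarrow> L" "v 0 = 0"
  shows "((\<lambda>x. \<Sum>k. (v (Suc k) - v k) * complex_of_real x ^ k) \<longlongrightarrow> L) (at_left 1)"
proof -
  have "(\<lambda>k. v (Suc k)) \<longlonglongrightarrow> L" using assms(1) by (rule LIMSEQ_Suc)
  from Abel_mean_limit[OF this]
  show ?thesis
  proof (rule Lim_transform_eventually)
    have "eventually (\<lambda>x. x \<in> {0<..<1::real}) (at_left 1)"
      by (rule eventually_at_left_real) auto
    thus "eventually (\<lambda>x. (1 - complex_of_real x) * (\<Sum>k. v (Suc k) * complex_of_real x ^ k) =
              (\<Sum>k. (v (Suc k) - v k) * complex_of_real x ^ k)) (at_left 1)"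
    proof eventually_elim
      case (elim x)
      let ?x = "complex_of_real x"
      have B: "Bseq v" using assms(1) convergentI convergent_imp_Bseq by blast
      hence s: "summable (\<lambda>k. v k * ?x ^ k)" "summable (\<lambda>k. v (Suc k) * ?x ^ k)"
        using elim Bseq_Suc_iff[of v] by (auto intro!: summable_bounded_powser)
      have "(\<lambda>k. v (Suc k) * ?x ^ Suc k) sums (?x * (\<Sum>k. v (Suc k) * ?x ^ k))"
        using sums_mult[OF summable_sums[OF s(2)], of ?x] by (simp add: mult_ac)
      hence "(\<lambda>k. v k * ?x ^ k) sums (?x * (\<Sum>k. v (Suc k) * ?x ^ k))"
        using assms(2) by (subst (asm) sums_Suc_iff) simp
      from sums_diff[OF summable_sums[OF s(2)] this] show ?case
        by (simp add: sums_iff algebra_simps)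
    qed
  qed
qed

lemma Abel_limit:
  fixes s :: "nat \<Rightarrow> complex"
  assumes "s sums L"
  shows "((\<lambda>x. \<Sum>k. s k * complex_of_real x ^ k) \<longlongrightarrow> L) (at_left 1)"
  using Abel_telescoping_limit[of "\<lambda>n. \<Sum>k<n. s k" L] assms by (simp add: sums_def)

section \<open>The zero-balanced series at 1\<close>

text \<open>
  This is \<open>\<Gamma>(c + n) \<sim> (n - 1)! n\<^sup>c\<close>. For \<open>c\<close> outside the poles it is the limit definition of
  \<open>\<Gamma>\<close>; at a pole the quotient \<open>(c + n) / n \<rightarrow> 1\<close> passes it on from \<open>c + 1\<close>.
\<close>
lemma rGamma_shift_asymp:
  "(\<lambda>n. rGamma (c + of_nat n) * (fact (n - 1) * exp (c * of_real (ln (of_nat n))))) \<longlonglongrightarrow> (1 :: complex)"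
proof -
  have non_pole: "(\<lambda>n. rGamma (c + of_nat n) * (fact (n - 1) * exp (c * of_real (ln (of_nat n))))) \<longlonglongrightarrow> 1"
    if c: "c \<notin> \<int>\<^sub>\<le>\<^sub>0" for c :: complex
  proof -
    have "Gamma_series' c \<longlonglongrightarrow> Gamma c" by (rule Gamma_series'_LIMSEQ)
    hence "(\<lambda>n. rGamma c * Gamma_series' c n) \<longlonglongrightarrow> rGamma c * Gamma c" by (intro tendsto_intros)
    also have "rGamma c * Gamma c = 1" using c by (simp add: Gamma_def rGamma_eq_zero_iff)
    also have "(\<lambda>n. rGamma c * Gamma_series' c n) = (\<lambda>n. rGamma (c + of_nat n) * (fact (n - 1) * exp (c * of_real (ln (of_nat n)))))"
    proof
      fix n
      have "pochhammer c n \<noteq> 0" using c by (auto simp: pochhammer_eq_0_iff)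
      thus "rGamma c * Gamma_series' c n = rGamma (c + of_nat n) * (fact (n - 1) * exp (c * of_real (ln (of_nat n))))"
        using pochhammer_rGamma[of c n] by (simp add: Gamma_series'_def)
    qed
    finally show ?thesis .
  qed
  obtain N where N: "real N > - Re c" using reals_Archimedean2 by blast
  have "(\<lambda>n. rGamma (c + of_nat j + of_nat n) * (fact (n - 1) * exp ((c + of_nat j) * of_real (ln (of_nat n))))) \<longlonglongrightarrow> 1"
    if "j \<le> N" for j using that
  proof (induction j rule: inc_induct)
    case base
    show ?case using N by (intro non_pole) (auto dest!: nonpos_Ints_Re)
  next
    case (step j)
    define d where "d = c + of_nat j"
    have d1: "c + of_nat (Suc j) = d + 1" by (simp add: d_def)
    have "(\<lambda>n. (d / of_nat n + 1) * (rGamma (d + 1 + of_nat n) * (fact (n - 1) * exp ((d + 1) * of_real (ln (of_nat n)))))) \<longlonglongrightarrow> (0 + 1) * 1"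
      using step.IH unfolding d1
      by (intro tendsto_intros tendsto_divide_0[OF tendsto_const] tendsto_of_nat)
    hence "(\<lambda>n. (d / of_nat n + 1) * (rGamma (d + 1 + of_nat n) * (fact (n - 1) * exp ((d + 1) * of_real (ln (of_nat n)))))) \<longlonglongrightarrow> 1"
      by simp
    moreover have "eventually (\<lambda>n. (d / of_nat n + 1) * (rGamma (d + 1 + of_nat n) * (fact (n - 1) * exp ((d + 1) * of_real (ln (of_nat n)))))
         = rGamma (d + of_nat n) * (fact (n - 1) * exp (d * of_real (ln (of_nat n))))) sequentially"
      using eventually_gt_at_top[of 0]
    proof eventually_elim
      case (elim n)
      have A: "exp ((d + 1) * of_real (ln (of_nat n))) = exp (d * of_real (ln (of_nat n))) * of_nat n"
        using elim by (simp add: ring_distribs exp_add exp_of_real)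
      have B: "rGamma (d + of_nat n) = (d + of_nat n) * rGamma (d + 1 + of_nat n)"
        using rGamma_plus1[of "d + of_nat n"] by (simp only: add_ac)
      have C: "(d / of_nat n + 1) * of_nat n = d + of_nat n" using elim by (simp add: field_simps)
      have "(d / of_nat n + 1) * (rGamma (d + 1 + of_nat n) * (fact (n - 1) * exp ((d + 1) * of_real (ln (of_nat n)))))
         = ((d / of_nat n + 1) * of_nat n) * rGamma (d + 1 + of_nat n) * (fact (n - 1) * exp (d * of_real (ln (of_nat n))))"
        unfolding A by (simp only: mult_ac)
      thus ?case unfolding B C by (simp only: mult.assoc)
    qed
    ultimately show ?case unfolding d_def by (rule Lim_transform_eventually)
  qed
  from this[of 0] show ?thesis by simp
qed

text \<open>
  These are the coefficients \<open>\<Gamma>(a + k) \<Gamma>(b + k) / (\<Gamma>(a + b + k) k!)\<close>, which behave like \<open>1 / k\<close>.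
\<close>
definition zero_balanced_coeff :: "complex \<Rightarrow> complex \<Rightarrow> nat \<Rightarrow> complex" where
  "zero_balanced_coeff a b k = Gamma a * Gamma b * hyp_coeff a b (a + b) k"

lemma zero_balanced_coeff_asymp:
  assumes "a \<notin> \<int>\<^sub>\<le>\<^sub>0" "b \<notin> \<int>\<^sub>\<le>\<^sub>0"
  shows "(\<lambda>k. of_nat k * zero_balanced_coeff a b k) \<longlonglongrightarrow> 1"
proof -
  have G: "Gamma a \<noteq> 0" "Gamma b \<noteq> 0" using assms by (auto simp: Gamma_eq_zero_iff)
  have "(\<lambda>n. Gamma a / Gamma_series' a n * (Gamma b / Gamma_series' b n) *
           (rGamma ((a + b) + of_nat n) * (fact (n - 1) * exp ((a + b) * of_real (ln (of_nat n))))))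
        \<longlonglongrightarrow> Gamma a / Gamma a * (Gamma b / Gamma b) * 1"
    by (intro tendsto_intros Gamma_series'_LIMSEQ rGamma_shift_asymp G)
  hence "(\<lambda>n. Gamma a / Gamma_series' a n * (Gamma b / Gamma_series' b n) *
           (rGamma ((a + b) + of_nat n) * (fact (n - 1) * exp ((a + b) * of_real (ln (of_nat n))))))
        \<longlonglongrightarrow> 1" using G by simp
  moreover have "eventually (\<lambda>n. Gamma a / Gamma_series' a n * (Gamma b / Gamma_series' b n) *
           (rGamma ((a + b) + of_nat n) * (fact (n - 1) * exp ((a + b) * of_real (ln (of_nat n))))) = of_nat n * zero_balanced_coeff a b n) sequentially"
    using eventually_gt_at_top[of 0]
  proof eventually_elim
    case (elim n)
    have f: "fact n = of_nat n * (fact (n - 1) :: complex)" using elim by (simp add: fact_reduce)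
    have "exp ((a + b) * of_real (ln (of_nat n))) = exp (a * of_real (ln (of_nat n))) * exp (b * of_real (ln (of_nat n)) :: complex)"
      by (simp add: ring_distribs exp_add)
    thus ?case using elim
      by (simp add: zero_balanced_coeff_def hyp_coeff_def Gamma_series'_def f divide_simps)
  qed
  ultimately show ?thesis by (rule Lim_transform_eventually)
qed

text \<open>
  The right-hand side telescopes. Summed against \<open>x\<^sup>k\<close> for \<open>x \<rightarrow> 1-\<close>, it gives minus the limit of
  \<open>k u\<^sub>k\<close>, that is, \<open>- 1\<close>.
\<close>
lemma zero_balanced_coeff_step:
  assumes "a \<notin> \<int>\<^sub>\<le>\<^sub>0"
  shows "a * (zero_balanced_coeff (a + 1) b k - zero_balanced_coeff a b k) = of_nat k * zero_balanced_coeff a b k - of_nat (Suc k) * zero_balanced_coeff a b (Suc k)"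
proof -
  have a0: "a \<noteq> 0" using assms by auto
  define X where "X = Gamma a * Gamma b * pochhammer a k * pochhammer b k * rGamma (a + b + of_nat k + 1) / fact k"
  have 1: "zero_balanced_coeff a b k = (a + b + of_nat k) * X"
  proof -
    have r: "rGamma (a + b + of_nat k) = (a + b + of_nat k) * rGamma (a + b + of_nat k + 1)"
      by (simp only: rGamma_plus1)
    show ?thesis unfolding zero_balanced_coeff_def hyp_coeff_def X_def r by (simp only: mult_ac times_divide_eq_left times_divide_eq_right)
  qed
  have "a + b + of_nat (Suc k) = a + b + of_nat k + 1" by simp
  hence 2: "of_nat (Suc k) * zero_balanced_coeff a b (Suc k) = (a + of_nat k) * (b + of_nat k) * X"
    unfolding zero_balanced_coeff_def hyp_coeff_def X_def
    using of_nat_neq_0[of k, where 'a = complex] by (simp only: pochhammer_rec' fact_Suc) (simp add: mult_ac)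
  have P: "a * pochhammer (a + 1) k = (a + of_nat k) * pochhammer a k"
    using pochhammer_rec[of a k] pochhammer_rec'[of a k] by (simp only:)
  have G: "Gamma (a + 1) = a * Gamma a" using assms by (rule Gamma_plus1)
  have S: "a + 1 + b + of_nat k = a + b + of_nat k + 1" by simp
  have "zero_balanced_coeff (a + 1) b k = (a * pochhammer (a + 1) k) * (Gamma a * Gamma b * pochhammer b k * rGamma (a + b + of_nat k + 1) / fact k)"
    unfolding zero_balanced_coeff_def hyp_coeff_def G S by (simp only: mult_ac times_divide_eq_left times_divide_eq_right)
  hence 3: "zero_balanced_coeff (a + 1) b k = (a + of_nat k) * X"
    unfolding P X_def by (simp only: mult_ac times_divide_eq_left times_divide_eq_right)
  show ?thesis unfolding 1 2 3 by (simp add: algebra_simps)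
qed

definition zero_balanced :: "complex \<Rightarrow> complex \<Rightarrow> complex \<Rightarrow> complex" where
  "zero_balanced a b z = Gamma a * Gamma b * reg_hyp a b (a + b) z"

lemma zero_balanced_sums: "norm z < 1 \<Longrightarrow> (\<lambda>k. zero_balanced_coeff a b k * z ^ k) sums zero_balanced a b z"
  unfolding zero_balanced_def zero_balanced_coeff_def using sums_mult[OF continues_sums[OF continues_reg_hyp], of z "Gamma a * Gamma b"]
  by (simp add: mult.assoc)

lemma zero_balanced_commute: "zero_balanced a b = zero_balanced b a"
  by (simp add: zero_balanced_def fun_eq_iff reg_hyp_commute[of a b] add.commute)

definition zero_balanced_limit :: "complex \<Rightarrow> complex \<Rightarrow> bool" where
  "zero_balanced_limit a b \<longleftrightarrow> ((\<lambda>x. zero_balanced a b (complex_of_real x) + Ln (1 - complex_of_real x)) \<longlongrightarrow>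
      - Digamma a - Digamma b - 2 * euler_mascheroni) (at_left 1)"

lemma zero_balanced_limit_commute: "zero_balanced_limit a b \<longleftrightarrow> zero_balanced_limit b a"
proof -
  have "- Digamma a - Digamma b - 2 * euler_mascheroni = - Digamma b - Digamma a - 2 * euler_mascheroni" by simp
  thus ?thesis unfolding zero_balanced_limit_def zero_balanced_commute[of a b] by (simp only:)
qed

lemma eventually_unit_interval: "eventually (\<lambda>x. x \<in> {0<..<1::real}) (at_left 1)"
  by (rule eventually_at_left_real) auto

lemma zero_balanced_diff_limit:
  assumes a: "a \<notin> \<int>\<^sub>\<le>\<^sub>0" and b: "b \<notin> \<int>\<^sub>\<le>\<^sub>0"
  shows "((\<lambda>x. zero_balanced (a + 1) b (complex_of_real x) - zero_balanced a b (complex_of_real x)) \<longlongrightarrow> - 1 / a) (at_left 1)"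
proof -
  have a0: "a \<noteq> 0" using a by auto
  have "((\<lambda>x. \<Sum>k. (of_nat (Suc k) * zero_balanced_coeff a b (Suc k) - of_nat k * zero_balanced_coeff a b k) * complex_of_real x ^ k) \<longlongrightarrow> 1) (at_left 1)"
    using Abel_telescoping_limit[OF zero_balanced_coeff_asymp[OF a b]] by simp
  hence "((\<lambda>x. - 1 / a * (\<Sum>k. (of_nat (Suc k) * zero_balanced_coeff a b (Suc k) - of_nat k * zero_balanced_coeff a b k) * complex_of_real x ^ k)) \<longlongrightarrow> - 1 / a * 1) (at_left 1)"
    by (intro tendsto_intros)
  hence *: "((\<lambda>x. - 1 / a * (\<Sum>k. (of_nat (Suc k) * zero_balanced_coeff a b (Suc k) - of_nat k * zero_balanced_coeff a b k) * complex_of_real x ^ k)) \<longlongrightarrow> - 1 / a) (at_left 1)"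
    by simp
  show ?thesis
  proof (rule Lim_transform_eventually[OF *])
    show "eventually (\<lambda>x. - 1 / a * (\<Sum>k. (of_nat (Suc k) * zero_balanced_coeff a b (Suc k) - of_nat k * zero_balanced_coeff a b k) * complex_of_real x ^ k)
            = zero_balanced (a + 1) b (complex_of_real x) - zero_balanced a b (complex_of_real x)) (at_left 1)"
      using eventually_unit_interval
    proof eventually_elim
      case (elim x)
      let ?x = "complex_of_real x"
      have nx: "norm ?x < 1" using elim by simp
      have "(\<lambda>k. - a * (zero_balanced_coeff (a + 1) b k * ?x ^ k - zero_balanced_coeff a b k * ?x ^ k)) sums (- a * (zero_balanced (a + 1) b ?x - zero_balanced a b ?x))"
        by (intro sums_mult sums_diff zero_balanced_sums nx)
      moreover have "- a * (zero_balanced_coeff (a + 1) b k * ?x ^ k - zero_balanced_coeff a b k * ?x ^ k) =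
          (of_nat (Suc k) * zero_balanced_coeff a b (Suc k) - of_nat k * zero_balanced_coeff a b k) * ?x ^ k" for k
      proof -
        have "- a * (zero_balanced_coeff (a + 1) b k * ?x ^ k - zero_balanced_coeff a b k * ?x ^ k) = - (a * (zero_balanced_coeff (a + 1) b k - zero_balanced_coeff a b k)) * ?x ^ k"
          by (simp add: algebra_simps)
        also have "\<dots> = (of_nat (Suc k) * zero_balanced_coeff a b (Suc k) - of_nat k * zero_balanced_coeff a b k) * ?x ^ k"
          unfolding zero_balanced_coeff_step[OF a] by simp
        finally show ?thesis .
      qed
      ultimately have "(\<Sum>k. (of_nat (Suc k) * zero_balanced_coeff a b (Suc k) - of_nat k * zero_balanced_coeff a b k) * ?x ^ k) = - a * (zero_balanced (a + 1) b ?x - zero_balanced a b ?x)"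
        by (simp add: sums_iff)
      thus ?case using a0 by simp
    qed
  qed
qed

text \<open>
  Raising \<open>a\<close> by \<open>1\<close> changes the series by \<open>- 1 / a\<close> in the limit, and by the functional equation of \<open>\<psi>\<close>
  it changes \<open>- \<psi>(a)\<close> by the same amount.
\<close>
lemma zero_balanced_limit_step:
  assumes a: "a \<notin> \<int>\<^sub>\<le>\<^sub>0" and b: "b \<notin> \<int>\<^sub>\<le>\<^sub>0"
  shows "zero_balanced_limit (a + 1) b \<longleftrightarrow> zero_balanced_limit a b"
proof -
  have a0: "a \<noteq> 0" using a by auto
  have D: "Digamma (a + 1) = Digamma a + 1 / a" using a0 by (rule Digamma_plus1)
  note lim = zero_balanced_diff_limit[OF a b]
  show ?thesis
  proof
    assume "zero_balanced_limit a b"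
    moreover have "- Digamma a - Digamma b - 2 * euler_mascheroni + - 1 / a = - Digamma (a + 1) - Digamma b - 2 * euler_mascheroni"
      by (simp add: D)
    moreover have "(\<lambda>x. zero_balanced a b (complex_of_real x) + Ln (1 - complex_of_real x) + (zero_balanced (a + 1) b (complex_of_real x) - zero_balanced a b (complex_of_real x)))
        = (\<lambda>x. zero_balanced (a + 1) b (complex_of_real x) + Ln (1 - complex_of_real x))" by auto
    ultimately show "zero_balanced_limit (a + 1) b"
      using tendsto_add[OF _ lim, of "\<lambda>x. zero_balanced a b (complex_of_real x) + Ln (1 - complex_of_real x)"
              "- Digamma a - Digamma b - 2 * euler_mascheroni"]
      unfolding zero_balanced_limit_def by (simp only:)
  next
    assume "zero_balanced_limit (a + 1) b"
    moreover have "- Digamma (a + 1) - Digamma b - 2 * euler_mascheroni - - 1 / a = - Digamma a - Digamma b - 2 * euler_mascheroni"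
      by (simp add: D)
    moreover have "(\<lambda>x. zero_balanced (a + 1) b (complex_of_real x) + Ln (1 - complex_of_real x) - (zero_balanced (a + 1) b (complex_of_real x) - zero_balanced a b (complex_of_real x)))
        = (\<lambda>x. zero_balanced a b (complex_of_real x) + Ln (1 - complex_of_real x))" by auto
    ultimately show "zero_balanced_limit a b"
      using tendsto_diff[OF _ lim, of "\<lambda>x. zero_balanced (a + 1) b (complex_of_real x) + Ln (1 - complex_of_real x)"
              "- Digamma (a + 1) - Digamma b - 2 * euler_mascheroni"]
      unfolding zero_balanced_limit_def by (simp only:)
  qed
qed

lemma nonpos_Ints_shift: "(a :: complex) \<notin> \<int>\<^sub>\<le>\<^sub>0 \<Longrightarrow> a + of_nat k \<notin> \<int>\<^sub>\<le>\<^sub>0"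
proof
  assume "a + of_nat k \<in> \<int>\<^sub>\<le>\<^sub>0"
  then obtain n where n: "a + of_nat k = - of_nat n" by (elim nonpos_Ints_cases')
  have "a = (a + of_nat k) - of_nat k" by simp
  also have "\<dots> = - of_nat (n + k)" unfolding n by simp
  finally have "a \<in> \<int>\<^sub>\<le>\<^sub>0" by (metis minus_of_nat_in_nonpos_Ints)
  moreover assume "a \<notin> \<int>\<^sub>\<le>\<^sub>0"
  ultimately show False by contradiction
qed

text \<open>
  For \<open>b = 1\<close> the coefficients are \<open>1 / (a + k)\<close>, and comparison with the series \<open>\<Sum> x\<^sup>k / (k + 1)\<close> of the
  logarithm leaves the series that defines \<open>\<psi>(a)\<close>.
\<close>
lemma zero_balanced_limit_1:
  assumes a: "a \<notin> \<int>\<^sub>\<le>\<^sub>0"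
  shows "zero_balanced_limit a 1"
proof -
  have an: "a + of_nat k \<noteq> 0" for k
  proof
    assume "a + of_nat k = 0"
    hence "a = - of_nat k" by (simp add: add_eq_0_iff2)
    thus False using a by auto
  qed
  have u: "zero_balanced_coeff a 1 k = 1 / (a + of_nat k)" for k
  proof -
    have "zero_balanced_coeff a 1 k = Gamma (a + of_nat k) * rGamma (a + of_nat k + 1)"
      using a by (simp add: zero_balanced_coeff_def hyp_coeff_def pochhammer_Gamma Gamma_eq_zero_iff add_ac flip: pochhammer_fact)
    also have "rGamma (a + of_nat k + 1) = rGamma (a + of_nat k) / (a + of_nat k)"
      using rGamma_plus1[of "a + of_nat k"] an[of k] by (simp add: field_simps)
    also have "Gamma (a + of_nat k) * (rGamma (a + of_nat k) / (a + of_nat k)) = 1 / (a + of_nat k)"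
    proof -
      have "a + of_nat k \<notin> \<int>\<^sub>\<le>\<^sub>0" using a by (rule nonpos_Ints_shift)
      thus ?thesis by (simp add: Gamma_def rGamma_eq_zero_iff)
    qed
    finally show ?thesis .
  qed
  have a0: "a \<noteq> 0" using a by auto
  have "(\<lambda>k. 1 / of_nat (Suc k) - 1 / (a + of_nat k)) sums (Digamma a + euler_mascheroni)"
    using summable_sums[OF summable_Digamma[OF a0]] by (simp add: Digamma_def inverse_eq_divide)
  from sums_minus[OF this] have s: "(\<lambda>k. 1 / (a + of_nat k) - 1 / of_nat (Suc k)) sums (- Digamma a - euler_mascheroni)"
    by simp
  have "(\<lambda>k. 1 / of_nat (Suc k) :: complex) \<longlonglongrightarrow> 0"
    using LIMSEQ_Suc[OF lim_1_over_n[where 'a = complex]] .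
  from tendsto_add[OF Abel_limit[OF s] Abel_mean_limit[OF this]]
  have *: "((\<lambda>x. (\<Sum>k. (1 / (a + of_nat k) - 1 / of_nat (Suc k)) * complex_of_real x ^ k) +
        (1 - complex_of_real x) * (\<Sum>k. 1 / of_nat (Suc k) * complex_of_real x ^ k)) \<longlongrightarrow> - Digamma a - euler_mascheroni) (at_left 1)"
    by simp
  have "((\<lambda>x. zero_balanced a 1 (complex_of_real x) + Ln (1 - complex_of_real x)) \<longlongrightarrow> - Digamma a - euler_mascheroni) (at_left 1)"
  proof (rule Lim_transform_eventually[OF *])
    show "eventually (\<lambda>x. (\<Sum>k. (1 / (a + of_nat k) - 1 / of_nat (Suc k)) * complex_of_real x ^ k) +
        (1 - complex_of_real x) * (\<Sum>k. 1 / of_nat (Suc k) * complex_of_real x ^ k) = zero_balanced a 1 (complex_of_real x) + Ln (1 - complex_of_real x)) (at_left 1)"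
      using eventually_unit_interval
    proof eventually_elim
      case (elim x)
      let ?x = "complex_of_real x"
      have nx: "norm ?x < 1" using elim by simp
      define T where "T = (\<Sum>k. 1 / of_nat (Suc k) * ?x ^ k)"
      have "Bseq (\<lambda>k. 1 / of_nat (Suc k) :: complex)"
        using \<open>(\<lambda>k. 1 / of_nat (Suc k) :: complex) \<longlonglongrightarrow> 0\<close> convergentI convergent_imp_Bseq by blast
      hence T: "(\<lambda>k. 1 / of_nat (Suc k) * ?x ^ k) sums T"
        unfolding T_def using nx by (intro summable_sums summable_bounded_powser)
      have "(\<lambda>k. 1 / of_nat (Suc k) * ?x ^ Suc k) sums (?x * T)"
        using sums_mult[OF T, of ?x] by (simp add: mult_ac)
      hence "(\<lambda>k. 1 / of_nat k * ?x ^ k) sums (?x * T)"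
        using sums_Suc_iff[of "\<lambda>k. 1 / of_nat k * ?x ^ k" "?x * T"] by simp
      moreover have "(\<lambda>n. (-1) ^ Suc n / of_nat n * (- ?x) ^ n) sums Ln (1 + (- ?x))"
        by (rule Ln_series) (use nx in auto)
      hence "(\<lambda>n. - (1 / of_nat n * ?x ^ n)) sums Ln (1 - ?x)"
      proof -
        have "(-1) ^ Suc n / of_nat n * (- ?x) ^ n = - (1 / of_nat n * ?x ^ n)" for n
        proof -
          have "(-1) ^ n * (- ?x) ^ n = ?x ^ n" by (simp flip: power_mult_distrib)
          thus ?thesis by simp
        qed
        hence "(\<lambda>n. (-1) ^ Suc n / of_nat n * (- ?x) ^ n) = (\<lambda>n. - (1 / of_nat n * ?x ^ n))" by (rule ext)
        with \<open>(\<lambda>n. (-1) ^ Suc n / of_nat n * (- ?x) ^ n) sums Ln (1 + (- ?x))\<close> show ?thesis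
          by (simp only: diff_conv_add_uminus)
      qed
      ultimately have L: "Ln (1 - ?x) = - (?x * T)"
        using sums_minus sums_unique2 by blast
      have "(\<lambda>k. (1 / (a + of_nat k)) * ?x ^ k - 1 / of_nat (Suc k) * ?x ^ k) sums (zero_balanced a 1 ?x - T)"
        using zero_balanced_sums[OF nx, of a 1] unfolding u by (intro sums_diff T)
      hence "(\<Sum>k. (1 / (a + of_nat k) - 1 / of_nat (Suc k)) * ?x ^ k) = zero_balanced a 1 ?x - T"
        by (simp add: sums_iff left_diff_distrib)
      thus ?case unfolding T_def [symmetric] L by (simp add: algebra_simps)
    qed
  qed
  moreover have "- Digamma a - euler_mascheroni = - Digamma a - Digamma 1 - 2 * (euler_mascheroni :: complex)" by simp
  ultimately show ?thesis unfolding zero_balanced_limit_def by (simp only:)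
qed


text \<open>
  Mean value inequality on \<open>[t, 1]\<close>. It cancels the factor \<open>1 / (1 - t)\<close> of the integrand that remains when
  \<open>x \<rightarrow> 1-\<close> in Euler's integral.
\<close>
lemma norm_powr_diff_square_le:
  assumes b: "Re b > 2" and t: "t \<in> {0..1::real}"
  shows "norm (complex_of_real t powr (b - 1) - complex_of_real t powr 2) \<le> (norm (b - 1) + 2) * (1 - t)"
proof (cases "t = 0")
  case True
  thus ?thesis by simp
next
  case False
  define S where "S = closed_segment (complex_of_real t) 1"
  have S: "\<exists>r. z = of_real r \<and> t \<le> r \<and> r \<le> 1" if "z \<in> S" for z
  proof -
    from that obtain u where u: "0 \<le> u" "u \<le> 1" "z = of_real ((1 - u) * t + u)"
      by (auto simp: S_def closed_segment_def scaleR_conv_of_real)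
    have "(1 - u) * t + u * t \<le> (1 - u) * t + u * 1" "(1 - u) * t + u * 1 \<le> (1 - u) * 1 + u * 1"
      using u t by (intro add_mono mult_left_mono; simp)+
    thus ?thesis using u by (intro exI[of _ "(1 - u) * t + u"]) (simp add: algebra_simps)
  qed
  have "norm ((1 powr (b - 1) - 1 powr 2) - (complex_of_real t powr (b - 1) - complex_of_real t powr 2))
          \<le> (norm (b - 1) + 2) * norm (1 - complex_of_real t)"
  proof (rule field_differentiable_bound[of S _ "\<lambda>z. (b - 1) * z powr (b - 1 - 1) - 2 * z powr (2 - 1)"])
    fix z assume z: "z \<in> S"
    then obtain r where r: "z = of_real r" "t \<le> r" "r \<le> 1" using S by blast
    hence r0: "r > 0" using t False by auto
    hence "z \<notin> \<real>\<^sub>\<le>\<^sub>0" using r by (auto simp: complex_nonpos_Reals_iff)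
    thus "((\<lambda>z. z powr (b - 1) - z powr 2) has_field_derivative (b - 1) * z powr (b - 1 - 1) - 2 * z powr (2 - 1)) (at z within S)"
      by (intro DERIV_diff has_field_derivative_at_within[OF has_field_derivative_powr])
    have "norm ((b - 1) * z powr (b - 1 - 1)) \<le> norm (b - 1) * 1"
      unfolding norm_mult using r r0 b by (intro mult_left_mono) (auto simp: norm_powr_real_powr powr_le1)
    moreover have "norm (2 * z powr (2 - 1)) \<le> 2" using r r0 by (simp add: norm_mult)
    ultimately show "norm ((b - 1) * z powr (b - 1 - 1) - 2 * z powr (2 - 1)) \<le> norm (b - 1) + 2"
      by (intro order_trans[OF norm_triangle_ineq4] add_mono) auto
  qed (auto simp: S_def)
  also have "norm (1 - complex_of_real t) = norm (complex_of_real (1 - t))" by simp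
  also have "\<dots> = 1 - t" using t by (subst norm_of_real) auto
  finally show ?thesis by (simp add: norm_minus_commute)
qed

text \<open>
  Each integral diverges logarithmically, but their difference converges by dominated convergence,
  because \<open>|(1 - t) / (1 - t x)| \<le> 1\<close>. The limit does not depend on \<open>a\<close>, which
  \<open>zero_balanced_limit_large\<close> exploits.
\<close>
lemma Euler_kernel_diff_limit:
  assumes a: "Re a > 2" and b: "Re b > 2"
  shows "((\<lambda>x. integral {0..1} (Euler_kernel a b a (complex_of_real x)) - integral {0..1} (Euler_kernel a 3 a (complex_of_real x)))
           \<longlongrightarrow> integral {0..1} (\<lambda>t. (complex_of_real t powr (b - 1) - complex_of_real t powr 2) / complex_of_real (1 - t))) (at_left 1)"
proof (rule tendsto_at_left_sequentially[of 0])
  fix X :: "nat \<Rightarrow> real"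
  assume X: "\<And>n. X n < 1" "\<And>n. 0 < X n" "X \<longlonglongrightarrow> 1"
  let ?f = "\<lambda>n t. Euler_kernel a b a (complex_of_real (X n)) t - Euler_kernel a 3 a (complex_of_real (X n)) t"
  let ?g = "\<lambda>t. (complex_of_real t powr (b - 1) - complex_of_real t powr 2) / complex_of_real (1 - t)"
  let ?K = "norm (b - 1) + 2"
  have slit: "complex_of_real (X n) \<in> slit_plane" for n
    using X(1,2)[of n] unit_ball_subset_slit_plane by (auto simp: less_imp_le)
  have int: "Euler_kernel a c a (complex_of_real (X n)) integrable_on {0..1}" if "Re c > 1" for c n
    using a that slit by (intro integrable_continuous_real continuous_on_Euler_kernel) auto
  have f_eq: "?f n t = (complex_of_real t powr (b - 1) - complex_of_real t powr 2) * complex_of_real (1 - t) powr (a - 1)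
      * (1 - complex_of_real t * complex_of_real (X n)) powr (- a)" for n t
    by (simp add: Euler_kernel_def algebra_simps)
  have pos: "1 - t * X n > 0" "1 - t \<le> 1 - t * X n" if "t \<in> {0..1}" for t n
  proof -
    have "t * X n \<le> t * 1" "t * X n \<le> 1 * X n" using that X(1,2)[of n] by (intro mult_left_mono mult_right_mono; simp)+
    thus "1 - t * X n > 0" "1 - t \<le> 1 - t * X n" using X(1)[of n] by auto
  qed
  have bound: "norm (?f n t) \<le> ?K" if t: "t \<in> {0..1}" for n t
  proof (cases "t = 1")
    case True
    thus ?thesis unfolding f_eq by simp
  next
    case False
    hence t1: "1 - t > 0" using t by auto
    have e: "1 - complex_of_real t * complex_of_real (X n) = complex_of_real (1 - t * X n)" by simp
    have "norm (?f n t) = norm (complex_of_real t powr (b - 1) - complex_of_real t powr 2) * ((1 - t) powr (Re a - 1) * (1 - t * X n) powr (- Re a))"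
    proof -
      have "norm (complex_of_real r powr s) = r powr Re s" if "r > 0" for r s
        using that norm_powr_real_powr[of "complex_of_real r" s] by simp
      from this[OF t1, of "a - 1"] this[OF pos(1)[OF t, of n], of "- a"] show ?thesis
        unfolding f_eq e norm_mult by (simp del: of_real_diff of_real_mult)
    qed
    also have "\<dots> \<le> (?K * (1 - t)) * ((1 - t) powr (Re a - 1) * (1 - t) powr (- Re a))"
    proof -
      have "(1 - t * X n) powr (- Re a) \<le> (1 - t) powr (- Re a)"
        using pos(2)[OF t, of n] t1 a by (intro powr_mono2') auto
      from mult_mono[OF norm_powr_diff_square_le[OF b t] mult_left_mono[OF this]] show ?thesis
        using t1 by simp
    qed
    also have "(1 - t) powr (Re a - 1) * (1 - t) powr (- Re a) = (1 - t) powr (- 1)"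
      by (simp flip: powr_add)
    also have "(?K * (1 - t)) * (1 - t) powr (- 1) = ?K" using t1 by (simp add: powr_minus_divide)
    finally show ?thesis .
  qed
  have lim: "(\<lambda>n. ?f n t) \<longlonglongrightarrow> ?g t" if t: "t \<in> {0..1}" for t
  proof (cases "t = 1")
    case True
    thus ?thesis unfolding f_eq by simp
  next
    case False
    hence t1: "1 - t > 0" using t by auto
    have nz: "1 - complex_of_real t \<notin> \<real>\<^sub>\<le>\<^sub>0" using t1 by (simp add: complex_nonpos_Reals_iff)
    hence nz1: "1 - complex_of_real t \<noteq> 0" by auto
    have "(\<lambda>n. complex_of_real (X n)) \<longlonglongrightarrow> complex_of_real 1" by (intro tendsto_intros X(3))
    hence "(\<lambda>n. 1 - complex_of_real t * complex_of_real (X n)) \<longlonglongrightarrow> 1 - complex_of_real t * complex_of_real 1" by (intro tendsto_intros X(3))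
    hence "(\<lambda>n. 1 - complex_of_real t * complex_of_real (X n)) \<longlonglongrightarrow> 1 - complex_of_real t" by simp
    hence "(\<lambda>n. (1 - complex_of_real t * complex_of_real (X n)) powr (- a)) \<longlonglongrightarrow> (1 - complex_of_real t) powr (- a)"
      using nz by (intro tendsto_powr_complex tendsto_const)
    hence "(\<lambda>n. ?f n t) \<longlonglongrightarrow> (complex_of_real t powr (b - 1) - complex_of_real t powr 2) * complex_of_real (1 - t) powr (a - 1)
      * (1 - complex_of_real t) powr (- a)" unfolding f_eq by (intro tendsto_mult tendsto_const)
    moreover have e: "complex_of_real (1 - t) powr (a - 1) * (1 - complex_of_real t) powr (- a) = 1 / complex_of_real (1 - t)"
      using nz1 by (simp add: powr_minus_divide powr_diff)
    have "(complex_of_real t powr (b - 1) - complex_of_real t powr 2) * complex_of_real (1 - t) powr (a - 1)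
      * (1 - complex_of_real t) powr (- a) = ?g t" unfolding mult.assoc e by simp
    ultimately show ?thesis by (simp only:)
  qed
  have "(\<lambda>n. integral {0..1} (?f n)) \<longlonglongrightarrow> integral {0..1} ?g"
  proof (rule dominated_convergence(2)[where h = "\<lambda>_. ?K"])
    show "?f n integrable_on {0..1}" for n using b by (intro integrable_diff int) auto
    show "(\<lambda>_. ?K) integrable_on {0..1::real}" by (rule integrable_const_ivl)
  qed (use bound lim in auto)
  also have "(\<lambda>n. integral {0..1} (?f n)) = (\<lambda>n. integral {0..1} (Euler_kernel a b a (complex_of_real (X n))) - integral {0..1} (Euler_kernel a 3 a (complex_of_real (X n))))"
    using b by (intro ext integral_diff int) auto
  finally show "(\<lambda>n. integral {0..1} (Euler_kernel a b a (complex_of_real (X n))) - integral {0..1} (Euler_kernel a 3 a (complex_of_real (X n)))) \<longlonglongrightarrow> integral {0..1} ?g" .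
qed auto

lemma zero_balanced_eq_Euler_integral:
  assumes "Re a > 2" "Re b > 2" "norm z < 1"
  shows "zero_balanced a b z = integral {0..1} (Euler_kernel a b a z)"
proof (rule sums_unique2[OF zero_balanced_sums])
  show "(\<lambda>k. zero_balanced_coeff a b k * z ^ k) sums integral {0..1} (Euler_kernel a b a z)"
    using Euler_integral_sums[OF assms(2,1,3), of a] by (simp add: zero_balanced_coeff_def mult_ac add.commute)
qed (use assms in auto)

text \<open>
  The limit \<open>D\<close> of the difference between \<open>b\<close> and \<open>3\<close> need not be computed: as it is independent of
  \<open>a\<close>, the case \<open>a = 3\<close>, which is known by symmetry, gives \<open>D = \<psi>(3) - \<psi>(b)\<close>.
\<close>
lemma zero_balanced_limit_large:
  assumes a: "Re a > 2" and b: "Re b > 2"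
  shows "zero_balanced_limit a b"
proof -
  have npole: "c \<notin> \<int>\<^sub>\<le>\<^sub>0" if "Re c > 0" for c using that by (auto dest: nonpos_Ints_Re)
  have L3: "zero_balanced_limit c 3" if "Re c > 2" for c
  proof -
    have "zero_balanced_limit 1 c" using zero_balanced_limit_1[of c] npole[of c] that by (simp add: zero_balanced_limit_commute)
    hence "zero_balanced_limit (1 + 1) c" using that by (subst zero_balanced_limit_step) (auto intro!: npole)
    hence "zero_balanced_limit (1 + 1 + 1) c" using that by (subst zero_balanced_limit_step) (auto intro!: npole)
    thus ?thesis by (simp add: zero_balanced_limit_commute)
  qed
  define D where "D = integral {0..1} (\<lambda>t. (complex_of_real t powr (b - 1) - complex_of_real t powr 2) / complex_of_real (1 - t))"
  have lim: "((\<lambda>x. zero_balanced c b (complex_of_real x) + Ln (1 - complex_of_real x)) \<longlongrightarrow>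
               (- Digamma c - Digamma 3 - 2 * euler_mascheroni) + D) (at_left 1)" if c: "Re c > 2" for c
  proof (rule Lim_transform_eventually)
    show "((\<lambda>x. (zero_balanced c 3 (complex_of_real x) + Ln (1 - complex_of_real x)) +
       (integral {0..1} (Euler_kernel c b c (complex_of_real x)) - integral {0..1} (Euler_kernel c 3 c (complex_of_real x))))
       \<longlongrightarrow> (- Digamma c - Digamma 3 - 2 * euler_mascheroni) + D) (at_left 1)"
      using L3[OF c] unfolding zero_balanced_limit_def D_def by (intro tendsto_add Euler_kernel_diff_limit c b)
    show "eventually (\<lambda>x. (zero_balanced c 3 (complex_of_real x) + Ln (1 - complex_of_real x)) +
       (integral {0..1} (Euler_kernel c b c (complex_of_real x)) - integral {0..1} (Euler_kernel c 3 c (complex_of_real x))) =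
        zero_balanced c b (complex_of_real x) + Ln (1 - complex_of_real x)) (at_left 1)"
      using eventually_unit_interval by eventually_elim (use b c in \<open>simp add: zero_balanced_eq_Euler_integral\<close>)
  qed
  have "((\<lambda>x. zero_balanced 3 b (complex_of_real x) + Ln (1 - complex_of_real x)) \<longlongrightarrow>
               (- Digamma 3 - Digamma b - 2 * euler_mascheroni)) (at_left 1)"
    using L3[OF b] unfolding zero_balanced_limit_commute[of b] unfolding zero_balanced_limit_def .
  from tendsto_unique[OF _ this lim[of 3]] have "D = Digamma 3 - Digamma b" by (simp add: algebra_simps)
  with lim[OF a] show ?thesis by (simp add: zero_balanced_limit_def algebra_simps)
qed

theorem zero_balanced_limit_always:
  assumes a: "a \<notin> \<int>\<^sub>\<le>\<^sub>0" and b: "b \<notin> \<int>\<^sub>\<le>\<^sub>0"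
  shows "zero_balanced_limit a b"
proof -
  have shift: "zero_balanced_limit (c + of_nat n) d \<longleftrightarrow> zero_balanced_limit c d" if "c \<notin> \<int>\<^sub>\<le>\<^sub>0" "d \<notin> \<int>\<^sub>\<le>\<^sub>0" for c d n
  proof (induction n)
    case (Suc n)
    have "c + of_nat (Suc n) = c + of_nat n + 1" by simp
    thus ?case using zero_balanced_limit_step[OF nonpos_Ints_shift[OF that(1)] that(2), of n] Suc by (simp only:)
  qed simp
  obtain n where n: "real n > 2 - Re a" using reals_Archimedean2 by blast
  obtain m where m: "real m > 2 - Re b" using reals_Archimedean2 by blast
  have "zero_balanced_limit (a + of_nat n) (b + of_nat m)" using n m by (intro zero_balanced_limit_large) auto
  hence "zero_balanced_limit a (b + of_nat m)" using shift[OF a nonpos_Ints_shift[OF b]] by simp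
  hence "zero_balanced_limit (b + of_nat m) a" by (simp only: zero_balanced_limit_commute)
  hence "zero_balanced_limit b a" using shift[OF b a] by simp
  thus ?thesis by (simp only: zero_balanced_limit_commute)
qed

section \<open>Logarithmic solutions\<close>

text \<open>
  The complement of \<open>(- \<infinity>, 0] \<union> [1, \<infinity>)\<close>. It contains both half planes, and it is connected. The lower half
  plane is needed because \<open>z \<mapsto> z / (z - 1)\<close> maps the upper half plane to it.
\<close>
definition cut_plane :: "complex set" where "cut_plane = slit_plane - \<real>\<^sub>\<le>\<^sub>0"

lemma cut_plane_iff: "z \<in> cut_plane \<longleftrightarrow> Im z \<noteq> 0 \<or> (0 < Re z \<and> Re z < 1)"
  by (auto simp: cut_plane_def slit_plane_iff complex_nonpos_Reals_iff)

lemma open_cut_plane [simp, intro]: "open cut_plane"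
  unfolding cut_plane_def by (intro open_Diff) auto

lemma cut_planeD: "z \<in> cut_plane \<Longrightarrow> z \<in> slit_plane" "z \<in> cut_plane \<Longrightarrow> z \<notin> \<real>\<^sub>\<le>\<^sub>0"
   "z \<in> cut_plane \<Longrightarrow> z \<noteq> 0" "z \<in> cut_plane \<Longrightarrow> z \<noteq> 1"
  by (auto simp: cut_plane_def slit_plane_iff)

lemma one_minus_cut_plane: "1 - z \<in> cut_plane \<longleftrightarrow> z \<in> cut_plane"
  by (auto simp: cut_plane_iff)

lemma connected_cut_plane_Int:
  assumes "convex C" "1 / 2 \<in> C"
  shows "connected (cut_plane \<inter> C)"
proof -
  have "starlike (cut_plane \<inter> C)"
    unfolding starlike_def
  proof (intro bexI[of _ "1 / 2"] ballI subsetI)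
    show "1 / 2 \<in> cut_plane \<inter> C" using assms by (simp add: cut_plane_iff)
    fix z x assume z: "z \<in> cut_plane \<inter> C" and x: "x \<in> closed_segment (1 / 2) z"
    have "x \<in> C" using assms z x closed_segment_subset[of "1 / 2" C z] by auto
    moreover obtain u where u: "0 \<le> u" "u \<le> 1" "x = (1 - u) *\<^sub>R (1 / 2) + u *\<^sub>R z"
      using x by (auto simp: closed_segment_def)
    have "x \<in> cut_plane"
    proof (cases "u = 0 \<or> Im z = 0")
      case True
      show ?thesis
      proof (cases "u = 0")
        case False
        hence "Im z = 0" "0 < Re z" "Re z < 1" using True z by (auto simp: cut_plane_iff)
        moreover have "Re x = 1 / 2 + u * (Re z - 1 / 2)" unfolding u(3) by (simp add: algebra_simps)
        moreover have "\<bar>u * (Re z - 1 / 2)\<bar> \<le> \<bar>Re z - 1 / 2\<bar>"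
          using u(1,2) by (simp add: abs_mult mult_left_le_one_le)
        moreover have "Im x = 0" unfolding u(3) using \<open>Im z = 0\<close> by simp
        ultimately show ?thesis by (auto simp: cut_plane_iff)
      qed (simp add: u(3) cut_plane_iff)
    qed (use u in \<open>simp add: cut_plane_iff\<close>)
    ultimately show "x \<in> cut_plane \<inter> C" by blast
  qed
  thus ?thesis by (rule starlike_imp_connected)
qed

lemma half_ball_nonempty: "1 / 2 \<in> cut_plane \<inter> ball 0 1"
  by (simp add: cut_plane_iff)

text \<open>
  The function \<open>U\<^sub>1\<close> of the theorem.
\<close>
definition hyp_U :: "nat \<Rightarrow> complex \<Rightarrow> complex \<Rightarrow> complex \<Rightarrow> complex" where
  "hyp_U m a b z = (-1) ^ (m + 1) * fact m * (Gamma (a - of_nat m) * Gamma (b - of_nat m))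
                     * reg_hyp a b (a + b - of_nat m) (1 - z)"

definition hyp_F :: "nat \<Rightarrow> complex \<Rightarrow> complex \<Rightarrow> complex \<Rightarrow> complex" where
  "hyp_F m a b z = fact m * reg_hyp a b (of_nat m + 1) z"

definition F_coeff :: "nat \<Rightarrow> complex \<Rightarrow> complex \<Rightarrow> nat \<Rightarrow> complex" where
  "F_coeff m a b k = pochhammer a k * pochhammer b k / (pochhammer (of_nat m + 1) k * fact k)"

definition psi_sum :: "nat \<Rightarrow> complex \<Rightarrow> complex \<Rightarrow> nat \<Rightarrow> complex" where
  "psi_sum m a b k = Digamma (a + of_nat k) + Digamma (b + of_nat k) - Digamma (of_nat m + of_nat k + 1) - Digamma (of_nat k + 1)"

definition log_fps :: "nat \<Rightarrow> complex \<Rightarrow> complex \<Rightarrow> complex fps" where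
  "log_fps m a b = Abs_fps (\<lambda>k. F_coeff m a b k * psi_sum m a b k)"

definition log_series :: "nat \<Rightarrow> complex \<Rightarrow> complex \<Rightarrow> complex \<Rightarrow> complex" where
  "log_series m a b = eval_fps (log_fps m a b)"

lemma F_coeff_eq: "F_coeff m a b k = fact m * hyp_coeff a b (of_nat m + 1) k"
proof -
  have "pochhammer (of_nat m + 1) k \<noteq> (0 :: complex)"
    unfolding pochhammer_eq_0_iff by (auto simp: complex_eq_iff)
  moreover have "rGamma (of_nat m + 1) = pochhammer (of_nat m + 1) k * rGamma (of_nat m + 1 + of_nat k :: complex)"
    by (rule pochhammer_rGamma)
  moreover have "rGamma (of_nat m + 1) = (1 / fact m :: complex)"
    using rGamma_Suc_of_nat[of m] by (simp add: add.commute)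
  ultimately have "rGamma (of_nat m + 1 + of_nat k :: complex) = 1 / (fact m * pochhammer (of_nat m + 1) k)"
    by (simp add: field_simps)
  thus ?thesis by (simp add: F_coeff_def hyp_coeff_def)
qed

lemma continues_F: "continues (F_coeff m a b) (hyp_F m a b)"
proof -
  have "F_coeff m a b = (\<lambda>k. fact m * hyp_coeff a b (of_nat m + 1) k)" by (simp add: F_coeff_eq fun_eq_iff)
  moreover have "hyp_F m a b = (\<lambda>z. fact m * reg_hyp a b (of_nat m + 1) z)" by (simp add: hyp_F_def fun_eq_iff)
  ultimately show ?thesis using continues_cmult[OF continues_reg_hyp] by metis
qed

lemma F_coeff_0 [simp]: "F_coeff m a b 0 = 1"
  by (simp add: F_coeff_def)

lemma F_coeff_Suc: "of_nat (Suc k) * (of_nat k + of_nat m + 1) * F_coeff m a b (Suc k) = (of_nat k + a) * (of_nat k + b) * F_coeff m a b k"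
  using hyp_coeff_Suc[of k "of_nat m + 1" a b] by (simp add: F_coeff_eq mult_ac add_ac)

lemma holomorphic_F: "hyp_F m a b holomorphic_on slit_plane"
  using continues_F by (rule continues_holomorphic)

lemma hyp_F_0: "hyp_F m a b 0 = 1"
  using continues_sums[OF continues_F, of 0 m a b] powser_sums_zero_iff[of "F_coeff m a b" "hyp_F m a b 0"] by simp

lemma summable_powser_norm:
  assumes "\<And>w. norm w < 1 \<Longrightarrow> summable (\<lambda>k. f k * w ^ k)" "norm (z::complex) < 1"
  shows "summable (\<lambda>k. norm (f k * z ^ k))"
proof (rule powser_insidea)
  have "norm (complex_of_real ((norm z + 1) / 2)) = (norm z + 1) / 2" by (subst norm_of_real) simp
  thus "summable (\<lambda>k. f k * complex_of_real ((norm z + 1) / 2) ^ k)" "norm z < norm (complex_of_real ((norm z + 1) / 2))"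
    using assms by auto
qed

lemma bounded_increments_linear:
  fixes h :: "nat \<Rightarrow> complex"
  assumes "\<And>k. norm (h (Suc k) - h k) \<le> K"
  shows "norm (h k) \<le> norm (h 0) + K * real k"
proof (induction k)
  case (Suc k)
  have "norm (h (Suc k)) \<le> norm (h k) + norm (h (Suc k) - h k)" by (metis norm_triangle_sub)
  with Suc assms[of k] show ?case by (simp add: algebra_simps)
qed simp

lemma nonint_shift: "a \<notin> \<int> \<Longrightarrow> (a :: complex) + of_nat k \<noteq> 0"
  by (metis Ints_minus Ints_of_nat add_eq_0_iff2)

lemma nonint_nonpole: "a \<notin> \<int> \<Longrightarrow> a \<notin> \<int>\<^sub>\<le>\<^sub>0"
  by (auto simp: nonpos_Ints_def)

lemma psi_sum_Suc:
  assumes "a \<notin> \<int>" "b \<notin> \<int>"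
  shows "psi_sum m a b (Suc k) = psi_sum m a b k + 1 / (a + of_nat k) + 1 / (b + of_nat k) - 1 / (of_nat m + of_nat k + 1) - 1 / (of_nat k + 1)"
proof -
  have 1: "Digamma (x + of_nat (Suc k)) = Digamma (x + of_nat k) + 1 / (x + of_nat k)" if "x + of_nat k \<noteq> 0" for x :: complex
    using Digamma_plus1[OF that] by (simp add: add_ac)
  have nz: "of_nat m + 1 + of_nat k \<noteq> (0::complex)" "1 + of_nat k \<noteq> (0::complex)"
    by (auto simp: complex_eq_iff)
  have e: "of_nat m + of_nat (Suc k) + 1 = (of_nat m + 1) + complex_of_nat (Suc k)" "of_nat (Suc k) + 1 = 1 + complex_of_nat (Suc k)"
     "of_nat m + of_nat k + 1 = (of_nat m + 1) + complex_of_nat k" "of_nat k + 1 = 1 + complex_of_nat k"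
    by simp_all
  show ?thesis
    unfolding psi_sum_def e 1[OF nonint_shift[OF assms(1)]] 1[OF nonint_shift[OF assms(2)]] 1[OF nz(1)] 1[OF nz(2)]
    by (simp only: diff_conv_add_uminus add_ac minus_add_distrib)
qed

lemma Bseq_inverse_shift: "Bseq (\<lambda>k. 1 / (a + of_nat k :: complex))"
proof -
  have "(\<lambda>k. 1 / (a + of_nat k)) \<longlonglongrightarrow> 0"
    by (intro tendsto_divide_0[OF tendsto_const] tendsto_add_filterlim_at_infinity[OF tendsto_const] tendsto_of_nat)
  thus ?thesis using convergentI convergent_imp_Bseq by blast
qed

text \<open>
  The increments of \<open>psi_sum m a b\<close> are bounded, so it grows at most linearly, and the factor \<open>k\<close> does not
  change the radius of convergence.
\<close>
lemma log_fps_conv_radius: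
  assumes "a \<notin> \<int>" "b \<notin> \<int>"
  shows "fps_conv_radius (log_fps m a b) \<ge> 1"
  unfolding fps_conv_radius_def
proof (rule conv_radius_geI_ex')
  fix r :: real assume r: "0 < r" "ereal r < 1"
  let ?z = "complex_of_real r"
  have nz: "norm ?z < 1" using r by simp
  obtain A where A: "\<And>k. norm (1 / (a + of_nat k)) \<le> A" using Bseq_inverse_shift[of a] by (auto simp: Bseq_def)
  obtain B where B: "\<And>k. norm (1 / (b + of_nat k)) \<le> B" using Bseq_inverse_shift[of b] by (auto simp: Bseq_def)
  obtain C where C: "\<And>k. norm (1 / (of_nat m + 1 + of_nat k :: complex)) \<le> C" using Bseq_inverse_shift[of "of_nat m + 1"] by (auto simp: Bseq_def)
  obtain D where D: "\<And>k. norm (1 / (1 + of_nat k :: complex)) \<le> D" using Bseq_inverse_shift[of 1] by (auto simp: Bseq_def)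
  have "norm (psi_sum m a b (Suc k) - psi_sum m a b k) \<le> A + B + C + D" for k
  proof -
    have "psi_sum m a b (Suc k) - psi_sum m a b k = 1 / (a + of_nat k) + 1 / (b + of_nat k) - 1 / (of_nat m + 1 + of_nat k) - 1 / (1 + of_nat k)"
      unfolding psi_sum_Suc[OF assms] by (simp add: add_ac)
    also have "norm \<dots> \<le> A + B + C + D"
      by (intro norm_triangle_le norm_triangle_le_diff add_mono order_trans[OF norm_triangle_ineq4] order_trans[OF norm_triangle_ineq] A B C D)
    finally show ?thesis .
  qed
  from bounded_increments_linear[of "psi_sum m a b" "A + B + C + D", OF this]
  have lin: "norm (psi_sum m a b k) \<le> norm (psi_sum m a b 0) + (A + B + C + D) * real k" for k .
  have s1: "summable (\<lambda>k. norm (F_coeff m a b k * ?z ^ k))"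
    by (rule summable_powser_norm[OF sums_summable[OF continues_sums[OF continues_F]] nz])
  have s2: "summable (\<lambda>k. norm (of_nat k * F_coeff m a b k * ?z ^ k))"
    by (rule summable_powser_norm[OF sums_summable[OF continues_sums[OF continues_Euler_operator[OF continues_F]]] nz])
  have "summable (\<lambda>k. norm (psi_sum m a b 0) * norm (F_coeff m a b k * ?z ^ k) + (A + B + C + D) * norm (of_nat k * F_coeff m a b k * ?z ^ k))"
    by (intro summable_add summable_mult s1 s2)
  thus "summable (\<lambda>k. fps_nth (log_fps m a b) k * ?z ^ k)"
  proof (rule summable_comparison_test'[where N = 0])
    fix k
    have "norm (fps_nth (log_fps m a b) k * ?z ^ k) = norm (psi_sum m a b k) * norm (F_coeff m a b k * ?z ^ k)"
      by (simp add: log_fps_def norm_mult)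
    also have "\<dots> \<le> (norm (psi_sum m a b 0) + (A + B + C + D) * real k) * norm (F_coeff m a b k * ?z ^ k)"
      by (intro mult_right_mono lin) auto
    finally show "norm (fps_nth (log_fps m a b) k * ?z ^ k) \<le> norm (psi_sum m a b 0) * norm (F_coeff m a b k * ?z ^ k) + (A + B + C + D) * norm (of_nat k * F_coeff m a b k * ?z ^ k)"
      by (simp add: norm_mult algebra_simps)
  qed
qed

lemma log_series_facts:
  assumes "a \<notin> \<int>" "b \<notin> \<int>"
  shows holomorphic_log_series: "log_series m a b holomorphic_on ball 0 1"
    and log_series_sums: "norm z < 1 \<Longrightarrow> (\<lambda>k. F_coeff m a b k * psi_sum m a b k * z ^ k) sums log_series m a b z"
    and log_series_fps: "log_series m a b has_fps_expansion log_fps m a b"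
    and log_series_0: "log_series m a b 0 = psi_sum m a b 0"
proof -
  note R = log_fps_conv_radius[OF assms, of m]
  have sub: "ball (0::complex) 1 \<subseteq> eball 0 (fps_conv_radius (log_fps m a b))"
    using R ball_eball_mono[of 1] by (simp add: one_ereal_def)
  show "log_series m a b holomorphic_on ball 0 1" unfolding log_series_def
    using holomorphic_on_eval_fps[OF sub] .
  show "(\<lambda>k. F_coeff m a b k * psi_sum m a b k * z ^ k) sums log_series m a b z" if "norm z < 1"
  proof -
    have "ereal (norm z) < fps_conv_radius (log_fps m a b)" using that R by (metis ereal_less(3) less_le_trans)
    from sums_eval_fps[OF this] show ?thesis by (simp add: log_series_def log_fps_def)
  qed
  show "log_series m a b has_fps_expansion log_fps m a b" unfolding log_series_def
    by (rule eval_fps_has_fps_expansion, rule less_le_trans[OF _ R]) simp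
  show "log_series m a b 0 = psi_sum m a b 0" by (simp add: log_series_def eval_fps_at_0 log_fps_def)
qed

text \<open>
  The inhomogeneity is what the equation produces from \<open>F log z\<close> apart from the multiple of \<open>log z\<close>. On
  coefficients the claim is the recurrence for \<open>F\<close> together with the increments of \<open>psi_sum\<close>.
\<close>
lemma log_series_ode:
  assumes ab: "a \<notin> \<int>" "b \<notin> \<int>" and z: "z \<in> ball 0 1"
  defines "S \<equiv> log_series 0 a b" and "F \<equiv> hyp_F 0 a b"
  shows "z * (1 - z) * deriv (deriv S) z + (1 - (a + b + 1) * z) * deriv S z - a * b * S z
          + 2 * (1 - z) * deriv F z - (a + b) * F z = 0"
proof -
  let ?S = "log_fps 0 a b"
  let ?F = "Abs_fps (F_coeff 0 a b)"
  have S: "S has_fps_expansion ?S" unfolding S_def by (rule log_series_fps[OF ab])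
  have F: "F has_fps_expansion ?F"
  proof (rule has_fps_expansionI, rule eventually_mono)
    show "eventually (\<lambda>z. z \<in> ball 0 1) (nhds (0::complex))" by (rule eventually_nhds_in_open) auto
  qed (use continues_sums[OF continues_F] in \<open>auto simp: F_def\<close>)
  let ?E = "(fps_X * (1 - fps_X)) * fps_deriv (fps_deriv ?S) + (1 - fps_const (a + b + 1) * fps_X) * fps_deriv ?S
          - fps_const (a * b) * ?S + fps_const 2 * (1 - fps_X) * fps_deriv ?F - fps_const (a + b) * ?F"
  let ?e = "\<lambda>z. (z * (1 - z)) * deriv (deriv S) z + (1 - (a + b + 1) * z) * deriv S z - (a * b) * S z
          + 2 * (1 - z) * deriv F z - (a + b) * F z"
  have "?e has_fps_expansion ?E" by (intro fps_expansion_intros S F)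
  also have "?E = 0"
  proof (rule fps_ext)
    fix n
    have *: "?E = fps_X * fps_deriv (fps_deriv ?S) - fps_X * (fps_X * fps_deriv (fps_deriv ?S)) + fps_deriv ?S
                - fps_const (a + b + 1) * (fps_X * fps_deriv ?S) - fps_const (a * b) * ?S
                + fps_const 2 * fps_deriv ?F - fps_const 2 * (fps_X * fps_deriv ?F) - fps_const (a + b) * ?F" by (simp add: algebra_simps)
    define f where "f = F_coeff 0 a b n"
    define g where "g = of_nat (Suc n) * F_coeff 0 a b (Suc n)"
    define h where "h = psi_sum 0 a b n"
    define N where "N = complex_of_nat n"
    have nth: "fps_nth ?E n = N * (of_nat (Suc n) * fps_nth ?S (Suc n)) - N * (N - 1) * fps_nth ?S n + of_nat (Suc n) * fps_nth ?S (Suc n)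
             - (a + b + 1) * (N * fps_nth ?S n) - a * b * fps_nth ?S n + 2 * (of_nat (Suc n) * F_coeff 0 a b (Suc n)) - 2 * (N * F_coeff 0 a b n) - (a + b) * F_coeff 0 a b n"
      unfolding * by (cases n; cases "n - 1") (simp_all add: algebra_simps N_def)
    have S1: "of_nat (Suc n) * fps_nth ?S (Suc n) = g * psi_sum 0 a b (Suc n)"
      by (simp add: log_fps_def g_def)
    have S0: "fps_nth ?S n = f * h" by (simp add: log_fps_def f_def h_def)
    have rec: "(N + 1) * g = (N + a) * (N + b) * f"
      using F_coeff_Suc[of n 0 a b] by (simp add: f_def g_def N_def mult_ac)
    have nz: "a + N \<noteq> 0" "b + N \<noteq> 0" "N + 1 \<noteq> 0"
      using nonint_shift[OF ab(1), of n] nonint_shift[OF ab(2), of n] by (auto simp: N_def complex_eq_iff)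
    have ps: "psi_sum 0 a b (Suc n) = h + 1 / (a + N) + 1 / (b + N) - 2 / (N + 1)"
      unfolding psi_sum_Suc[OF ab] by (simp add: h_def N_def)
    have "(N + 1) * (g * psi_sum 0 a b (Suc n)) = (N + a) * (N + b) * f * h + (2 * N + a + b) * f - 2 * g"
    proof -
      have "(N + 1) * (g * psi_sum 0 a b (Suc n)) = (N + 1) * g * (h + 1 / (a + N) + 1 / (b + N)) - 2 * g"
        unfolding ps using nz(3) by (simp add: field_simps)
      also have "(N + 1) * g * (h + 1 / (a + N) + 1 / (b + N)) = (N + a) * (N + b) * f * h + (2 * N + a + b) * f"
        unfolding rec using nz by (simp add: divide_simps) (simp add: algebra_simps)
      finally show ?thesis .
    qed
    hence "N * (g * psi_sum 0 a b (Suc n)) + g * psi_sum 0 a b (Suc n) = (N + a) * (N + b) * f * h + (2 * N + a + b) * f - 2 * g"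
      by (simp add: algebra_simps)
    thus "fps_nth ?E n = fps_nth 0 n"
      unfolding nth S1 S0 f_def [symmetric] g_def [symmetric] by (simp add: algebra_simps)
  qed
  finally have E: "?e has_fps_expansion 0" .
  have "S holomorphic_on ball 0 1" unfolding S_def by (rule holomorphic_log_series[OF ab])
  moreover have "F holomorphic_on ball 0 1" unfolding F_def
    using holomorphic_F unit_ball_subset_slit_plane by (rule holomorphic_on_subset)
  ultimately have "?e holomorphic_on ball 0 1" by (intro holomorphic_intros holomorphic_deriv) auto
  from has_fps_expansion_0_analytic_continuation[OF E this _ _ _ z] show ?thesis by simp
qed

lemma hyp_ode_F: "hyp_ode a b (of_nat m + 1) slit_plane (hyp_F m a b)"
  using hyp_ode_lincomb[OF hyp_ode_reg_hyp hyp_ode_reg_hyp open_slit_plane, of a b "of_nat m + 1" "fact m" 0]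
  by (simp add: hyp_F_def [abs_def])

lemma hyp_ode_U0: "hyp_ode a b 1 cut_plane (hyp_U 0 a b)"
proof -
  have "hyp_ode a b (a + b + 1 - 1) slit_plane (reg_hyp a b (a + b))" using hyp_ode_reg_hyp[of a b "a + b"] by simp
  hence "hyp_ode a b 1 cut_plane (\<lambda>z. reg_hyp a b (a + b) (1 - z))"
    by (rule hyp_ode_reflect) (auto intro!: cut_planeD(1) simp: one_minus_cut_plane)
  from hyp_ode_lincomb[OF this this open_cut_plane, of "- (Gamma a * Gamma b)" 0] show ?thesis
    by (simp add: hyp_U_def [abs_def])
qed

definition log_sol :: "complex \<Rightarrow> complex \<Rightarrow> complex \<Rightarrow> complex" where
  "log_sol a b z = hyp_F 0 a b z * Ln z + log_series 0 a b z"

lemma log_sol_derivs: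
  assumes ab: "a \<notin> \<int>" "b \<notin> \<int>" and z: "z \<in> cut_plane \<inter> ball 0 1"
  defines "S \<equiv> log_series 0 a b" and "F \<equiv> hyp_F 0 a b"
  shows "(log_sol a b has_field_derivative (deriv F z * Ln z + F z / z + deriv S z)) (at z)"
    and "((\<lambda>z. deriv F z * Ln z + F z / z + deriv S z) has_field_derivative
           (deriv (deriv F) z * Ln z + 2 * deriv F z / z - F z / z ^ 2 + deriv (deriv S) z)) (at z)"
proof -
  have z': "z \<in> ball 0 1" "z \<in> slit_plane" "z \<notin> \<real>\<^sub>\<le>\<^sub>0" "z \<noteq> 0" using z by (auto dest: cut_planeD)
  have SH: "S holomorphic_on ball 0 1" unfolding S_def by (rule holomorphic_log_series[OF ab])
  have FH: "F holomorphic_on slit_plane" unfolding F_def by (rule holomorphic_F)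
  have S1: "(S has_field_derivative deriv S z) (at z)" and S2: "(deriv S has_field_derivative deriv (deriv S) z) (at z)"
    using SH z' by (auto intro!: holomorphic_derivI[where S = "ball 0 1"] holomorphic_deriv)
  have F1: "(F has_field_derivative deriv F z) (at z)" and F2: "(deriv F has_field_derivative deriv (deriv F) z) (at z)"
    using FH z' by (auto intro!: holomorphic_derivI[where S = slit_plane] holomorphic_deriv)
  have L: "(Ln has_field_derivative 1 / z) (at z)" using has_field_derivative_Ln[OF z'(3)] by (simp add: inverse_eq_divide)
  have "((\<lambda>z. F z * Ln z + S z) has_field_derivative (deriv F z * Ln z + F z / z + deriv S z)) (at z)"
    by (rule DERIV_add[OF DERIV_mult[OF F1 L] S1, THEN DERIV_cong]) (simp add: mult_ac)
  thus "(log_sol a b has_field_derivative (deriv F z * Ln z + F z / z + deriv S z)) (at z)"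
    by (simp add: log_sol_def [abs_def] F_def S_def)
  have q: "(deriv F z * z - F z * 1) / (z * z) = deriv F z / z - F z / z ^ 2"
    using z'(4) by (simp add: diff_divide_distrib power2_eq_square)
  show "((\<lambda>z. deriv F z * Ln z + F z / z + deriv S z) has_field_derivative
           (deriv (deriv F) z * Ln z + 2 * deriv F z / z - F z / z ^ 2 + deriv (deriv S) z)) (at z)"
    by (rule DERIV_add[OF DERIV_add[OF DERIV_mult[OF F2 L] DERIV_divide[OF F1 DERIV_ident z'(4)]] S2, THEN DERIV_cong])
       (simp only: q, simp)
qed

lemma hyp_ode_log_sol:
  assumes ab: "a \<notin> \<int>" "b \<notin> \<int>"
  shows "hyp_ode a b 1 (cut_plane \<inter> ball 0 1) (log_sol a b)"
proof (rule hyp_odeI[OF _ log_sol_derivs[OF ab]])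
  show "open (cut_plane \<inter> ball 0 1)" by auto
  fix z assume z: "z \<in> cut_plane \<inter> ball 0 1"
  let ?F = "hyp_F 0 a b" and ?S = "log_series 0 a b"
  have nz: "z \<noteq> 0" using z by (auto dest: cut_planeD)
  have zs: "z \<in> slit_plane" using z by (auto dest: cut_planeD)
  have E: "z * (1 - z) * deriv (deriv ?F) z + (1 - (a + b + 1) * z) * deriv ?F z - a * b * ?F z = 0"
    using hyp_odeD(3)[OF hyp_ode_F[of a b 0] open_slit_plane zs] by simp
  have S: "z * (1 - z) * deriv (deriv ?S) z + (1 - (a + b + 1) * z) * deriv ?S z - a * b * ?S z
          + 2 * (1 - z) * deriv ?F z - (a + b) * ?F z = 0"
    by (rule log_series_ode[OF ab]) (use z in auto)
  have "z * (1 - z) * (deriv (deriv ?F) z * Ln z + 2 * deriv ?F z / z - ?F z / z ^ 2 + deriv (deriv ?S) z)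
     + (1 - (a + b + 1) * z) * (deriv ?F z * Ln z + ?F z / z + deriv ?S z) - a * b * (?F z * Ln z + ?S z)
     = Ln z * (z * (1 - z) * deriv (deriv ?F) z + (1 - (a + b + 1) * z) * deriv ?F z - a * b * ?F z)
      + (z * (1 - z) * deriv (deriv ?S) z + (1 - (a + b + 1) * z) * deriv ?S z - a * b * ?S z
          + 2 * (1 - z) * deriv ?F z - (a + b) * ?F z)"
    using nz by (simp add: divide_simps power2_eq_square) (simp add: algebra_simps)
  also have "\<dots> = 0" unfolding E S by simp
  finally show "z * (1 - z) * (deriv (deriv ?F) z * Ln z + 2 * deriv ?F z / z - ?F z / z ^ 2 + deriv (deriv ?S) z)
     + (1 - (a + b + 1) * z) * (deriv ?F z * Ln z + ?F z / z + deriv ?S z) - a * b * log_sol a b z = 0"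
    by (simp add: log_sol_def)
qed

text \<open>
  Abel's identity: the Wronskian satisfies a linear equation of first order, whose solutions for \<open>c = 1\<close>
  are the multiples of \<open>1 / (z (1 - z)\<^sup>a\<^sup>+\<^sup>b)\<close>.
\<close>
lemma Wronskian_constant:
  assumes u: "hyp_ode a b 1 D u" and v: "hyp_ode a b 1 D v" and D: "open D" "connected D" "D \<subseteq> cut_plane"
  obtains \<kappa> where "\<And>z. z \<in> D \<Longrightarrow> z * (1 - z) powr (a + b) * (u z * deriv v z - deriv u z * v z) = \<kappa>"
proof -
  define W where "W = (\<lambda>z. z * (1 - z) powr (a + b) * (u z * deriv v z - deriv u z * v z))"
  have W': "(W has_field_derivative 0) (at z)" if z: "z \<in> D" for z
  proof -
    have zs: "z \<in> slit_plane" "1 - z \<noteq> 0" using z D by (auto dest: cut_planeD)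
    note U = hyp_odeD[OF u D(1) z] and V = hyp_odeD[OF v D(1) z]
    let ?p = "(1 - z) powr (a + b)"
    have p1: "(1 - z) powr (a + b - 1) = ?p / (1 - z)" by (rule one_minus_powr_diff[OF zs(1)])
    have d1: "((\<lambda>z. z * (1 - z) powr (a + b)) has_field_derivative (?p - z * (a + b) * ?p / (1 - z))) (at z)"
      by (rule DERIV_mult[OF DERIV_ident DERIV_one_minus_powr[OF zs(1)], THEN DERIV_cong]) (simp add: p1 algebra_simps add_divide_distrib diff_divide_distrib)
    have d2: "((\<lambda>z. u z * deriv v z - deriv u z * v z) has_field_derivative (u z * deriv (deriv v) z - deriv (deriv u) z * v z)) (at z)"
      by (rule DERIV_diff[OF DERIV_mult[OF U(1) V(2)] DERIV_mult[OF U(2) V(1)], THEN DERIV_cong]) (simp add: algebra_simps)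
    have "(?p - z * (a + b) * ?p / (1 - z)) * (u z * deriv v z - deriv u z * v z) + (u z * deriv (deriv v) z - deriv (deriv u) z * v z) * (z * ?p)
       = ?p / (1 - z) * (u z * (z * (1 - z) * deriv (deriv v) z + (1 - (a + b + 1) * z) * deriv v z - a * b * v z)
              - v z * (z * (1 - z) * deriv (deriv u) z + (1 - (a + b + 1) * z) * deriv u z - a * b * u z))"
      using zs(2) by (simp add: divide_simps) (simp add: algebra_simps)
    also have "\<dots> = 0" unfolding U(3) V(3) by simp
    finally show ?thesis using DERIV_mult[OF d1 d2] by (simp add: W_def)
  qed
  have "continuous_on D W"
    using W' DERIV_isCont by (intro continuous_at_imp_continuous_on) blast
  from DERIV_zero_connected_constant[OF D(2,1) finite.emptyI this] W' obtain \<kappa> where "\<And>z. z \<in> D \<Longrightarrow> W z = \<kappa>" by blast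
  thus ?thesis using that by (auto simp: W_def)
qed


lemma Wronskian_zero_imp_proportional:
  assumes "convex D" "open D" and u: "u holomorphic_on D" and v: "v holomorphic_on D"
    and nz: "\<And>z. z \<in> D \<Longrightarrow> u z \<noteq> 0"
    and W: "\<And>z. z \<in> D \<Longrightarrow> u z * deriv v z - deriv u z * v z = 0"
  obtains \<beta> where "\<And>z. z \<in> D \<Longrightarrow> v z = \<beta> * u z"
proof -
  have "((\<lambda>z. v z / u z) has_field_derivative 0) (at z within D)" if z: "z \<in> D" for z
  proof -
    have "(u has_field_derivative deriv u z) (at z)" "(v has_field_derivative deriv v z) (at z)"
      using u v \<open>open D\<close> z by (auto intro: holomorphic_derivI)
    from DERIV_divide[OF this(2,1) nz[OF z]] have "((\<lambda>z. v z / u z) has_field_derivative 0) (at z)"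
      using W[OF z] by (simp add: mult_ac)
    thus ?thesis by (rule has_field_derivative_at_within)
  qed
  from has_field_derivative_zero_constant[OF \<open>convex D\<close> this] obtain \<beta> where "\<And>z. z \<in> D \<Longrightarrow> v z / u z = \<beta>" by blast
  hence "v z = \<beta> * u z" if "z \<in> D" for z using that nz by (auto simp: field_simps)
  thus ?thesis by (rule that)
qed

text \<open>
  A convex subset of the common domain that touches both \<open>0\<close> and \<open>1\<close>, where the asymptotic behaviour
  is known.
\<close>
definition lens :: "complex set" where "lens = ball (1 / 2) (1 / 2)"

lemma lens_subset: "lens \<subseteq> cut_plane \<inter> ball 0 1"
proof
  fix z assume z: "z \<in> lens"
  hence d: "norm (z - 1 / 2) < 1 / 2" by (simp add: lens_def dist_norm norm_minus_commute)
  have "norm z \<le> norm (z - 1 / 2) + norm (1 / 2 :: complex)" using norm_triangle_ineq[of "z - 1 / 2" "1 / 2"] by simp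
  moreover have "\<bar>Re (z - 1 / 2)\<bar> < 1 / 2" using d abs_Re_le_cmod[of "z - 1 / 2"] by linarith
  hence "\<bar>Re z - 1 / 2\<bar> < 1 / 2" by simp
  hence "0 < Re z" "Re z < 1" by linarith+
  moreover have "norm (1 / 2 :: complex) = 1 / 2" by (simp add: norm_divide)
  ultimately show "z \<in> cut_plane \<inter> ball 0 1" using d
    \<open>norm z \<le> norm (z - 1 / 2) + norm (1 / 2 :: complex)\<close> by (auto simp: cut_plane_iff)
qed

lemma lens_real: "x \<in> {0<..<1} \<Longrightarrow> complex_of_real x \<in> lens"
proof -
  assume "x \<in> {0<..<1}"
  moreover have "dist (1 / 2) (complex_of_real x) = norm (complex_of_real (1 / 2 - x))" by (simp add: dist_norm)
  hence "dist (1 / 2) (complex_of_real x) = \<bar>1 / 2 - x\<bar>" by (simp only: norm_of_real real_norm_def)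
  moreover have "\<bar>1 / 2 - x\<bar> < 1 / 2" using calculation(1) unfolding greaterThanLessThan_iff by linarith
  ultimately show ?thesis by (simp add: lens_def)
qed

lemma eventually_unit_interval_right: "eventually (\<lambda>x. x \<in> {0<..<1::real}) (at_right 0)"
  by (rule eventually_at_right_real) auto

lemma tendsto_at_right_0_of_holomorphic:
  assumes "f holomorphic_on A" "open A" "0 \<in> A"
  shows "((\<lambda>x. f (complex_of_real x)) \<longlongrightarrow> f 0) (at_right 0)"
proof -
  have "isCont f 0"
    using assms holomorphic_on_imp_continuous_on continuous_on_eq_continuous_at by blast
  moreover have "((\<lambda>x. complex_of_real x) \<longlongrightarrow> complex_of_real 0) (at_right 0)" by (intro tendsto_intros)
  hence "((\<lambda>x. complex_of_real x) \<longlongrightarrow> 0) (at_right 0)" by simp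
  ultimately show ?thesis by (rule isCont_tendsto_compose)
qed

text \<open>
  The logarithms cancel in the Wronskian, so its value can be read off at \<open>z = 0\<close>, where it is
  \<open>F(0)\<^sup>2 = 1\<close>.
\<close>
lemma Wronskian_log_sol:
  assumes ab: "a \<notin> \<int>" "b \<notin> \<int>" and z: "z \<in> lens"
  shows "z * (1 - z) powr (a + b) * (hyp_F 0 a b z * deriv (log_sol a b) z - deriv (hyp_F 0 a b) z * log_sol a b z) = 1"
proof -
  let ?F = "hyp_F 0 a b" and ?S = "log_series 0 a b"
  have sub: "lens \<subseteq> slit_plane" using lens_subset by (auto dest: cut_planeD)
  have oF: "hyp_ode a b 1 lens ?F" using hyp_ode_subset[OF hyp_ode_F sub, of a b 0] by simp
  have oL: "hyp_ode a b 1 lens (log_sol a b)" by (rule hyp_ode_subset[OF hyp_ode_log_sol[OF ab] lens_subset])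
  have "open lens" "connected lens" "lens \<subseteq> cut_plane" using lens_subset by (auto simp: lens_def)
  from Wronskian_constant[OF oF oL this] obtain \<kappa> where \<kappa>: "\<And>z. z \<in> lens \<Longrightarrow>
      z * (1 - z) powr (a + b) * (?F z * deriv (log_sol a b) z - deriv ?F z * log_sol a b z) = \<kappa>" by blast
  let ?G = "\<lambda>z. (1 - z) powr (a + b) * (?F z ^ 2 + z * (?F z * deriv ?S z - deriv ?F z * ?S z))"
  have FH: "?F holomorphic_on ball 0 1" by (rule holomorphic_on_subset[OF holomorphic_F unit_ball_subset_slit_plane])
  have "?G holomorphic_on ball 0 1"
    using unit_ball_subset_slit_plane
    by (intro holomorphic_intros holomorphic_deriv FH holomorphic_log_series ab) (auto simp: slit_plane_iff)
  hence "((\<lambda>x. ?G (complex_of_real x)) \<longlongrightarrow> ?G 0) (at_right 0)"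
    by (rule tendsto_at_right_0_of_holomorphic) auto
  hence G1: "((\<lambda>x. ?G (complex_of_real x)) \<longlongrightarrow> 1) (at_right 0)" by (simp add: hyp_F_0)
  have "eventually (\<lambda>x. ?G (complex_of_real x) = \<kappa>) (at_right 0)"
    using eventually_unit_interval_right
  proof eventually_elim
    case (elim x)
    let ?x = "complex_of_real x"
    have x: "?x \<in> lens" using elim by (rule lens_real)
    hence x': "?x \<in> cut_plane \<inter> ball 0 1" using lens_subset by blast
    have nz: "?x \<noteq> 0" using elim by auto
    have dL: "deriv (log_sol a b) ?x = deriv ?F ?x * Ln ?x + ?F ?x / ?x + deriv ?S ?x"
      by (rule DERIV_imp_deriv[OF log_sol_derivs(1)[OF ab x']])
    have "?x * (?F ?x * deriv (log_sol a b) ?x - deriv ?F ?x * log_sol a b ?x) = ?F ?x ^ 2 + ?x * (?F ?x * deriv ?S ?x - deriv ?F ?x * ?S ?x)"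
      unfolding dL log_sol_def using nz by (simp add: field_simps power2_eq_square)
    hence "?G ?x = ?x * (1 - ?x) powr (a + b) * (?F ?x * deriv (log_sol a b) ?x - deriv ?F ?x * log_sol a b ?x)"
      by (simp add: mult_ac)
    thus ?case using \<kappa>[OF x] by simp
  qed
  hence "((\<lambda>x. ?G (complex_of_real x)) \<longlongrightarrow> \<kappa>) (at_right 0)"
    by (rule tendsto_eventually)
  from tendsto_unique[OF trivial_limit_at_right_real this G1] have "\<kappa> = 1" .
  thus ?thesis using \<kappa>[OF z] by simp
qed

lemma U0_minus_Ln_limit:
  assumes ab: "a \<notin> \<int>" "b \<notin> \<int>"
  shows "((\<lambda>x. hyp_U 0 a b (complex_of_real x) - Ln (complex_of_real x)) \<longlongrightarrow> psi_sum 0 a b 0) (at_right 0)"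
proof -
  have "((\<lambda>x. zero_balanced a b (complex_of_real x) + Ln (1 - complex_of_real x)) \<longlongrightarrow>
      - Digamma a - Digamma b - 2 * euler_mascheroni) (at_left 1)"
    using zero_balanced_limit_always[of a b] ab nonint_nonpole unfolding zero_balanced_limit_def by blast
  hence "((\<lambda>x. zero_balanced a b (complex_of_real (1 - x)) + Ln (1 - complex_of_real (1 - x))) \<longlongrightarrow>
      - Digamma a - Digamma b - 2 * euler_mascheroni) (at_right 0)"
  proof (rule filterlim_compose)
    show "filterlim (\<lambda>x::real. 1 - x) (at_left 1) (at_right 0)"
      by (auto simp: filterlim_at eventually_at_filter intro!: tendsto_eq_intros)
  qed
  from tendsto_minus[OF this]
  have lim: "((\<lambda>x. - (zero_balanced a b (complex_of_real (1 - x)) + Ln (1 - complex_of_real (1 - x)))) \<longlongrightarrow>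
      - (- Digamma a - Digamma b - 2 * euler_mascheroni)) (at_right 0)" .
  have 1: "(\<lambda>x. - (zero_balanced a b (complex_of_real (1 - x)) + Ln (1 - complex_of_real (1 - x))))
      = (\<lambda>x. hyp_U 0 a b (complex_of_real x) - Ln (complex_of_real x))"
    by (simp add: zero_balanced_def hyp_U_def fun_eq_iff)
  have 2: "- (- Digamma a - Digamma b - 2 * euler_mascheroni) = psi_sum 0 a b 0"
    by (simp add: psi_sum_def)
  show ?thesis using lim unfolding 1 2 .
qed

text \<open>
  If \<open>\<kappa>\<close> is the constant Wronskian of \<open>F\<close> and \<open>U\<^sub>1\<close>, then \<open>U\<^sub>1 - \<kappa> (F log z + S)\<close> has Wronskian \<open>0\<close> with
  \<open>F\<close> and is \<open>\<beta> F\<close> near \<open>0\<close>. For \<open>z \<rightarrow> 0+\<close> the term \<open>(\<kappa> - 1) log z\<close> must stay bounded, which forces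
  \<open>\<kappa> = 1\<close>; then \<open>\<beta> = 0\<close>, because both functions minus \<open>log z\<close> have the limit \<open>\<psi>(a) + \<psi>(b) + 2 \<gamma>\<close>.
\<close>
theorem U0_eq_log_sol:
  assumes ab: "a \<notin> \<int>" "b \<notin> \<int>" and z: "z \<in> cut_plane \<inter> ball 0 1"
  shows "hyp_U 0 a b z = log_sol a b z"
proof -
  let ?F = "hyp_F 0 a b" and ?S = "log_series 0 a b" and ?L = "log_sol a b" and ?U = "hyp_U 0 a b"
  have sub: "lens \<subseteq> slit_plane" "lens \<subseteq> cut_plane" using lens_subset by (auto dest: cut_planeD)
  have lens: "open lens" "connected lens" "convex lens" by (auto simp: lens_def)
  have oF: "hyp_ode a b 1 lens ?F" using hyp_ode_subset[OF hyp_ode_F sub(1), of a b 0] by simp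
  have oL: "hyp_ode a b 1 lens ?L" by (rule hyp_ode_subset[OF hyp_ode_log_sol[OF ab] lens_subset])
  have oU: "hyp_ode a b 1 lens ?U" by (rule hyp_ode_subset[OF hyp_ode_U0 sub(2)])
  from Wronskian_constant[OF oF oU lens(1,2) sub(2)] obtain \<kappa> where \<kappa>: "\<And>z. z \<in> lens \<Longrightarrow>
      z * (1 - z) powr (a + b) * (?F z * deriv ?U z - deriv ?F z * ?U z) = \<kappa>" by blast
  let ?D = "\<lambda>z. ?U z - \<kappa> * ?L z"
  have W: "?F z * deriv ?D z - deriv ?F z * ?D z = 0" if z: "z \<in> lens" for z
  proof -
    have dD: "deriv ?D z = deriv ?U z - \<kappa> * deriv ?L z"
      by (intro DERIV_imp_deriv DERIV_diff DERIV_cmult hyp_odeD(1)[OF oU lens(1) z] hyp_odeD(1)[OF oL lens(1) z])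
    have "z * (1 - z) powr (a + b) * (?F z * deriv ?D z - deriv ?F z * ?D z)
       = z * (1 - z) powr (a + b) * (?F z * deriv ?U z - deriv ?F z * ?U z) - \<kappa> * (z * (1 - z) powr (a + b) * (?F z * deriv ?L z - deriv ?F z * ?L z))"
      unfolding dD by (simp add: algebra_simps)
    also have "\<dots> = 0" using \<kappa>[OF z] Wronskian_log_sol[OF ab z] by simp
    finally show ?thesis using z sub(2) by (auto dest: cut_planeD)
  qed
  have "isCont ?F 0"
    using holomorphic_F holomorphic_on_imp_continuous_on continuous_on_eq_continuous_at open_slit_plane zero_in_slit_plane by blast
  moreover have "?F 0 \<noteq> 0" by (simp add: hyp_F_0)
  ultimately obtain e where e: "e > 0" "\<And>z. dist 0 z < e \<Longrightarrow> ?F z \<noteq> 0"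
    using continuous_at_avoid[of 0 ?F 0] by auto
  define N where "N = lens \<inter> ball 0 e"
  have N: "open N" "convex N" "N \<subseteq> lens" by (auto simp: N_def lens intro: convex_Int)
  have UH: "?U holomorphic_on lens" and LH: "?L holomorphic_on lens" and FH: "?F holomorphic_on lens"
    using oU oL oF by (auto simp: hyp_ode_def)
  obtain \<beta> where \<beta>: "\<And>z. z \<in> N \<Longrightarrow> ?D z = \<beta> * ?F z"
  proof (rule Wronskian_zero_imp_proportional[OF N(2,1)])
    show "?F holomorphic_on N" by (rule holomorphic_on_subset[OF FH N(3)])
    show "?D holomorphic_on N" by (rule holomorphic_on_subset[OF _ N(3)]) (intro holomorphic_intros UH LH)
  qed (use e W N(3) in \<open>auto simp: N_def\<close>)
  have ev: "eventually (\<lambda>x. complex_of_real x \<in> N \<and> x \<in> {0<..<1}) (at_right 0)"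
  proof -
    have "eventually (\<lambda>x. x \<in> {0<..<min 1 e}) (at_right 0)" using e by (intro eventually_at_right_real) auto
    thus ?thesis by eventually_elim (use lens_real in \<open>auto simp: N_def\<close>)
  qed
  \<comment> \<open>\<open>F - 1\<close> is \<open>O(z)\<close>, which beats the logarithm.\<close>
  have LnF: "((\<lambda>x. Ln (complex_of_real x) * (?F (complex_of_real x) - 1)) \<longlongrightarrow> 0) (at_right 0)"
  proof -
    have "(?F has_field_derivative deriv ?F 0) (at 0)"
      by (rule holomorphic_derivI[OF holomorphic_F open_slit_plane zero_in_slit_plane])
    hence "((\<lambda>h. (?F (0 + h) - ?F 0) / h) \<longlongrightarrow> deriv ?F 0) (at 0)"
      unfolding DERIV_def .
    moreover have "filterlim complex_of_real (at 0) (at_right 0)"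
      by (auto simp: filterlim_at eventually_at_filter intro!: tendsto_eq_intros)
    ultimately have 1: "((\<lambda>x. (?F (0 + complex_of_real x) - ?F 0) / complex_of_real x) \<longlongrightarrow> deriv ?F 0) (at_right 0)"
      by (rule filterlim_compose)
    have "((\<lambda>x::real. x * ln x) \<longlongrightarrow> 0) (at_right 0)" by real_asymp
    hence "((\<lambda>x. complex_of_real (x * ln x)) \<longlongrightarrow> complex_of_real 0) (at_right 0)" by (intro tendsto_intros)
    from tendsto_mult[OF this 1] have "((\<lambda>x. complex_of_real (x * ln x) * ((?F (0 + complex_of_real x) - ?F 0) / complex_of_real x)) \<longlongrightarrow> 0) (at_right 0)"
      by simp
    thus ?thesis
    proof (rule Lim_transform_eventually)
      show "eventually (\<lambda>x. complex_of_real (x * ln x) * ((?F (0 + complex_of_real x) - ?F 0) / complex_of_real x) =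
            Ln (complex_of_real x) * (?F (complex_of_real x) - 1)) (at_right 0)"
        using ev by eventually_elim (auto simp: hyp_F_0 Ln_of_real)
    qed
  qed
  have Ft: "((\<lambda>x. ?F (complex_of_real x)) \<longlongrightarrow> 1) (at_right 0)"
    using tendsto_at_right_0_of_holomorphic[OF holomorphic_F, of 0 a b] by (simp add: hyp_F_0)
  have St: "((\<lambda>x. ?S (complex_of_real x)) \<longlongrightarrow> psi_sum 0 a b 0) (at_right 0)"
    using tendsto_at_right_0_of_holomorphic[OF holomorphic_log_series[OF ab], of 0] by (simp add: log_series_0[OF ab])
  have "((\<lambda>x. (?U (complex_of_real x) - Ln (complex_of_real x)) - (\<kappa> * (Ln (complex_of_real x) * (?F (complex_of_real x) - 1) + ?S (complex_of_real x)) + \<beta> * ?F (complex_of_real x)))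
     \<longlongrightarrow> psi_sum 0 a b 0 - (\<kappa> * (0 + psi_sum 0 a b 0) + \<beta> * 1)) (at_right 0)"
    by (intro tendsto_intros U0_minus_Ln_limit[OF ab] LnF St Ft)
  moreover have "eventually (\<lambda>x. (?U (complex_of_real x) - Ln (complex_of_real x)) - (\<kappa> * (Ln (complex_of_real x) * (?F (complex_of_real x) - 1) + ?S (complex_of_real x)) + \<beta> * ?F (complex_of_real x))
       = (\<kappa> - 1) * complex_of_real (ln x)) (at_right 0)"
    using ev
  proof eventually_elim
    case (elim x)
    have "?U (complex_of_real x) = \<kappa> * ?L (complex_of_real x) + \<beta> * ?F (complex_of_real x)"
      using \<beta>[of "complex_of_real x"] elim by (simp add: algebra_simps)
    moreover have "Ln (complex_of_real x) = complex_of_real (ln x)" using elim by (simp add: Ln_of_real)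
    ultimately show ?case by (simp add: log_sol_def algebra_simps)
  qed
  ultimately have lim: "((\<lambda>x. (\<kappa> - 1) * complex_of_real (ln x)) \<longlongrightarrow> psi_sum 0 a b 0 - (\<kappa> * (0 + psi_sum 0 a b 0) + \<beta> * 1)) (at_right 0)"
    by (rule Lim_transform_eventually)
  \<comment> \<open>Divide by the unbounded \<open>ln x\<close>: the limit \<open>\<kappa> - 1\<close> of the quotient is \<open>0\<close>.\<close>
  have "((\<lambda>x::real. 1 / ln x) \<longlongrightarrow> 0) (at_right 0)" by real_asymp
  hence "((\<lambda>x. complex_of_real (1 / ln x)) \<longlongrightarrow> complex_of_real 0) (at_right 0)" by (intro tendsto_intros)
  from tendsto_mult[OF this lim] have "((\<lambda>x. complex_of_real (1 / ln x) * ((\<kappa> - 1) * complex_of_real (ln x))) \<longlongrightarrow> 0) (at_right 0)" by simp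
  moreover have "eventually (\<lambda>x. complex_of_real (1 / ln x) * ((\<kappa> - 1) * complex_of_real (ln x)) = \<kappa> - 1) (at_right 0)"
    using ev
  proof eventually_elim
    case (elim x)
    hence "ln x \<noteq> 0" using ln_less_zero[of x] by auto
    thus ?case by simp
  qed
  ultimately have "((\<lambda>x::real. \<kappa> - 1) \<longlongrightarrow> 0) (at_right 0)"
    by (rule Lim_transform_eventually)
  hence \<kappa>1: "\<kappa> = 1" using tendsto_const_iff[of "at_right (0::real)" "\<kappa> - 1" 0] by simp
  have "((\<lambda>x::real. 0 :: complex) \<longlongrightarrow> - \<beta>) (at_right 0)" using lim unfolding \<kappa>1 by simp
  hence \<beta>0: "\<beta> = 0" using tendsto_const_iff[of "at_right (0::real)" "0::complex" "- \<beta>"] by simp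
  show ?thesis
  proof (rule analytic_continuation_open[of N "cut_plane \<inter> ball 0 1" ?U ?L])
    show "N \<noteq> {}"
      using eventually_happens'[OF trivial_limit_at_right_real ev] by auto
    show "connected (cut_plane \<inter> ball 0 1)" by (rule connected_cut_plane_Int) auto
    show "?U holomorphic_on cut_plane \<inter> ball 0 1"
      using hyp_ode_U0[of a b] by (auto simp: hyp_ode_def intro: holomorphic_on_subset)
    show "?L holomorphic_on cut_plane \<inter> ball 0 1"
      using hyp_ode_log_sol[OF ab] by (simp add: hyp_ode_def)
    show "?U z = ?L z" if "z \<in> N" for z using \<beta>[OF that] by (simp add: \<kappa>1 \<beta>0)
  qed (use N lens_subset z in auto)
qed

section \<open>From m to m + 1 by differentiation\<close>

lemma DERIV_hyp_U:
  assumes "1 - z \<in> slit_plane"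
  shows "(hyp_U m a b has_field_derivative (a * b / (of_nat m + 1)) * hyp_U (Suc m) (a + 1) (b + 1) z) (at z)"
proof -
  define K where "K = (-1) ^ (m + 1) * fact m * (Gamma (a - of_nat m) * Gamma (b - of_nat m))"
  have 1: "((\<lambda>z. reg_hyp a b (a + b - of_nat m) (1 - z)) has_field_derivative
      (a * b * reg_hyp (a + 1) (b + 1) (a + b - of_nat m + 1) (1 - z)) * (- 1)) (at z)"
    by (rule DERIV_chain2[where g = "\<lambda>z. 1 - z", OF DERIV_reg_hyp[OF assms]]) (auto intro!: derivative_eq_intros)
  have nz: "of_nat m + 1 \<noteq> (0::complex)" by (auto simp: complex_eq_iff)
  have e: "a + 1 - of_nat (Suc m) = a - of_nat m" "b + 1 - of_nat (Suc m) = b - of_nat m"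
     "a + 1 + (b + 1) - of_nat (Suc m) = a + b - of_nat m + 1" by simp_all
  have f: "fact (Suc m) = (of_nat m + 1) * (fact m :: complex)" by simp
  have "hyp_U (Suc m) (a + 1) (b + 1) z = (of_nat m + 1) * (- (K * reg_hyp (a + 1) (b + 1) (a + b - of_nat m + 1) (1 - z)))"
    unfolding hyp_U_def e f K_def by (simp add: algebra_simps)
  hence "K * (a * b * reg_hyp (a + 1) (b + 1) (a + b - of_nat m + 1) (1 - z) * (- 1)) = (a * b / (of_nat m + 1)) * hyp_U (Suc m) (a + 1) (b + 1) z"
    using nz by simp
  with DERIV_cmult[OF 1, of K] show ?thesis by (simp add: hyp_U_def [abs_def] K_def)
qed

lemma DERIV_hyp_F:
  assumes "z \<in> slit_plane"
  shows "(hyp_F m a b has_field_derivative (a * b / (of_nat m + 1)) * hyp_F (Suc m) (a + 1) (b + 1) z) (at z)"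
proof -
  have nz: "of_nat m + 1 \<noteq> (0::complex)" by (auto simp: complex_eq_iff)
  have e: "of_nat (Suc m) + 1 = of_nat m + 1 + (1::complex)" by simp
  have f: "fact (Suc m) = (of_nat m + 1) * (fact m :: complex)" by simp
  have "(a * b / (of_nat m + 1)) * hyp_F (Suc m) (a + 1) (b + 1) z = fact m * (a * b * reg_hyp (a + 1) (b + 1) (of_nat m + 1 + 1) z)"
    unfolding hyp_F_def e f using nz by simp
  with DERIV_cmult[OF DERIV_reg_hyp[OF assms, of a b "of_nat m + 1"], of "fact m"] show ?thesis
    by (simp add: hyp_F_def [abs_def])
qed

text \<open>
  The identity for \<open>(m + 1, a, b)\<close> is the derivative of the one for \<open>(m, a - 1, b - 1)\<close>, divided by the
  common factor.
\<close>
lemma raise_identity: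
  fixes X Y :: "nat \<Rightarrow> complex \<Rightarrow> complex \<Rightarrow> complex \<Rightarrow> complex"
  assumes D: "open D"
    and base: "\<And>a b z. a \<notin> \<int> \<Longrightarrow> b \<notin> \<int> \<Longrightarrow> z \<in> D \<Longrightarrow> X 0 a b z = Y 0 a b z"
    and X: "\<And>m a b z. a \<notin> \<int> \<Longrightarrow> b \<notin> \<int> \<Longrightarrow> z \<in> D \<Longrightarrow>
       (X m a b has_field_derivative (a * b / (of_nat m + 1)) * X (Suc m) (a + 1) (b + 1) z) (at z)"
    and Y: "\<And>m a b z. a \<notin> \<int> \<Longrightarrow> b \<notin> \<int> \<Longrightarrow> z \<in> D \<Longrightarrow>
       (Y m a b has_field_derivative (a * b / (of_nat m + 1)) * Y (Suc m) (a + 1) (b + 1) z) (at z)"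
    and ab: "a \<notin> \<int>" "b \<notin> \<int>" and z: "z \<in> D"
  shows "X m a b z = Y m a b z"
  using ab z
proof (induction m arbitrary: a b z)
  case 0
  thus ?case by (rule base)
next
  case (Suc m)
  let ?a = "a - 1" and ?b = "b - 1"
  have ni: "?a \<notin> \<int>" "?b \<notin> \<int>" using Suc.prems by (metis Ints_1 Ints_add diff_add_cancel)+
  have "of_nat m + 1 \<noteq> (0::complex)" by (auto simp: complex_eq_iff)
  moreover have "?a \<noteq> 0" "?b \<noteq> 0" using ni Ints_0 by metis+
  ultimately have nz: "?a * ?b / (of_nat m + 1) \<noteq> 0" by simp
  have "eventually (\<lambda>z. X m ?a ?b z = Y m ?a ?b z) (nhds z)"
    using eventually_nhds_in_open[OF D Suc.prems(3)] by eventually_elim (rule Suc.IH[OF ni])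
  hence "(X m ?a ?b has_field_derivative (?a * ?b / (of_nat m + 1)) * Y (Suc m) (?a + 1) (?b + 1) z) (at z)"
    using Y[OF ni Suc.prems(3), of m] DERIV_cong_ev by blast
  from DERIV_unique[OF this X[OF ni Suc.prems(3), of m]] have "X (Suc m) (?a + 1) (?b + 1) z = Y (Suc m) (?a + 1) (?b + 1) z"
    using mult_left_cancel[OF nz] by metis
  thus ?case by simp
qed

definition polar_const :: "nat \<Rightarrow> complex \<Rightarrow> complex \<Rightarrow> complex" where
  "polar_const m a b = (-1) ^ (m + 1) * fact m * fact (m - 1) / (pochhammer (1 - a) m * pochhammer (1 - b) m)"

text \<open>
  The factor \<open>z\<^sup>-\<^sup>m\<close> is moved into the sum to make the differentiation termwise.
\<close>
definition polar_part :: "nat \<Rightarrow> complex \<Rightarrow> complex \<Rightarrow> complex \<Rightarrow> complex" where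
  "polar_part m a b z = (\<Sum>k<m. polar_const m a b * (pochhammer (a - of_nat m) k * pochhammer (b - of_nat m) k
                          / (pochhammer (1 - of_nat m) k * fact k)) * z powi (int k - int m))"

lemma pochhammer_minus_of_nat: "pochhammer (a - of_nat m) m = (- 1) ^ m * pochhammer (1 - a :: complex) m"
  using pochhammer_minus[of "of_nat m - a" m] by (simp add: algebra_simps)

lemma pochhammer_neg_of_nat: "pochhammer (- of_nat m) m = (- 1) ^ m * (fact m :: complex)"
  using pochhammer_minus_of_nat[of 0 m] by (simp add: pochhammer_fact)

lemma pochhammer_one_minus_nonzero:
  assumes "a \<notin> \<int>"
  shows "pochhammer (1 - a :: complex) m \<noteq> 0"
proof
  assume "pochhammer (1 - a) m = 0"
  then obtain k where "1 - a = - of_nat k" by (auto simp: pochhammer_eq_0_iff)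
  hence "a = of_nat (k + 1)" by (simp add: algebra_simps)
  thus False using assms by (metis Ints_of_nat)
qed

text \<open>
  The term \<open>k = m\<close> is new at \<open>m + 1\<close>. Its coefficient \<open>1\<close> is matched by the pole \<open>1 / z\<close> of the
  derivative of \<open>F log z\<close>; the other terms are those for \<open>m\<close>, differentiated.
\<close>
lemma polar_coeff_raise:
  assumes ab: "a \<notin> \<int>" "b \<notin> \<int>" and k: "k \<le> m"
  defines "d \<equiv> a * b / (of_nat m + 1) * (polar_const (Suc m) (a + 1) (b + 1) * (pochhammer (a + 1 - of_nat (Suc m)) k * pochhammer (b + 1 - of_nat (Suc m)) k
                          / (pochhammer (1 - of_nat (Suc m)) k * fact k)))"
  shows "k = m \<Longrightarrow> d = 1"
    and "k < m \<Longrightarrow> d = (of_nat k - of_nat m) * (polar_const m a b * (pochhammer (a - of_nat m) k * pochhammer (b - of_nat m) k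
                          / (pochhammer (1 - of_nat m) k * fact k)))"
proof -
  let ?A = "pochhammer (1 - a) m" and ?B = "pochhammer (1 - b) m"
  have "of_nat m + 1 \<noteq> (0::complex)" by (auto simp: complex_eq_iff)
  moreover have "a \<noteq> 0" "b \<noteq> 0" using ab by auto
  ultimately have nz: "of_nat m + 1 \<noteq> (0::complex)" "a \<noteq> 0" "b \<noteq> 0" "?A \<noteq> 0" "?B \<noteq> 0"
    using pochhammer_one_minus_nonzero[OF ab(1)] pochhammer_one_minus_nonzero[OF ab(2)] by auto
  have e: "a + 1 - of_nat (Suc m) = a - of_nat m" "b + 1 - of_nat (Suc m) = b - of_nat m" "1 - of_nat (Suc m) = (- of_nat m :: complex)"
     "Suc m - 1 = m"
    by simp_all
  have p: "pochhammer (1 - (a + 1)) (Suc m) = - a * ?A" "pochhammer (1 - (b + 1)) (Suc m) = - b * ?B"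
    by (simp_all add: pochhammer_rec add.commute)
  have f: "fact (Suc m) = (of_nat m + 1) * (fact m :: complex)" by simp
  have Q: "a * b / (of_nat m + 1) * polar_const (Suc m) (a + 1) (b + 1) = (-1) ^ m * fact m * fact m / (?A * ?B)"
    unfolding polar_const_def p f e(4) using nz by (simp add: divide_simps)
  have d: "d = (-1) ^ m * fact m * fact m / (?A * ?B) * (pochhammer (a - of_nat m) k * pochhammer (b - of_nat m) k / (pochhammer (- of_nat m) k * fact k))"
    unfolding d_def e mult.assoc [symmetric] Q by simp
  show "d = 1" if "k = m"
  proof -
    have "(- 1) ^ m * (- 1) ^ m = (1 :: complex)" by (simp flip: power_mult_distrib)
    thus ?thesis
      unfolding d that pochhammer_minus_of_nat pochhammer_neg_of_nat using nz by (simp add: divide_simps)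
  qed
  show "d = (of_nat k - of_nat m) * (polar_const m a b * (pochhammer (a - of_nat m) k * pochhammer (b - of_nat m) k
                          / (pochhammer (1 - of_nat m) k * fact k)))" if km: "k < m"
  proof -
    define X where "X = pochhammer (a - of_nat m) k * pochhammer (b - of_nat m) k / (?A * ?B * fact k)"
    have m0: "m > 0" using km by simp
    have fm: "fact m = of_nat m * (fact (m - 1) :: complex)" using m0 by (simp add: fact_reduce)
    have r: "pochhammer (- of_nat m) k * (of_nat k - of_nat m) = - of_nat m * pochhammer (1 - of_nat m :: complex) k"
      using pochhammer_rec[of "- of_nat m :: complex" k] pochhammer_rec'[of "- of_nat m :: complex" k] by (simp add: algebra_simps)
    have p0: "pochhammer (- of_nat m :: complex) k \<noteq> 0" using km by (simp add: pochhammer_of_nat_eq_0_iff)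
    have km0: "of_nat k - of_nat m \<noteq> (0 :: complex)" using km by simp
    have p1: "pochhammer (1 - of_nat m :: complex) k \<noteq> 0" using r p0 km0 m0 by (metis mult_eq_0_iff)
    have q: "of_nat m / pochhammer (- of_nat m) k = - (of_nat k - of_nat m) / pochhammer (1 - of_nat m :: complex) k"
      using r p0 p1 by (simp add: divide_simps) (simp add: algebra_simps)
    have "d = (-1) ^ m * fact m * fact (m - 1) * X * (of_nat m / pochhammer (- of_nat m) k)"
      unfolding d X_def using nz p0 by (simp add: divide_simps fm)
    also have "\<dots> = (of_nat k - of_nat m) * ((- ((-1) ^ m) * fact m * fact (m - 1)) * X / pochhammer (1 - of_nat m) k)"
    proof -
      have "P * (- t / p) = t * (- P / p)" for P t p :: complex by simp
      from this[of "(-1) ^ m * fact m * fact (m - 1) * X"] show ?thesis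
        unfolding q by (simp only: mult_minus_left)
    qed
    also have "(- ((-1) ^ m) * fact m * fact (m - 1)) * X / pochhammer (1 - of_nat m) k =
        polar_const m a b * (pochhammer (a - of_nat m) k * pochhammer (b - of_nat m) k
                          / (pochhammer (1 - of_nat m) k * fact k))"
      unfolding X_def polar_const_def by (simp add: mult_ac)
    finally show ?thesis .
  qed
qed

lemma DERIV_polar_part:
  assumes ab: "a \<notin> \<int>" "b \<notin> \<int>" and z: "z \<noteq> 0"
  shows "(polar_part m a b has_field_derivative
           (a * b / (of_nat m + 1)) * polar_part (Suc m) (a + 1) (b + 1) z - 1 / z) (at z)"
proof -
  define c where "c = (\<lambda>k. polar_const m a b * (pochhammer (a - of_nat m) k * pochhammer (b - of_nat m) k
                          / (pochhammer (1 - of_nat m) k * fact k)))"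
  define c' where "c' = (\<lambda>k. polar_const (Suc m) (a + 1) (b + 1) * (pochhammer (a + 1 - of_nat (Suc m)) k * pochhammer (b + 1 - of_nat (Suc m)) k
                          / (pochhammer (1 - of_nat (Suc m)) k * fact k)))"
  have 1: "((\<lambda>z. \<Sum>k<m. c k * z powi (int k - int m)) has_field_derivative (\<Sum>k<m. c k * (of_int (int k - int m) * z powi (int k - int m - 1) * 1))) (at z)"
    by (intro DERIV_sum DERIV_cmult DERIV_power_int DERIV_ident disjI2 z)
  have "(a * b / (of_nat m + 1)) * polar_part (Suc m) (a + 1) (b + 1) z =
      (\<Sum>k<Suc m. a * b / (of_nat m + 1) * c' k * z powi (int k - int (Suc m)))"
    unfolding polar_part_def c'_def sum_distrib_left by (intro sum.cong) (simp_all only: mult.assoc)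
  also have "\<dots> = (\<Sum>k<m. a * b / (of_nat m + 1) * c' k * z powi (int k - int (Suc m))) + a * b / (of_nat m + 1) * c' m * z powi (- 1)"
    by simp
  also have "a * b / (of_nat m + 1) * c' m = 1"
    using polar_coeff_raise(1)[OF ab, of m m] by (simp only: c'_def)
  also have "(\<Sum>k<m. a * b / (of_nat m + 1) * c' k * z powi (int k - int (Suc m))) = (\<Sum>k<m. c k * (of_int (int k - int m) * z powi (int k - int m - 1) * 1))"
  proof (rule sum.cong)
    fix k assume "k \<in> {..<m}"
    hence k: "k \<le> m" "k < m" by auto
    have e: "int k - int (Suc m) = int k - int m - 1" by simp
    have "a * b / (of_nat m + 1) * c' k = (of_nat k - of_nat m) * c k"
      using polar_coeff_raise(2)[OF ab k] by (simp only: c'_def c_def)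
    thus "a * b / (of_nat m + 1) * c' k * z powi (int k - int (Suc m)) = c k * (of_int (int k - int m) * z powi (int k - int m - 1) * 1)"
      unfolding e by simp
  qed simp
  finally show ?thesis using 1 by (simp add: polar_part_def [abs_def] c_def power_int_minus inverse_eq_divide)
qed

lemma F_coeff_raise:
  "a * b / (of_nat m + 1) * F_coeff (Suc m) (a + 1) (b + 1) k = of_nat (Suc k) * F_coeff m a b (Suc k)"
proof -
  have nz: "of_nat m + 1 \<noteq> (0::complex)" by (auto simp: complex_eq_iff)
  have p: "pochhammer (of_nat m + 1) (Suc k) = (of_nat m + 1) * pochhammer (of_nat (Suc m) + 1 :: complex) k"
    by (simp add: pochhammer_rec add_ac)
  have "of_nat (Suc k) \<noteq> (0::complex)" by (rule of_nat_neq_0)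
  thus ?thesis unfolding F_coeff_def p fact_Suc pochhammer_rec[of a] pochhammer_rec[of b]
    using nz by (simp add: divide_simps del: of_nat_Suc)
qed

lemma psi_sum_raise: "psi_sum (Suc m) (a + 1) (b + 1) k = psi_sum m a b (Suc k) + 1 / of_nat (Suc k)"
proof -
  have nz: "complex_of_nat (Suc k) \<noteq> 0" by (rule of_nat_neq_0)
  have e: "a + 1 + of_nat k = a + of_nat (Suc k)" "b + 1 + of_nat k = b + of_nat (Suc k)"
     "of_nat (Suc m) + of_nat k + 1 = of_nat m + complex_of_nat (Suc k) + 1" "of_nat k + 1 = complex_of_nat (Suc k)"
    by simp_all
  show ?thesis unfolding psi_sum_def e Digamma_plus1[OF nz] by (simp only: algebra_simps)
qed

text \<open>
  The subtracted term is compensated by the derivative of \<open>F log z\<close>, whose part \<open>F / z\<close> is not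
  covered by \<open>F' log z\<close>.
\<close>
lemma DERIV_log_series:
  assumes ab: "a \<notin> \<int>" "b \<notin> \<int>" and z: "z \<in> ball 0 1" "z \<noteq> 0"
  shows "(log_series m a b has_field_derivative
           (a * b / (of_nat m + 1)) * log_series (Suc m) (a + 1) (b + 1) z - (hyp_F m a b z - 1) / z) (at z)"
proof -
  have ni: "a + 1 \<notin> \<int>" "b + 1 \<notin> \<int>" using ab by (metis Ints_1 Ints_diff add_diff_cancel_right')+
  have nz: "norm z < 1" using z by simp
  have R: "ereal (norm z) < fps_conv_radius (log_fps m a b)"
    using log_fps_conv_radius[OF ab, of m] nz by (metis ereal_less(3) less_le_trans)
  hence D: "(log_series m a b has_field_derivative eval_fps (fps_deriv (log_fps m a b)) z) (at z)"
    unfolding log_series_def by (rule has_field_derivative_eval_fps)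
  have "ereal (norm z) < fps_conv_radius (fps_deriv (log_fps m a b))"
    using R fps_conv_radius_deriv[of "log_fps m a b"] by simp
  hence s1: "(\<lambda>k. of_nat (Suc k) * (F_coeff m a b (Suc k) * psi_sum m a b (Suc k)) * z ^ k) sums eval_fps (fps_deriv (log_fps m a b)) z"
    using sums_eval_fps[of z "fps_deriv (log_fps m a b)"] by (simp add: log_fps_def)
  have "(\<lambda>k. F_coeff m a b (Suc k) * z ^ Suc k) sums (hyp_F m a b z - 1)"
    using continues_sums[OF continues_F nz, of m a b] sums_Suc_iff[of "\<lambda>k. F_coeff m a b k * z ^ k" "hyp_F m a b z - 1"] by simp
  from sums_divide[OF this, of z] have s2: "(\<lambda>k. F_coeff m a b (Suc k) * z ^ k) sums ((hyp_F m a b z - 1) / z)"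
    using z(2) by (simp add: divide_simps mult_ac)
  have s3: "(\<lambda>k. a * b / (of_nat m + 1) * (F_coeff (Suc m) (a + 1) (b + 1) k * psi_sum (Suc m) (a + 1) (b + 1) k * z ^ k)) sums
      (a * b / (of_nat m + 1) * log_series (Suc m) (a + 1) (b + 1) z)"
    by (intro sums_mult log_series_sums ni nz)
  have "a * b / (of_nat m + 1) * (F_coeff (Suc m) (a + 1) (b + 1) k * psi_sum (Suc m) (a + 1) (b + 1) k * z ^ k) =
      of_nat (Suc k) * (F_coeff m a b (Suc k) * psi_sum m a b (Suc k)) * z ^ k + F_coeff m a b (Suc k) * z ^ k" for k
  proof -
    have nz: "complex_of_nat (Suc k) \<noteq> 0" by (rule of_nat_neq_0)
    have "a * b / (of_nat m + 1) * (F_coeff (Suc m) (a + 1) (b + 1) k * psi_sum (Suc m) (a + 1) (b + 1) k * z ^ k) =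
       (a * b / (of_nat m + 1) * F_coeff (Suc m) (a + 1) (b + 1) k) * psi_sum (Suc m) (a + 1) (b + 1) k * z ^ k"
      by (simp only: mult.assoc)
    also have "\<dots> = of_nat (Suc k) * (F_coeff m a b (Suc k) * psi_sum m a b (Suc k)) * z ^ k + (of_nat (Suc k) * (1 / of_nat (Suc k))) * F_coeff m a b (Suc k) * z ^ k"
      unfolding F_coeff_raise psi_sum_raise by (simp only: ring_distribs mult_ac)
    finally show ?thesis using nz by (simp del: of_nat_Suc)
  qed
  with s3 sums_add[OF s1 s2] have "a * b / (of_nat m + 1) * log_series (Suc m) (a + 1) (b + 1) z =
      eval_fps (fps_deriv (log_fps m a b)) z + (hyp_F m a b z - 1) / z"
    using sums_unique2 by (simp only:) blast
  thus ?thesis using D by simp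
qed

definition log_expansion :: "nat \<Rightarrow> complex \<Rightarrow> complex \<Rightarrow> complex \<Rightarrow> complex" where
  "log_expansion m a b z = hyp_F m a b z * Ln z + polar_part m a b z + log_series m a b z"

theorem hyp_U_eq_log_expansion:
  assumes "a \<notin> \<int>" "b \<notin> \<int>" "z \<in> cut_plane \<inter> ball 0 1"
  shows "hyp_U m a b z = log_expansion m a b z"
proof (rule raise_identity[of "cut_plane \<inter> ball 0 1" hyp_U log_expansion, OF _ _ _ _ assms])
  fix m :: nat and a b z :: complex assume ab: "a \<notin> \<int>" "b \<notin> \<int>" and z: "z \<in> cut_plane \<inter> ball 0 1"
  show "hyp_U 0 a b z = log_expansion 0 a b z"
    unfolding U0_eq_log_sol[OF ab z] by (simp add: log_expansion_def log_sol_def polar_part_def)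
  show "(hyp_U m a b has_field_derivative (a * b / (of_nat m + 1)) * hyp_U (Suc m) (a + 1) (b + 1) z) (at z)"
    using z by (intro DERIV_hyp_U cut_planeD(1)) (simp add: one_minus_cut_plane)
  have z': "z \<in> slit_plane" "z \<notin> \<real>\<^sub>\<le>\<^sub>0" "z \<noteq> 0" using z by (auto dest: cut_planeD)
  have L: "(Ln has_field_derivative 1 / z) (at z)" using has_field_derivative_Ln[OF z'(2)] by (simp add: inverse_eq_divide)
  have z_ball: "z \<in> ball 0 1" using z by simp
  let ?q = "a * b / (of_nat m + 1)"
  have "((\<lambda>z. hyp_F m a b z * Ln z + polar_part m a b z + log_series m a b z) has_field_derivative
      (?q * hyp_F (Suc m) (a + 1) (b + 1) z * Ln z + 1 / z * hyp_F m a b z) + (?q * polar_part (Suc m) (a + 1) (b + 1) z - 1 / z)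
       + (?q * log_series (Suc m) (a + 1) (b + 1) z - (hyp_F m a b z - 1) / z)) (at z)"
    by (intro DERIV_add DERIV_mult DERIV_hyp_F DERIV_polar_part DERIV_log_series L z' ab z_ball)
  thus "(log_expansion m a b has_field_derivative ?q * log_expansion (Suc m) (a + 1) (b + 1) z) (at z)"
    unfolding log_expansion_def [abs_def]
    by (rule DERIV_cong) (simp add: ring_distribs diff_divide_distrib)
qed auto

section \<open>Connection formulas\<close>

lemma hyp_ode_extend:
  assumes u: "hyp_ode a b c N u" and N: "open N" "N \<noteq> {}" "N \<subseteq> D"
    and D: "open D" "connected D" and v: "v holomorphic_on D" and eq: "\<And>z. z \<in> N \<Longrightarrow> u z = v z"
  shows "hyp_ode a b c D v"
proof -
  have vN: "hyp_ode a b c N v" by (rule hyp_ode_cong[OF u N(1) eq])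
  show ?thesis unfolding hyp_ode_def
  proof (intro conjI ballI v)
    fix z assume z: "z \<in> D"
    show "z * (1 - z) * deriv (deriv v) z + (c - (a + b + 1) * z) * deriv v z - a * b * v z = 0"
    proof (rule analytic_continuation_open[of N D "\<lambda>z. z * (1 - z) * deriv (deriv v) z + (c - (a + b + 1) * z) * deriv v z - a * b * v z" "\<lambda>_. 0"])
      show "(\<lambda>z. z * (1 - z) * deriv (deriv v) z + (c - (a + b + 1) * z) * deriv v z - a * b * v z) holomorphic_on D"
        by (intro holomorphic_intros holomorphic_deriv v D)
    qed (use N D z vN in \<open>auto simp: hyp_ode_def\<close>)
  qed
qed

lemma sin_pi_nonzero:
  assumes "a \<notin> \<int>"
  shows "sin (of_real pi * a) \<noteq> (0 :: complex)"
proof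
  assume "sin (of_real pi * a) = 0"
  then obtain n :: int where "of_real pi * a = of_real (real_of_int n * pi)" by (auto simp: sin_eq_0)
  hence "a = of_int n" by simp
  thus False using assms by auto
qed

lemma Digamma_reflection:
  fixes a :: complex
  assumes a: "a \<notin> \<int>"
  shows "Digamma (1 - a) - Digamma a = of_real pi * cos (of_real pi * a) / sin (of_real pi * a)"
proof -
  have a': "a \<notin> \<int>\<^sub>\<le>\<^sub>0" "1 - a \<notin> \<int>\<^sub>\<le>\<^sub>0"
    using a nonint_nonpole[of a] nonint_nonpole[of "1 - a"] by (metis Ints_1 Ints_diff diff_diff_eq2 add_diff_cancel_left')+
  have "((\<lambda>z. rGamma z * rGamma (1 - z)) has_field_derivative rGamma a * rGamma (1 - a) * (Digamma (1 - a) - Digamma a)) (at a)"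
    using a' by (auto intro!: derivative_eq_intros simp: algebra_simps)
  moreover have "(\<lambda>z::complex. rGamma z * rGamma (1 - z)) = (\<lambda>z. sin (of_real pi * z) / of_real pi)"
    by (rule ext) (rule rGamma_reflection_complex)
  moreover have "((\<lambda>z. sin (of_real pi * z) / of_real pi) has_field_derivative cos (of_real pi * a)) (at a)"
    by (auto intro!: derivative_eq_intros)
  ultimately have "rGamma a * rGamma (1 - a) * (Digamma (1 - a) - Digamma a) = cos (of_real pi * a)"
    using DERIV_unique by metis
  thus ?thesis unfolding rGamma_reflection_complex using sin_pi_nonzero[OF a] by (simp add: field_simps)
qed

lemma nonint_one_minus: "a \<notin> \<int> \<Longrightarrow> (of_nat m + 1 - a :: complex) \<notin> \<int>"
proof
  assume "of_nat m + 1 - a \<in> \<int>"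
  hence "of_nat m + 1 - (of_nat m + 1 - a) \<in> \<int>" by (rule Ints_diff[OF Ints_add[OF Ints_of_nat Ints_1]])
  moreover have "of_nat m + 1 - (of_nat m + 1 - a) = a" by simp
  moreover assume "a \<notin> \<int>"
  ultimately show False by metis
qed

lemma hyp_F_Euler:
  assumes "z \<in> slit_plane"
  shows "hyp_F m a b z = (1 - z) powr (of_nat m + 1 - a - b) * hyp_F m (of_nat m + 1 - a) (of_nat m + 1 - b) z"
proof -
  have "of_nat m + 1 \<notin> (\<int>\<^sub>\<le>\<^sub>0 :: complex set)" by (auto dest!: nonpos_Ints_Re)
  from reg_hyp_Euler[OF this assms, of a b] show ?thesis by (simp add: hyp_F_def)
qed

lemma hyp_F_Pfaff:
  assumes "z \<in> slit_plane"
  shows "hyp_F m a b z = (1 - z) powr (- a) * hyp_F m a (of_nat m + 1 - b) (z / (z - 1))"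
  using reg_hyp_Pfaff[OF assms, of a b "of_nat m + 1"] by (simp add: hyp_F_def)

text \<open>
  The Kummer solution with exponent \<open>m + 1 - a - b\<close> at \<open>z = 1\<close>, with the factor that it has next to \<open>U\<^sub>1\<close>.
\<close>
definition hyp_W :: "nat \<Rightarrow> complex \<Rightarrow> complex \<Rightarrow> complex \<Rightarrow> complex" where
  "hyp_W m a b z = (-1) ^ (m + 1) * fact m * (Gamma (1 - a) * Gamma (1 - b))
                * (1 - z) powr (of_nat m + 1 - a - b)
                * reg_hyp (of_nat m + 1 - a) (of_nat m + 1 - b) (of_nat m + 2 - a - b) (1 - z)"

text \<open>
  The functions \<open>hyp_W\<close> and \<open>hyp_U\<close> are exchanged by Euler's transformation, that is, by \<open>a \<mapsto> m + 1 - a\<close> and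
  \<open>b \<mapsto> m + 1 - b\<close>.
\<close>
lemma hyp_W_eq: "hyp_W m a b z = (1 - z) powr (of_nat m + 1 - a - b) * hyp_U m (of_nat m + 1 - a) (of_nat m + 1 - b) z"
proof -
  have e: "of_nat m + 1 - a - of_nat m = 1 - a" "of_nat m + 1 - b - of_nat m = 1 - b"
     "of_nat m + 1 - a + (of_nat m + 1 - b) - of_nat m = of_nat m + 2 - a - b" by simp_all
  show ?thesis unfolding hyp_W_def hyp_U_def e by (simp only: mult_ac)
qed

lemma DERIV_powr_reg_hyp:
  assumes x: "x \<in> slit_plane" "x \<notin> \<real>\<^sub>\<le>\<^sub>0"
  shows "((\<lambda>x. x powr c * reg_hyp a b (c + 1) x) has_field_derivative x powr (c - 1) * reg_hyp a b c x) (at x)"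
proof -
  have nz: "x \<noteq> 0" using x by auto
  have R: "(reg_hyp a b (c + 1) has_field_derivative deriv (reg_hyp a b (c + 1)) x) (at x)"
    by (rule holomorphic_derivI[OF holomorphic_reg_hyp open_slit_plane x(1)])
  have P: "((\<lambda>x. x powr c) has_field_derivative c * x powr (c - 1)) (at x)"
    by (rule has_field_derivative_powr[OF x(2)])
  have p: "x powr c = x powr (c - 1) * x" using nz by (simp add: powr_diff)
  show ?thesis
    by (rule DERIV_mult[OF P R, THEN DERIV_cong]) (simp add: p reg_hyp_lower_c[OF x(1), of a b c, symmetric] algebra_simps)
qed

lemma DERIV_hyp_W:
  assumes ab: "a \<notin> \<int>" "b \<notin> \<int>" and z: "z \<in> cut_plane"
  shows "(hyp_W m a b has_field_derivative (a * b / (of_nat m + 1)) * hyp_W (Suc m) (a + 1) (b + 1) z) (at z)"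
proof -
  define K where "K = (-1) ^ (m + 1) * fact m * (Gamma (1 - a) * Gamma (1 - b))"
  define c where "c = of_nat m + 1 - a - b"
  have x: "1 - z \<in> slit_plane" "1 - z \<notin> \<real>\<^sub>\<le>\<^sub>0"
    using z one_minus_cut_plane[of z] by (auto dest: cut_planeD)
  have nz: "of_nat m + 1 \<noteq> (0::complex)" by (auto simp: complex_eq_iff)
  have W: "hyp_W m a b = (\<lambda>z. K * ((1 - z) powr c * reg_hyp (of_nat m + 1 - a) (of_nat m + 1 - b) (c + 1) (1 - z)))"
  proof
    fix z
    have "of_nat m + 2 - a - b = c + 1" by (simp add: c_def)
    thus "hyp_W m a b z = K * ((1 - z) powr c * reg_hyp (of_nat m + 1 - a) (of_nat m + 1 - b) (c + 1) (1 - z))"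
      unfolding hyp_W_def K_def c_def by (simp only: mult.assoc)
  qed
  have e: "of_nat m + 1 - a - (b + 1) = c - 1" "of_nat (Suc m) + 1 - (a + 1) = of_nat m + 1 - a"
    "of_nat (Suc m) + 1 - (b + 1) = of_nat m + 1 - b" "of_nat (Suc m) + 2 - (a + 1) - (b + 1) = c"
    "1 - (a + 1) = - a" "1 - (b + 1) = - b"
    by (simp_all add: c_def)
  have f: "fact (Suc m) = (of_nat m + 1) * (fact m :: complex)" by simp
  have G: "Gamma (1 - x) = - x * Gamma (- x)" if "x \<notin> \<int>" for x :: complex
  proof -
    have "- x \<notin> \<int>\<^sub>\<le>\<^sub>0" using that nonint_nonpole[of "- x"] by (metis Ints_minus minus_minus)
    from Gamma_plus1[OF this] show ?thesis by (simp add: add.commute)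
  qed
  have W2: "(a * b / (of_nat m + 1)) * hyp_W (Suc m) (a + 1) (b + 1) z = - (K * ((1 - z) powr (c - 1) * reg_hyp (of_nat m + 1 - a) (of_nat m + 1 - b) c (1 - z)))"
    unfolding hyp_W_def e f K_def G[OF ab(1)] G[OF ab(2)] using nz by simp
  have "((\<lambda>z. (1 - z) powr c * reg_hyp (of_nat m + 1 - a) (of_nat m + 1 - b) (c + 1) (1 - z)) has_field_derivative
      (1 - z) powr (c - 1) * reg_hyp (of_nat m + 1 - a) (of_nat m + 1 - b) c (1 - z) * (- 1)) (at z)"
    by (rule DERIV_chain2[where g = "\<lambda>z. 1 - z", OF DERIV_powr_reg_hyp[OF x]]) (auto intro!: derivative_eq_intros)
  from DERIV_cmult[OF this, of K] show ?thesis unfolding W W2[unfolded W] W2 by (simp add: W2[symmetric])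
qed

text \<open>
  The Kummer solution with exponent \<open>a\<close> at \<open>z = \<infinity>\<close>, with the factor that it has next to \<open>U\<^sub>1\<close>.
\<close>
definition hyp_V :: "nat \<Rightarrow> complex \<Rightarrow> complex \<Rightarrow> complex \<Rightarrow> complex" where
  "hyp_V m a b z = (-1) ^ (m + 1) * fact m * (Gamma (a - of_nat m) * Gamma (1 - b))
                * (- z) powr (- a) * reg_hyp a (a - of_nat m) (1 + a - b) (1 / z)"

lemma upper_half_plane_facts:
  assumes z: "z \<in> upper_half_plane"
  shows "z \<in> cut_plane" and "1 / z \<in> slit_plane" and "- z \<notin> \<real>\<^sub>\<le>\<^sub>0" and "z / (z - 1) \<in> cut_plane"
    and "1 - 1 / z \<noteq> 0" and "Im (z / (1 - z)) > 0"
proof -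
  have im: "Im z > 0" using z by (simp add: upper_half_plane_def)
  show "z \<in> cut_plane" using im by (simp add: cut_plane_iff)
  have nz: "z \<noteq> 0" "z \<noteq> 1" using im by auto
  have "Im (1 / z) < 0" using im nz by (simp add: Im_divide_Reals Im_divide divide_neg_pos sum_power2_gt_zero_iff complex_eq_iff)
  thus "1 / z \<in> slit_plane" by (auto simp: slit_plane_iff complex_nonpos_Reals_iff)
  show "- z \<notin> \<real>\<^sub>\<le>\<^sub>0" using im by (auto simp: complex_nonpos_Reals_iff)
  show "1 - 1 / z \<noteq> 0" using nz by simp
  have "Im (1 / (1 - z)) > 0" using im nz by (simp add: Im_divide sum_power2_gt_zero_iff complex_eq_iff)
  moreover have "z / (1 - z) = 1 / (1 - z) - 1" using nz by (simp add: field_simps)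
  ultimately show *: "Im (z / (1 - z)) > 0" by simp
  have "z / (z - 1) = - (z / (1 - z))" using nz by (simp add: divide_simps) (simp add: algebra_simps)
  thus "z / (z - 1) \<in> cut_plane" using * by (simp add: cut_plane_iff)
qed

lemma open_upper_half_plane: "open upper_half_plane" "connected upper_half_plane"
  using open_halfspace_Im_gt[of 0] convex_halfspace_Im_gt[of 0] by (auto simp: upper_half_plane_def intro: convex_connected)

lemma DERIV_hyp_V:
  assumes ab: "a \<notin> \<int>" "b \<notin> \<int>" and z: "z \<in> upper_half_plane"
  shows "(hyp_V m a b has_field_derivative (a * b / (of_nat m + 1)) * hyp_V (Suc m) (a + 1) (b + 1) z) (at z)"
proof -
  define K where "K = (-1) ^ (m + 1) * fact m * (Gamma (a - of_nat m) * Gamma (1 - b))"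
  define f where "f = reg_hyp a (a - of_nat m) (1 + a - b)"
  note zf = upper_half_plane_facts[OF z]
  have nz: "z \<noteq> 0" using zf(1) by (auto dest: cut_planeD)
  have nzm: "of_nat m + 1 \<noteq> (0::complex)" by (auto simp: complex_eq_iff)
  have V: "hyp_V m a b = (\<lambda>z. K * ((- z) powr (- a) * f (1 / z)))"
    by (rule ext) (simp only: hyp_V_def K_def f_def mult.assoc)
  have f1: "(f has_field_derivative deriv f (1 / z)) (at (1 / z))"
    unfolding f_def by (rule holomorphic_derivI[OF holomorphic_reg_hyp open_slit_plane zf(2)])
  have d1: "((\<lambda>z. f (1 / z)) has_field_derivative deriv f (1 / z) * (- 1 / z ^ 2)) (at z)"
    by (rule DERIV_chain2[where g = "\<lambda>z. 1 / z", OF f1]) (use nz in \<open>auto intro!: derivative_eq_intros simp: power2_eq_square\<close>)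
  have d2: "((\<lambda>z. (- z) powr (- a)) has_field_derivative (- a * (- z) powr (- a - 1)) * (- 1)) (at z)"
    by (rule DERIV_chain2[where g = uminus, OF has_field_derivative_powr[OF zf(3)]]) (auto intro!: derivative_eq_intros)
  have p: "(- z) powr (- a) = (- z) powr (- a - 1) * (- z)" using nz by (simp add: powr_diff)
  have raise: "1 / z * deriv f (1 / z) + a * f (1 / z) = a * reg_hyp (a + 1) (a - of_nat m) (1 + a - b) (1 / z)"
    unfolding f_def by (rule reg_hyp_raise_a[OF zf(2)])
  have D: "((\<lambda>z. (- z) powr (- a) * f (1 / z)) has_field_derivative
     (- z) powr (- a - 1) * (a * reg_hyp (a + 1) (a - of_nat m) (1 + a - b) (1 / z))) (at z)"
    unfolding raise [symmetric]
    by (rule DERIV_mult[OF d2 d1, THEN DERIV_cong]) (use nz in \<open>simp add: p ring_distribs power2_eq_square mult_ac\<close>)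
  have e: "a + 1 - of_nat (Suc m) = a - of_nat m" "1 - (b + 1) = - b" "1 + (a + 1) - (b + 1) = 1 + a - b" "- (a + 1) = - a - 1"
    by simp_all
  have fa: "fact (Suc m) = (of_nat m + 1) * (fact m :: complex)" by simp
  have "- b \<notin> \<int>\<^sub>\<le>\<^sub>0" using ab(2) nonint_nonpole[of "- b"] by (metis Ints_minus minus_minus)
  from Gamma_plus1[OF this] have G: "Gamma (1 - b) = - b * Gamma (- b)" by (simp add: add.commute)
  have "(a * b / (of_nat m + 1)) * hyp_V (Suc m) (a + 1) (b + 1) z = K * ((- z) powr (- a - 1) * (a * reg_hyp (a + 1) (a - of_nat m) (1 + a - b) (1 / z)))"
    unfolding hyp_V_def e fa K_def G using nzm by simp
  with DERIV_cmult[OF D, of K] show ?thesis unfolding V by simp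
qed


lemma hyp_F_unique:
  assumes "hyp_ode a b 1 D u" "open D" "connected D" "0 \<in> D" "D \<subseteq> slit_plane" "z \<in> D"
  shows "u z = u 0 * hyp_F 0 a b z"
  using hyp_ode_unique_analytic[OF assms(1) _ assms(2-6)] by (simp add: hyp_F_def)

definition connection_const :: "complex \<Rightarrow> complex \<Rightarrow> complex" where
  "connection_const a b = of_real pi * sin (of_real pi * (a + b)) / (sin (of_real pi * a) * sin (of_real pi * b))"

lemma sin_cos_pi_shift:
  fixes a :: complex
  shows "sin (of_real pi * (a + 1)) = - sin (of_real pi * a)" "cos (of_real pi * (a + 1)) = - cos (of_real pi * a)"
  by (simp_all add: ring_distribs sin_add cos_add)

lemma connection_const_raise: "connection_const (a + 1) (b + 1) = connection_const a b"
proof -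
  have e: "a + 1 + (b + 1) = (a + b + 1) + 1" by simp
  show ?thesis unfolding connection_const_def e sin_cos_pi_shift by simp
qed

text \<open>
  The digamma terms that do not involve \<open>a\<close> or \<open>b\<close> cancel, and the reflection formula gives
  \<open>- \<pi> (cot \<pi>a + cot \<pi>b)\<close>.
\<close>
lemma psi_sum_reflection:
  assumes "a \<notin> \<int>" "b \<notin> \<int>"
  shows "psi_sum 0 a b 0 - psi_sum 0 (1 - a) (1 - b) 0 = - connection_const a b"
proof -
  have "psi_sum 0 a b 0 - psi_sum 0 (1 - a) (1 - b) 0 = - (Digamma (1 - a) - Digamma a) - (Digamma (1 - b) - Digamma b)"
    by (simp add: psi_sum_def)
  also have "\<dots> = - connection_const a b"
    unfolding Digamma_reflection[OF assms(1)] Digamma_reflection[OF assms(2)] connection_const_def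
    using sin_pi_nonzero[OF assms(1)] sin_pi_nonzero[OF assms(2)]
    by (simp add: ring_distribs sin_add divide_simps)
  finally show ?thesis .
qed

text \<open>
  By Euler's transformation the logarithmic terms of \<open>hyp_U\<close> and \<open>hyp_W\<close> agree.
\<close>
lemma U0_Euler_connection:
  assumes ab: "a \<notin> \<int>" "b \<notin> \<int>" and z: "z \<in> cut_plane"
  shows "hyp_U 0 a b z = hyp_W 0 a b z - connection_const a b * hyp_F 0 a b z"
proof -
  let ?p = "\<lambda>z. (1 - z) powr (1 - a - b)"
  have ni: "1 - a \<notin> \<int>" "1 - b \<notin> \<int>" using nonint_one_minus[of _ 0] ab by auto
  have W: "hyp_W 0 a b = (\<lambda>z. ?p z * hyp_U 0 (1 - a) (1 - b) z)" by (rule ext) (simp add: hyp_W_eq)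
  let ?A = "\<lambda>z. log_series 0 a b z - ?p z * log_series 0 (1 - a) (1 - b) z"
  let ?N = "cut_plane \<inter> ball 0 1"
  have eq: "1 * hyp_U 0 a b z + (-1) * hyp_W 0 a b z = ?A z" if z: "z \<in> ?N" for z
  proof -
    have zs: "z \<in> slit_plane" using z by (auto dest: cut_planeD)
    have "hyp_W 0 a b z = ?p z * hyp_F 0 (1 - a) (1 - b) z * Ln z + ?p z * log_series 0 (1 - a) (1 - b) z"
      unfolding W U0_eq_log_sol[OF ni z] log_sol_def by (simp add: ring_distribs)
    also have "?p z * hyp_F 0 (1 - a) (1 - b) z = hyp_F 0 a b z" using hyp_F_Euler[OF zs, of 0 a b] by simp
    finally show ?thesis unfolding U0_eq_log_sol[OF ab z] log_sol_def by simp
  qed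
  have "hyp_ode (1 - a) (1 - b) 1 cut_plane (hyp_U 0 (1 - a) (1 - b))" by (rule hyp_ode_U0)
  hence "hyp_ode a b 1 cut_plane (hyp_W 0 a b)" unfolding W
    by (rule hyp_ode_Euler_transform) (auto dest: cut_planeD)
  from hyp_ode_lincomb[OF hyp_ode_U0 this open_cut_plane, of 1 "-1"]
  have ode: "hyp_ode a b 1 cut_plane (\<lambda>z. 1 * hyp_U 0 a b z + (-1) * hyp_W 0 a b z)" .
  have AH: "?A holomorphic_on ball 0 1"
    using unit_ball_subset_slit_plane
    by (intro holomorphic_intros holomorphic_log_series ab ni) (auto simp: slit_plane_iff)
  have "hyp_ode a b 1 (ball 0 1) ?A"
    by (rule hyp_ode_extend[OF hyp_ode_subset[OF ode], of ?N]) (use half_ball_nonempty AH eq in auto)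
  from hyp_F_unique[OF this _ _ _ unit_ball_subset_slit_plane]
  have A: "?A z = ?A 0 * hyp_F 0 a b z" if "z \<in> ball 0 1" for z using that by simp
  have A0: "?A 0 = - connection_const a b"
    using psi_sum_reflection[OF ab] by (simp add: log_series_0 ab ni)
  show ?thesis
  proof (rule analytic_continuation_open[of ?N cut_plane "hyp_U 0 a b" "\<lambda>z. hyp_W 0 a b z - connection_const a b * hyp_F 0 a b z"])
    show "connected cut_plane" using connected_cut_plane_Int[of UNIV] by simp
    show "hyp_U 0 a b holomorphic_on cut_plane" using hyp_ode_U0[of a b] by (simp add: hyp_ode_def)
    show "(\<lambda>z. hyp_W 0 a b z - connection_const a b * hyp_F 0 a b z) holomorphic_on cut_plane"
      using \<open>hyp_ode a b 1 cut_plane (hyp_W 0 a b)\<close> holomorphic_on_subset[OF holomorphic_F, of cut_plane 0 a b]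
      by (intro holomorphic_intros) (auto simp: hyp_ode_def dest: cut_planeD)
    show "hyp_U 0 a b z = hyp_W 0 a b z - connection_const a b * hyp_F 0 a b z" if "z \<in> ?N" for z
    proof -
      have "hyp_U 0 a b z - hyp_W 0 a b z = ?A z" using eq[OF that] by simp
      also have "\<dots> = - connection_const a b * hyp_F 0 a b z" using A[of z] that unfolding A0 by simp
      finally show ?thesis by (simp add: algebra_simps)
    qed
  qed (use half_ball_nonempty z in auto)
qed

theorem Euler_connection:
  assumes "a \<notin> \<int>" "b \<notin> \<int>" "z \<in> cut_plane"
  shows "hyp_U m a b z = hyp_W m a b z - connection_const a b * hyp_F m a b z"
proof (rule raise_identity[of cut_plane hyp_U "\<lambda>m a b z. hyp_W m a b z - connection_const a b * hyp_F m a b z", OF _ _ _ _ assms])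
  fix m :: nat and a b z :: complex assume ab: "a \<notin> \<int>" "b \<notin> \<int>" and z: "z \<in> cut_plane"
  show "hyp_U 0 a b z = hyp_W 0 a b z - connection_const a b * hyp_F 0 a b z" by (rule U0_Euler_connection[OF ab z])
  show "(hyp_U m a b has_field_derivative (a * b / (of_nat m + 1)) * hyp_U (Suc m) (a + 1) (b + 1) z) (at z)"
    using z by (intro DERIV_hyp_U cut_planeD(1)) (simp add: one_minus_cut_plane)
  show "((\<lambda>z. hyp_W m a b z - connection_const a b * hyp_F m a b z) has_field_derivative
      (a * b / (of_nat m + 1)) * (hyp_W (Suc m) (a + 1) (b + 1) z - connection_const (a + 1) (b + 1) * hyp_F (Suc m) (a + 1) (b + 1) z)) (at z)"
    by (rule DERIV_diff[OF DERIV_hyp_W[OF ab z] DERIV_cmult[OF DERIV_hyp_F[OF cut_planeD(1)[OF z]]], THEN DERIV_cong])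
       (simp add: connection_const_raise right_diff_distrib mult_ac)
qed auto

text \<open>
  Each product rule for \<open>log\<close> used here has one factor in the upper and one in the lower half plane. Their
  arguments have a sum within \<open>(- \<pi>, \<pi>)\<close>, and no multiple of \<open>2 \<pi> i\<close> appears.
\<close>
lemma Ln_upper_half_plane:
  assumes z: "z \<in> upper_half_plane"
  shows "Ln (z / (1 - z)) = Ln z - Ln (1 - z)"
    and "Ln (z / (z - 1)) = Ln (z / (1 - z)) - \<i> * pi"
    and "Ln (1 - z) = Ln (- z) + Ln (1 - 1 / z)"
proof -
  have im: "Im z > 0" using z by (simp add: upper_half_plane_def)
  have nz: "z \<noteq> 0" "z \<noteq> 1" using im by auto
  let ?u = "z / (1 - z)"
  have u: "Im ?u > 0" "?u \<noteq> 0" using upper_half_plane_facts(6)[OF z] nz by auto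
  have lower: "Im (Ln w) < 0 \<and> - pi < Im (Ln w)" if "Im w < 0" for w
  proof -
    have "w \<noteq> 0" using that by auto
    hence "Im (Ln w) \<noteq> pi" using that by (metis Im_Ln_eq_pi less_irrefl)
    moreover have "\<not> 0 \<le> Im (Ln w)" using Im_Ln_pos_le[OF \<open>w \<noteq> 0\<close>] Im_Ln_le_pi[OF \<open>w \<noteq> 0\<close>] that by auto
    ultimately show ?thesis using mpi_less_Im_Ln[OF \<open>w \<noteq> 0\<close>] by auto
  qed
  have upper: "0 < Im (Ln w) \<and> Im (Ln w) < pi" if "Im w > 0" for w
  proof -
    have "w \<noteq> 0" using that by auto
    thus ?thesis using that Im_Ln_pos_lt[of w] by auto
  qed
  have z1: "1 - z \<noteq> 0" "Im (1 - z) < 0" using nz im by auto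
  have "Ln (?u * (1 - z)) = Ln ?u + Ln (1 - z)"
    using upper[OF u(1)] lower[OF z1(2)] by (intro Ln_times_simple u z1) auto
  moreover have "?u * (1 - z) = z" using z1 by simp
  ultimately show "Ln ?u = Ln z - Ln (1 - z)" by simp
  have "z / (z - 1) = - ?u" using nz by (simp add: divide_simps) (simp add: algebra_simps)
  thus "Ln (z / (z - 1)) = Ln ?u - \<i> * pi" using u by (simp add: Ln_minus)
  have i: "Im (1 - 1 / z) > 0" using im nz by (simp add: Im_divide sum_power2_gt_zero_iff complex_eq_iff divide_neg_pos)
  have m: "- z \<noteq> 0" "Im (- z) < 0" "1 - 1 / z \<noteq> 0" using nz im by auto
  have "Ln (- z * (1 - 1 / z)) = Ln (- z) + Ln (1 - 1 / z)"
    using upper[OF i] lower[OF m(2)] by (intro Ln_times_simple m) auto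
  moreover have "- z * (1 - 1 / z) = 1 - z" using nz by (simp add: right_diff_distrib)
  ultimately show "Ln (1 - z) = Ln (- z) + Ln (1 - 1 / z)" by simp
qed

text \<open>
  Pfaff's transformation in the variable \<open>1 / z\<close>, which is mapped to \<open>1 / (1 - z) = 1 - z / (z - 1)\<close>.
\<close>
lemma hyp_V_eq:
  assumes z: "z \<in> upper_half_plane"
  shows "hyp_V m a b z = (1 - z) powr (- a) * hyp_U m a (of_nat m + 1 - b) (z / (z - 1))"
proof -
  note zf = upper_half_plane_facts[OF z]
  have nz: "z \<noteq> 0" "z \<noteq> 1" using zf(1) by (auto dest: cut_planeD)
  have e: "of_nat m + 1 - b - of_nat m = 1 - b" "a + (of_nat m + 1 - b) - of_nat m = 1 + a - b"
    "1 + a - b - (a - of_nat m) = of_nat m + 1 - b" by simp_all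
  have w: "1 / z / (1 / z - 1) = 1 - z / (z - 1)" using nz by (simp add: divide_simps)
  have p: "(- z) powr (- a) * (1 - 1 / z) powr (- a) = (1 - z) powr (- a)"
    using nz zf(5) Ln_upper_half_plane(3)[OF z] by (simp add: powr_def ring_distribs flip: exp_add)
  have "hyp_V m a b z = (-1) ^ (m + 1) * fact m * (Gamma (a - of_nat m) * Gamma (1 - b)) * (- z) powr (- a)
      * ((1 - 1 / z) powr (- a) * reg_hyp a (of_nat m + 1 - b) (1 + a - b) (1 - z / (z - 1)))"
    unfolding hyp_V_def reg_hyp_Pfaff[OF zf(2), of a "a - of_nat m"] e w ..
  also have "\<dots> = ((- z) powr (- a) * (1 - 1 / z) powr (- a)) * ((-1) ^ (m + 1) * fact m * (Gamma (a - of_nat m) * Gamma (1 - b))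
      * reg_hyp a (of_nat m + 1 - b) (1 + a - b) (1 - z / (z - 1)))" by (simp only: mult_ac)
  finally show ?thesis unfolding p hyp_U_def e .
qed

definition infinity_const :: "complex \<Rightarrow> complex" where
  "infinity_const b = of_real pi * exp (- (\<i> * of_real pi * b)) / sin (of_real pi * b)"

lemma infinity_const_eq:
  assumes "b \<notin> \<int>"
  shows "infinity_const b = of_real pi * cos (of_real pi * b) / sin (of_real pi * b) - \<i> * of_real pi"
proof -
  have "exp (- (\<i> * of_real pi * b)) = exp (\<i> * (- (of_real pi * b)))" by (simp add: mult.assoc)
  also have "\<dots> = cos (of_real pi * b) - \<i> * sin (of_real pi * b)" unfolding exp_Euler by simp
  finally have e: "exp (- (\<i> * of_real pi * b)) = cos (of_real pi * b) - \<i> * sin (of_real pi * b)" .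
  show ?thesis unfolding infinity_const_def e using sin_pi_nonzero[OF assms]
    by (simp add: field_simps)
qed

lemma infinity_const_raise: "infinity_const (b + 1) = infinity_const b"
proof -
  have "exp (- (\<i> * of_real pi * (b + 1))) = exp (- (\<i> * of_real pi * b)) * exp (- (\<i> * of_real pi))"
    by (simp add: ring_distribs flip: exp_add)
  also have "exp (- (\<i> * of_real pi)) = -1" by (simp add: exp_minus)
  finally show ?thesis by (simp add: infinity_const_def sin_cos_pi_shift)
qed

lemma norm_Pfaff_map_less:
  fixes z :: complex
  assumes "norm z < 1 / 2"
  shows "norm (z / (z - 1)) < 1"
proof -
  have "norm (z - 1) \<ge> 1 - norm z" using norm_triangle_ineq2[of 1 z] by (simp add: norm_minus_commute)
  hence "norm z < norm (z - 1)" using assms by linarith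
  thus ?thesis by (simp add: norm_divide divide_simps split: if_splits)
qed

text \<open>
  By Pfaff's transformation the terms \<open>F log z\<close> of \<open>hyp_U\<close> and \<open>F log (z / (z - 1))\<close> of \<open>hyp_V\<close> differ by
  \<open>F (log (1 - z) + i \<pi>)\<close>, which is analytic at \<open>0\<close>. The comparison takes place on \<open>|z| < 1/2\<close>, where
  \<open>|z / (z - 1)| < 1\<close>.
\<close>
lemma U0_infinity_connection:
  assumes ab: "a \<notin> \<int>" "b \<notin> \<int>" and z: "z \<in> upper_half_plane"
  shows "hyp_U 0 a b z = hyp_V 0 a b z - infinity_const b * hyp_F 0 a b z"
proof -
  let ?w = "\<lambda>z::complex. z / (z - 1)"
  let ?p = "\<lambda>z. (1 - z) powr (- a)"
  let ?v = "\<lambda>z. ?p z * hyp_U 0 a (1 - b) (?w z)"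
  let ?B = "ball 0 (1 / 2) :: complex set"
  let ?N = "upper_half_plane \<inter> ?B"
  have ni: "1 - b \<notin> \<int>" using nonint_one_minus[of b 0] ab by simp
  have V: "hyp_V 0 a b z = ?v z" if "z \<in> upper_half_plane" for z using hyp_V_eq[OF that, of 0 a b] by simp
  have Bs: "?B \<subseteq> ball 0 1" "?B \<subseteq> slit_plane" using unit_ball_subset_slit_plane by auto
  let ?A = "\<lambda>z. log_series 0 a b z + hyp_F 0 a b z * (Ln (1 - z) + \<i> * pi) - ?p z * log_series 0 a (1 - b) (?w z)"
  have eq: "1 * hyp_U 0 a b z + (-1) * ?v z = ?A z" if z: "z \<in> ?N" for z
  proof -
    have zu: "z \<in> upper_half_plane" and zs: "z \<in> slit_plane" and zc: "z \<in> cut_plane \<inter> ball 0 1"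
      using z Bs upper_half_plane_facts(1)[of z] by auto
    have wc: "?w z \<in> cut_plane \<inter> ball 0 1"
      using upper_half_plane_facts(4)[OF zu] norm_Pfaff_map_less[of z] z by auto
    have "?v z = (?p z * hyp_F 0 a (1 - b) (?w z)) * Ln (?w z) + ?p z * log_series 0 a (1 - b) (?w z)"
      unfolding U0_eq_log_sol[OF ab(1) ni wc] log_sol_def by (simp add: ring_distribs)
    also have "?p z * hyp_F 0 a (1 - b) (?w z) = hyp_F 0 a b z" using hyp_F_Pfaff[OF zs, of 0 a b] by simp
    also have "Ln (?w z) = Ln z - Ln (1 - z) - \<i> * pi" using Ln_upper_half_plane(1,2)[OF zu] by simp
    finally show ?thesis unfolding U0_eq_log_sol[OF ab zc] log_sol_def by (simp add: algebra_simps)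
  qed
  have "hyp_ode a (1 - b) 1 cut_plane (hyp_U 0 a (1 - b))" by (rule hyp_ode_U0)
  hence ode_v: "hyp_ode a b 1 upper_half_plane ?v"
    by (rule hyp_ode_Pfaff_transform) (auto intro: open_upper_half_plane dest: upper_half_plane_facts cut_planeD)
  have ode_U: "hyp_ode a b 1 upper_half_plane (hyp_U 0 a b)"
    by (rule hyp_ode_subset[OF hyp_ode_U0]) (auto dest: upper_half_plane_facts)
  from hyp_ode_lincomb[OF ode_U ode_v open_upper_half_plane(1), of 1 "-1"]
  have ode: "hyp_ode a b 1 upper_half_plane (\<lambda>z. 1 * hyp_U 0 a b z + (-1) * ?v z)" .
  have AH: "?A holomorphic_on ?B"
  proof -
    have "(log_series 0 a (1 - b) \<circ> ?w) holomorphic_on ?B"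
    proof (rule holomorphic_on_compose_gen[OF _ holomorphic_log_series[OF ab(1) ni]])
      show "?w holomorphic_on ?B" using Bs by (intro holomorphic_intros) (auto simp: slit_plane_iff)
      show "?w ` ?B \<subseteq> ball 0 1" using norm_Pfaff_map_less by auto
    qed
    hence 1: "(\<lambda>z. log_series 0 a (1 - b) (?w z)) holomorphic_on ?B" by (simp add: o_def)
    have 2: "log_series 0 a b holomorphic_on ?B" "hyp_F 0 a b holomorphic_on ?B"
      using holomorphic_on_subset[OF holomorphic_log_series[OF ab] Bs(1)] holomorphic_on_subset[OF holomorphic_F Bs(2)] by auto
    show ?thesis using Bs by (intro holomorphic_intros 1 2) (auto simp: slit_plane_iff)
  qed
  have ne: "?N \<noteq> {}"
  proof -
    have "norm (\<i> / 4) < 1 / 2" by (simp add: norm_divide)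
    hence "\<i> / 4 \<in> ?N" by (simp add: upper_half_plane_def)
    thus ?thesis by blast
  qed
  have "hyp_ode a b 1 ?B ?A"
    by (rule hyp_ode_extend[OF hyp_ode_subset[OF ode], of ?N]) (use ne AH eq open_upper_half_plane in auto)
  from hyp_F_unique[OF this _ _ _ Bs(2)]
  have A: "?A z = ?A 0 * hyp_F 0 a b z" if "z \<in> ?B" for z using that by simp
  have A0: "?A 0 = - infinity_const b"
  proof -
    have "?A 0 = psi_sum 0 a b 0 - psi_sum 0 a (1 - b) 0 + \<i> * pi" by (simp add: log_series_0 ab ni hyp_F_0)
    also have "psi_sum 0 a b 0 - psi_sum 0 a (1 - b) 0 = - (Digamma (1 - b) - Digamma b)" by (simp add: psi_sum_def)
    finally show ?thesis unfolding Digamma_reflection[OF ab(2)] infinity_const_eq[OF ab(2)] by simp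
  qed
  have "hyp_U 0 a b z = ?v z - infinity_const b * hyp_F 0 a b z"
  proof (rule analytic_continuation_open[of ?N upper_half_plane "hyp_U 0 a b" "\<lambda>z. ?v z - infinity_const b * hyp_F 0 a b z"])
    show "hyp_U 0 a b holomorphic_on upper_half_plane" using ode_U by (simp add: hyp_ode_def)
    have "hyp_F 0 a b holomorphic_on upper_half_plane"
      by (rule holomorphic_on_subset[OF holomorphic_F]) (auto dest: upper_half_plane_facts cut_planeD)
    thus "(\<lambda>z. ?v z - infinity_const b * hyp_F 0 a b z) holomorphic_on upper_half_plane"
    proof -
      assume F: "hyp_F 0 a b holomorphic_on upper_half_plane"
      have "?v holomorphic_on upper_half_plane" using ode_v unfolding hyp_ode_def by (rule conjunct1)
      thus ?thesis by (rule holomorphic_on_diff) (rule holomorphic_on_mult[OF holomorphic_on_const F])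
    qed
    show "hyp_U 0 a b z = ?v z - infinity_const b * hyp_F 0 a b z" if "z \<in> ?N" for z
    proof -
      have "hyp_U 0 a b z - ?v z = ?A z" using eq[OF that] by simp
      also have "\<dots> = - infinity_const b * hyp_F 0 a b z" using A[of z] that unfolding A0 by simp
      finally show ?thesis by (simp add: algebra_simps)
    qed
  qed (use ne z open_upper_half_plane in auto)
  thus ?thesis unfolding V[OF z] .
qed

theorem infinity_connection:
  assumes "a \<notin> \<int>" "b \<notin> \<int>" "z \<in> upper_half_plane"
  shows "hyp_U m a b z = hyp_V m a b z - infinity_const b * hyp_F m a b z"
proof (rule raise_identity[of upper_half_plane hyp_U "\<lambda>m a b z. hyp_V m a b z - infinity_const b * hyp_F m a b z", OF _ _ _ _ assms])
  fix m :: nat and a b z :: complex assume ab: "a \<notin> \<int>" "b \<notin> \<int>" and z: "z \<in> upper_half_plane"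
  note zc = upper_half_plane_facts(1)[OF z]
  show "hyp_U 0 a b z = hyp_V 0 a b z - infinity_const b * hyp_F 0 a b z" by (rule U0_infinity_connection[OF ab z])
  show "(hyp_U m a b has_field_derivative (a * b / (of_nat m + 1)) * hyp_U (Suc m) (a + 1) (b + 1) z) (at z)"
    using zc by (intro DERIV_hyp_U cut_planeD(1)) (simp add: one_minus_cut_plane)
  show "((\<lambda>z. hyp_V m a b z - infinity_const b * hyp_F m a b z) has_field_derivative
      (a * b / (of_nat m + 1)) * (hyp_V (Suc m) (a + 1) (b + 1) z - infinity_const (b + 1) * hyp_F (Suc m) (a + 1) (b + 1) z)) (at z)"
    by (rule DERIV_diff[OF DERIV_hyp_V[OF ab z] DERIV_cmult[OF DERIV_hyp_F[OF cut_planeD(1)[OF zc]]], THEN DERIV_cong])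
       (simp add: infinity_const_raise right_diff_distrib mult_ac)
qed (use open_upper_half_plane in auto)

section \<open>The logarithmic expansions on the upper half plane\<close>

text \<open>
  Defined as what \<open>U\<^sub>1\<close> leaves over, the remainder is holomorphic on the whole cut plane, and it equals the
  power series with the digamma factors on the unit disc. It is thus the required continuation of that series.
\<close>
definition log_remainder :: "nat \<Rightarrow> complex \<Rightarrow> complex \<Rightarrow> complex \<Rightarrow> complex" where
  "log_remainder m a b z = hyp_U m a b z - hyp_F m a b z * Ln z - polar_part m a b z"

lemma holomorphic_log_remainder: "log_remainder m a b holomorphic_on cut_plane"
proof -
  have F: "hyp_F m a b holomorphic_on cut_plane"
    by (rule holomorphic_on_subset[OF holomorphic_F]) (auto dest: cut_planeD)
  have U: "hyp_U m a b holomorphic_on cut_plane"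
    unfolding hyp_U_def [abs_def] by (intro holomorphic_intros) (auto intro!: cut_planeD(1) simp: one_minus_cut_plane)
  show ?thesis unfolding log_remainder_def [abs_def] polar_part_def
    by (intro holomorphic_intros F U) (auto dest: cut_planeD)
qed

lemma log_remainder_sums:
  assumes ab: "a \<notin> \<int>" "b \<notin> \<int>" and z: "z \<in> cut_plane" "norm z < 1"
  shows "(\<lambda>k. F_coeff m a b k * psi_sum m a b k * z ^ k) sums log_remainder m a b z"
proof -
  have "log_remainder m a b z = log_series m a b z"
    using hyp_U_eq_log_expansion[OF ab, of z m] z by (simp add: log_remainder_def log_expansion_def)
  thus ?thesis using log_series_sums[OF ab z(2)] by simp
qed

lemma polar_part_altdef:
  assumes "z \<noteq> 0"
  shows "polar_part m a b z = polar_const m a b * z powi (- int m) * (\<Sum>k<m. pochhammer (a - of_nat m) k * pochhammer (b - of_nat m) k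
                          / (pochhammer (1 - of_nat m) k * fact k) * z ^ k)"
proof -
  have "z powi (int k - int m) = z powi (- int m) * z ^ k" for k
    using power_int_add[of z "- int m" "int k"] assms by (simp add: add.commute)
  thus ?thesis unfolding polar_part_def sum_distrib_left by (simp only: mult_ac)
qed

lemma polar_const_reflect:
  "polar_const m a (of_nat m + 1 - b) = (-1) ^ m * polar_const m a b"
  "polar_const m (of_nat m + 1 - a) (of_nat m + 1 - b) = polar_const m a b"
proof -
  have e: "1 - (of_nat m + 1 - x) = x - of_nat m" for x :: complex by simp
  have "(-1) ^ m * (-1) ^ m = (1::complex)" by (simp flip: power_mult_distrib)
  hence p: "x / ((-1) ^ m * y) = (-1) ^ m * (x / y)" for x y :: complex
    by (simp add: divide_simps mult_ac)
  show "polar_const m a (of_nat m + 1 - b) = (-1) ^ m * polar_const m a b"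
    unfolding polar_const_def e pochhammer_minus_of_nat
    by (simp only: mult.left_commute[of "pochhammer (1 - a) m" "(-1) ^ m"] p)
  have "(-1) ^ m * (pochhammer (1 - a) m) * ((-1) ^ m * pochhammer (1 - b) m) = pochhammer (1 - a) m * pochhammer (1 - b) m"
  proof -
    have "(-1) ^ m * (pochhammer (1 - a) m) * ((-1) ^ m * pochhammer (1 - b) m)
        = ((-1) ^ m * (-1) ^ m) * (pochhammer (1 - a) m * pochhammer (1 - b) m)" by (simp only: mult_ac)
    thus ?thesis unfolding \<open>(-1) ^ m * (-1) ^ m = (1::complex)\<close> by simp
  qed
  thus "polar_const m (of_nat m + 1 - a) (of_nat m + 1 - b) = polar_const m a b"
    unfolding polar_const_def e pochhammer_minus_of_nat by (simp only:)
qed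

lemma log_connection:
  assumes "z \<in> cut_plane"
  shows "hyp_U m a b z = hyp_F m a b z * Ln z + polar_const m a b * z powi (- int m) *
            (\<Sum>k<m. pochhammer (a - of_nat m) k * pochhammer (b - of_nat m) k / (pochhammer (1 - of_nat m) k * fact k) * z ^ k)
            + log_remainder m a b z"
  unfolding log_remainder_def polar_part_altdef[OF cut_planeD(3)[OF assms]] by simp

lemma log_connection_Euler:
  assumes ab: "a \<notin> \<int>" "b \<notin> \<int>" and z: "z \<in> cut_plane"
  shows "hyp_U m a b z = hyp_F m a b z * Ln z - connection_const a b * hyp_F m a b z
            + polar_const m a b * z powi (- int m) * (1 - z) powr (of_nat m + 1 - a - b) *
            (\<Sum>k<m. pochhammer (1 - a) k * pochhammer (1 - b) k / (pochhammer (1 - of_nat m) k * fact k) * z ^ k)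
            + (1 - z) powr (of_nat m + 1 - a - b) * log_remainder m (of_nat m + 1 - a) (of_nat m + 1 - b) z"
proof -
  let ?p = "(1 - z) powr (of_nat m + 1 - a - b)"
  let ?F = "hyp_F m (of_nat m + 1 - a) (of_nat m + 1 - b) z"
  have e: "of_nat m + 1 - a - of_nat m = 1 - a" "of_nat m + 1 - b - of_nat m = 1 - b" by simp_all
  have "hyp_U m a b z = ?p * hyp_U m (of_nat m + 1 - a) (of_nat m + 1 - b) z - connection_const a b * hyp_F m a b z"
    unfolding Euler_connection[OF ab z] hyp_W_eq ..
  also have "?p * hyp_U m (of_nat m + 1 - a) (of_nat m + 1 - b) z = (?p * ?F) * Ln z + polar_const m a b * z powi (- int m) * ?p *
            (\<Sum>k<m. pochhammer (1 - a) k * pochhammer (1 - b) k / (pochhammer (1 - of_nat m) k * fact k) * z ^ k)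
            + ?p * log_remainder m (of_nat m + 1 - a) (of_nat m + 1 - b) z"
    unfolding log_connection[OF z, of m "of_nat m + 1 - a" "of_nat m + 1 - b"] polar_const_reflect(2) e
    by (simp only: distrib_left mult_ac)
  also have "?p * ?F = hyp_F m a b z" using hyp_F_Euler[OF cut_planeD(1)[OF z], of m a b] by simp
  finally show ?thesis by simp
qed

lemma log_connection_Pfaff:
  fixes a b z :: complex
  assumes ab: "a \<notin> \<int>" "b \<notin> \<int>" and z: "z \<in> upper_half_plane"
  shows "hyp_U m a b z = hyp_F m a b z * Ln (z / (1 - z)) - pi / tan (pi * b) * hyp_F m a b z
            + polar_const m a b * z powi (- int m) * (1 - z) powr (of_nat m - a) *
            (\<Sum>k<m. pochhammer (a - of_nat m) k * pochhammer (1 - b) k / (pochhammer (1 - of_nat m) k * fact k) * (z ^ k / (z - 1) ^ k))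
            + (1 - z) powr (- a) * log_remainder m a (of_nat m + 1 - b) (z / (z - 1))"
proof -
  let ?w = "z / (z - 1)"
  let ?p = "(1 - z) powr (- a)"
  let ?F = "hyp_F m a (of_nat m + 1 - b) ?w"
  let ?S = "\<Sum>k<m. pochhammer (a - of_nat m) k * pochhammer (1 - b) k / (pochhammer (1 - of_nat m) k * fact k) * ?w ^ k"
  note zf = upper_half_plane_facts[OF z]
  have nz: "z \<noteq> 0" "1 - z \<noteq> 0" "z - 1 \<noteq> 0" using zf(1) by (auto dest: cut_planeD)
  have e: "of_nat m + 1 - b - of_nat m = 1 - b" by simp
  have w: "(-1) ^ m * ?w powi (- int m) = z powi (- int m) * (1 - z) ^ m"
  proof -
    have "(-1) ^ m * (z - 1) ^ m = (1 - z) ^ m" by (simp flip: power_mult_distrib)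
    thus ?thesis using nz by (simp add: power_int_minus power_divide field_simps)
  qed
  have p: "(1 - z) powr (of_nat m - a) = ?p * (1 - z) ^ m"
    using nz by (simp add: powr_diff powr_minus powr_nat' field_simps)
  have "hyp_U m a b z = ?p * hyp_U m a (of_nat m + 1 - b) ?w - infinity_const b * hyp_F m a b z"
    unfolding infinity_connection[OF ab z] hyp_V_eq[OF z] ..
  also have "?p * hyp_U m a (of_nat m + 1 - b) ?w = (?p * ?F) * Ln ?w
      + polar_const m a b * ((-1) ^ m * ?w powi (- int m)) * ?p * ?S + ?p * log_remainder m a (of_nat m + 1 - b) ?w"
    unfolding log_connection[OF zf(4), of m a "of_nat m + 1 - b"] polar_const_reflect(1) e
    by (simp only: distrib_left mult_ac)
  also have "?p * ?F = hyp_F m a b z" using hyp_F_Pfaff[OF cut_planeD(1)[OF zf(1)], of m a b] by simp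
  also have "Ln ?w = Ln (z / (1 - z)) - \<i> * pi" by (rule Ln_upper_half_plane(2)[OF z])
  also have "infinity_const b = pi / tan (pi * b) - \<i> * pi"
    unfolding infinity_const_eq[OF ab(2)] by (simp add: tan_def)
  also have "polar_const m a b * ((-1) ^ m * ?w powi (- int m)) * ?p * ?S
     = polar_const m a b * z powi (- int m) * (1 - z) powr (of_nat m - a) * ?S"
    unfolding w p by (simp only: mult_ac)
  finally have eq: "hyp_U m a b z = hyp_F m a b z * (Ln (z / (1 - z)) - \<i> * pi)
      + polar_const m a b * z powi (- int m) * (1 - z) powr (of_nat m - a) * ?S
      + ?p * log_remainder m a (of_nat m + 1 - b) ?w - (pi / tan (pi * b) - \<i> * pi) * hyp_F m a b z" .
  have "f * (l - i) + A + B - (t - i) * f = f * l - t * f + A + B" for f l i A B t :: complex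
    by (simp add: algebra_simps)
  thus ?thesis unfolding eq power_divide .
qed

lemma hyp2f1_eq_hyp_F:
  assumes "z \<in> slit_plane"
  shows "hyp2f1 a b (of_nat m + 1) z = hyp_F m a b z"
proof -
  have "of_nat m + 1 \<notin> (\<int>\<^sub>\<le>\<^sub>0 :: complex set)" by (auto dest!: nonpos_Ints_Re)
  moreover have "Gamma (of_nat m + 1) = (fact m :: complex)" using Gamma_fact[of m] by (simp add: add.commute)
  ultimately show ?thesis using assms by (simp add: hyp2f1_eq_reg_hyp hyp_F_def)
qed

lemma log_remainder_continues:
  assumes ab: "a \<notin> \<int>" "b \<notin> \<int>"
    and g: "g holomorphic_on upper_half_plane" "g ` upper_half_plane \<subseteq> cut_plane"
  shows "continues_series (\<lambda>k z. F_coeff m a b k * psi_sum m a b k * g z ^ k)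
           {z\<in>upper_half_plane. norm (g z) < 1} upper_half_plane (\<lambda>z. log_remainder m a b (g z))"
  unfolding continues_series_def
proof (intro conjI ballI)
  show "(\<lambda>z. log_remainder m a b (g z)) holomorphic_on upper_half_plane"
    using holomorphic_on_compose_gen[OF g(1) holomorphic_log_remainder g(2)] by (simp add: o_def)
  fix z assume "z \<in> {z\<in>upper_half_plane. norm (g z) < 1}"
  thus "(\<lambda>k. F_coeff m a b k * psi_sum m a b k * g z ^ k) sums log_remainder m a b (g z)"
    using g(2) by (intro log_remainder_sums ab) auto
qed

text \<open>
  In each logarithmic formula the witness for the continued series is \<^const>\<open>log_remainder\<close> with the
  parameters, and in the last one the argument, of the transformed function.
\<close>
theorem theorem5p1:
  fixes m :: nat and a b :: complex
  assumes "a \<notin> \<int>" and "b \<notin> \<int>"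
  defines "U1 \<equiv> \<lambda>z. (-1) ^ (m + 1) * fact m * (Gamma (a - of_nat m) * Gamma (b - of_nat m))
                     * hyp2f1_over_Gamma a b (a + b - of_nat m) (1 - z)"
      and "F \<equiv> hyp2f1 a b (of_nat m + 1)"
      and "C \<equiv> (-1) ^ (m + 1) * fact m * fact (m - 1)
                 / (pochhammer (1 - a) m * pochhammer (1 - b) m)"
  shows
    "(\<forall>z\<in>upper_half_plane.
       U1 z = (-1) ^ (m + 1) * fact m * (Gamma (1 - a) * Gamma (1 - b))
                * (1 - z) powr (of_nat m + 1 - a - b)
                * hyp2f1_over_Gamma (of_nat m + 1 - a) (of_nat m + 1 - b)
                                    (of_nat m + 2 - a - b) (1 - z)
              - pi * sin (pi * (a + b)) / (sin (pi * a) * sin (pi * b)) * F z)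
   \<and> (\<forall>z\<in>upper_half_plane.
       U1 z = (-1) ^ (m + 1) * fact m * (Gamma (a - of_nat m) * Gamma (1 - b))
                * (- z) powr (- a)
                * hyp2f1_over_Gamma a (a - of_nat m) (1 + a - b) (1 / z)
              - pi * exp (- (\<i> * pi * b)) / sin (pi * b) * F z)
   \<and> (\<exists>S. continues_series
           (\<lambda>k z. pochhammer a k * pochhammer b k / (pochhammer (of_nat m + 1) k * fact k)
                  * (Digamma (a + of_nat k) + Digamma (b + of_nat k)
                     - Digamma (of_nat m + of_nat k + 1) - Digamma (of_nat k + 1)) * z ^ k)
           {z\<in>upper_half_plane. norm z < 1} upper_half_plane S \<and>
         (\<forall>z\<in>upper_half_plane.
            U1 z = F z * Ln z
              + C * z powi (- int m)
                * (\<Sum>k<m. pochhammer (a - of_nat m) k * pochhammer (b - of_nat m) k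
                          / (pochhammer (1 - of_nat m) k * fact k) * z ^ k)
              + S z))
   \<and> (\<exists>S. continues_series
           (\<lambda>k z. pochhammer (of_nat m + 1 - a) k * pochhammer (of_nat m + 1 - b) k
                    / (pochhammer (of_nat m + 1) k * fact k)
                  * (Digamma (of_nat m + of_nat k + 1 - a) + Digamma (of_nat m + of_nat k + 1 - b)
                     - Digamma (of_nat m + of_nat k + 1) - Digamma (of_nat k + 1)) * z ^ k)
           {z\<in>upper_half_plane. norm z < 1} upper_half_plane S \<and>
         (\<forall>z\<in>upper_half_plane.
            U1 z = F z * Ln z
              - pi * sin (pi * (a + b)) / (sin (pi * a) * sin (pi * b)) * F z
              + C * z powi (- int m) * (1 - z) powr (of_nat m + 1 - a - b)
                * (\<Sum>k<m. pochhammer (1 - a) k * pochhammer (1 - b) k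
                          / (pochhammer (1 - of_nat m) k * fact k) * z ^ k)
              + (1 - z) powr (of_nat m + 1 - a - b) * S z))
   \<and> (\<exists>S. continues_series
           (\<lambda>k z. pochhammer a k * pochhammer (of_nat m + 1 - b) k
                    / (pochhammer (of_nat m + 1) k * fact k)
                  * (Digamma (a + of_nat k) + Digamma (of_nat m + of_nat k + 1 - b)
                     - Digamma (of_nat m + of_nat k + 1) - Digamma (of_nat k + 1))
                  * (z ^ k / (z - 1) ^ k))
           {z\<in>upper_half_plane. norm (z / (z - 1)) < 1} upper_half_plane S \<and>
         (\<forall>z\<in>upper_half_plane.
            U1 z = F z * Ln (z / (1 - z))
              - pi / tan (pi * b) * F z
              + C * z powi (- int m) * (1 - z) powr (of_nat m - a)
                * (\<Sum>k<m. pochhammer (a - of_nat m) k * pochhammer (1 - b) k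
                          / (pochhammer (1 - of_nat m) k * fact k) * (z ^ k / (z - 1) ^ k))
              + (1 - z) powr (- a) * S z))"
proof -
  have slit: "z \<in> slit_plane" "1 - z \<in> slit_plane" if "z \<in> upper_half_plane" for z
    by (rule cut_planeD(1), simp only: one_minus_cut_plane upper_half_plane_facts(1)[OF that])+
  have U1: "U1 z = hyp_U m a b z" and F: "F z = hyp_F m a b z" if "z \<in> upper_half_plane" for z
    unfolding U1_def hyp_U_def F_def
    by (simp_all only: hyp2f1_over_Gamma_eq_reg_hyp[OF slit(2)[OF that]] hyp2f1_eq_hyp_F[OF slit(1)[OF that]])
  have C: "C = polar_const m a b" unfolding C_def polar_const_def ..
  have cc: "pi * sin (pi * (a + b)) / (sin (pi * a) * sin (pi * b)) = connection_const a b"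
    unfolding connection_const_def by simp
  have ic: "pi * exp (- (\<i> * pi * b)) / sin (pi * b) = infinity_const b"
    by (simp add: infinity_const_def)
  have ab': "of_nat m + 1 - a \<notin> \<int>" "of_nat m + 1 - b \<notin> \<int>"
    using assms(1,2) by (auto intro: nonint_one_minus)
  have UHP: "upper_half_plane \<subseteq> cut_plane" by (rule subsetI) (rule upper_half_plane_facts(1))
  have shift: "of_nat m + 1 - x + of_nat k = of_nat m + of_nat k + 1 - x" for x :: complex and k by simp

  have "(\<lambda>z. z) ` upper_half_plane \<subseteq> cut_plane" using UHP by simp
  note id = log_remainder_continues[OF _ _ holomorphic_on_ident this, of _ _ m, unfolded F_coeff_def psi_sum_def]
  have "(\<lambda>z. z / (z - 1)) holomorphic_on upper_half_plane" "(\<lambda>z. z / (z - 1)) ` upper_half_plane \<subseteq> cut_plane"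
    using UHP upper_half_plane_facts(4) by (auto intro!: holomorphic_intros dest: cut_planeD)
  note Pfaff = log_remainder_continues[OF _ _ this, of _ _ m, unfolded F_coeff_def psi_sum_def power_divide]

  show ?thesis
    apply (intro conjI)
    subgoal by (rule ballI) (simp only: U1 F cc slit hyp2f1_over_Gamma_eq_reg_hyp upper_half_plane_facts(1)
          Euler_connection[OF assms(1,2)] hyp_W_def)
    subgoal by (rule ballI) (simp only: U1 F ic hyp2f1_over_Gamma_eq_reg_hyp upper_half_plane_facts(2)
          infinity_connection[OF assms(1,2)] hyp_V_def)
    subgoal by (rule exI, rule conjI, rule id[OF assms(1,2)], rule ballI, simp only: U1 F C,
          rule log_connection, erule upper_half_plane_facts(1))
    subgoal by (rule exI, rule conjI, rule id[OF ab', unfolded shift], rule ballI, simp only: U1 F C cc,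
          rule log_connection_Euler[OF assms(1,2)], erule upper_half_plane_facts(1))
    subgoal by (rule exI, rule conjI, rule Pfaff[OF assms(1) ab'(2), unfolded shift], rule ballI, simp only: U1 F C,
          erule log_connection_Pfaff[OF assms(1,2)])
    done
qed

end
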